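(* Let $p,q,\gamma$ be constants such that $1\le p<q$ and $\gamma>1$. For $M_q>0$ let $\mathcal P_{\rm exp}(q,\gamma,M_q)$ be the class of probability measures $\mu$ on $L_2=\{x\in\mathbb R^\infty:\sum_{m\ge1}x_m^2<\infty\}$ satisfying $$\mathbb E_{X\sim\mu}\left[\sum_{m=1}^\infty\left(\gamma^{m-1}X_m\right)^2\right]^{q/2}\le M_q^q .$$ Then there exist positive constants $\underline c_{p,q,\gamma}$ and $\bar c_{p,q,\gamma}$ depending only on $(p,q,\gamma)$ such that, for all $M_q>0$ and all sample sizes $n\in\mathbb N$, $$\underline c_{p,q,\gamma}\,M_q\,e^{-\sqrt{2\log\gamma\,\log n}}\le\sup_{\mu\in\mathcal P_{\rm exp}(q,\gamma,M_q)}\mathbb E\,W_p(\hat\mu,\mu)\le\bar c_{p,q,\gamma}\,M_q\,e^{-\sqrt{2\log\gamma\,\log n}},$$ where $\hat\mu$ is the empirical measure of $n$ independent samples from $\mu$.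
   Context: $L_2$ is the separable Hilbert space of square-summable sequences with norm $\|x\|=(\sum_m x_m^2)^{1/2}$; $X_m$ denotes the $m$-th coordinate of $X$. $\mathbb N$ is the set of positive integers. For probability measures $\mu,\nu$ on $L_2$ and $p\in[1,\infty)$, $W_p(\mu,\nu)=\inf_{\xi\in\mathcal C(\mu,\nu)}\left[\mathbb E_{(X,Y)\sim\xi}\|X-Y\|^p\right]^{1/p}$, where $\mathcal C(\mu,\nu)$ is the set of all distributions on $L_2\times L_2$ with marginals $\mu$ and $\nu$. The empirical measure $\hat\mu$ puts mass $1/n$ at each of $n$ independent samples from $\mu$; the expectation is over these samples. *)

theory Defs
  imports "HOL-Probability.Probability"
begin

section \<open>The Hilbert space of square-summable real sequences\<close>

text \<open>Coordinates are indexed from \<open>0\<close>: \<open>coord x m\<close> is the coordinate written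
  \<open>x\<^sub>m\<^sub>+\<^sub>1\<close> when the coordinates are indexed by the positive integers.\<close>

typedef ell2 = "{x :: nat \<Rightarrow> real. summable (\<lambda>m. (x m)\<^sup>2)}"
  morphisms coord Abs_ell2
  by (rule exI[of _ "\<lambda>_. 0"]) simp

setup_lifting type_definition_ell2

lemma ell2_eqI: "(\<And>m. coord x m = coord y m) \<Longrightarrow> x = y"
  by (metis coord_inject ext)

lemma summable_coord_square [simp]: "summable (\<lambda>m. (coord x m)\<^sup>2)"
  using coord[of x] by simp

lemma summable_mult_of_squares:
  fixes x y :: "nat \<Rightarrow> real"
  assumes "summable (\<lambda>m. (x m)\<^sup>2)" "summable (\<lambda>m. (y m)\<^sup>2)"
  shows "summable (\<lambda>m. x m * y m)"
proof (rule summable_comparison_test'[of "\<lambda>m. (x m)\<^sup>2 + (y m)\<^sup>2" 0])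
  show "summable (\<lambda>m. (x m)\<^sup>2 + (y m)\<^sup>2)"
    using assms by (rule summable_add)
  fix m
  have "2 * (\<bar>x m\<bar> * \<bar>y m\<bar>) \<le> (x m)\<^sup>2 + (y m)\<^sup>2"
    using sum_squares_bound[of "\<bar>x m\<bar>" "\<bar>y m\<bar>"] by simp
  moreover have "0 \<le> \<bar>x m\<bar> * \<bar>y m\<bar>"
    by simp
  ultimately show "norm (x m * y m) \<le> (x m)\<^sup>2 + (y m)\<^sup>2"
    unfolding real_norm_def abs_mult by linarith
qed

lemma summable_coord_mult [simp]: "summable (\<lambda>m. coord x m * coord y m)"
  by (rule summable_mult_of_squares) simp_all

lemma summable_square_add:
  fixes x y :: "nat \<Rightarrow> real"
  assumes "summable (\<lambda>m. (x m)\<^sup>2)" "summable (\<lambda>m. (y m)\<^sup>2)"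
  shows "summable (\<lambda>m. (x m + y m)\<^sup>2)"
proof -
  have "summable (\<lambda>m. (x m)\<^sup>2 + (y m)\<^sup>2 + 2 * (x m * y m))"
    by (intro summable_add summable_mult summable_mult_of_squares assms)
  then show ?thesis
    by (simp add: power2_sum mult.assoc)
qed

instantiation ell2 :: real_vector
begin

lift_definition zero_ell2 :: ell2 is "\<lambda>_. 0" by simp

lift_definition plus_ell2 :: "ell2 \<Rightarrow> ell2 \<Rightarrow> ell2" is "\<lambda>x y m. x m + y m"
  by (rule summable_square_add)

lift_definition uminus_ell2 :: "ell2 \<Rightarrow> ell2" is "\<lambda>x m. - x m" by simp

lift_definition minus_ell2 :: "ell2 \<Rightarrow> ell2 \<Rightarrow> ell2" is "\<lambda>x y m. x m - y m"
  subgoal for x y using summable_square_add[of x "\<lambda>m. - y m"] by simp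
  done

lift_definition scaleR_ell2 :: "real \<Rightarrow> ell2 \<Rightarrow> ell2" is "\<lambda>c x m. c * x m"
  by (simp add: power_mult_distrib summable_mult)

instance
  by standard (transfer; simp add: algebra_simps fun_eq_iff)+

end

lemma coord_zero [simp]: "coord 0 m = 0"
  and coord_add [simp]: "coord (x + y) m = coord x m + coord y m"
  and coord_uminus [simp]: "coord (- x) m = - coord x m"
  and coord_diff [simp]: "coord (x - y) m = coord x m - coord y m"
  and coord_scaleR [simp]: "coord (c *\<^sub>R x) m = c * coord x m"
  by (transfer; simp)+

instantiation ell2 :: real_inner
begin

definition inner_ell2 :: "ell2 \<Rightarrow> ell2 \<Rightarrow> real"
  where "inner x y = (\<Sum>m. coord x m * coord y m)"

definition norm_ell2 :: "ell2 \<Rightarrow> real"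
  where "norm x = sqrt (\<Sum>m. (coord x m)\<^sup>2)"

definition sgn_ell2 :: "ell2 \<Rightarrow> ell2"
  where "sgn (x :: ell2) = x /\<^sub>R norm x"

definition dist_ell2 :: "ell2 \<Rightarrow> ell2 \<Rightarrow> real"
  where "dist (x :: ell2) y = norm (x - y)"

definition uniformity_ell2 :: "(ell2 \<times> ell2) filter"
  where "uniformity = (INF e\<in>{0<..}. principal {(x :: ell2, y). dist x y < e})"

definition open_ell2 :: "ell2 set \<Rightarrow> bool"
  where "open (U :: ell2 set) \<longleftrightarrow> (\<forall>x\<in>U. eventually (\<lambda>(x', y). x' = x \<longrightarrow> y \<in> U) uniformity)"

instance
proof
  fix x y z :: ell2 and r :: real
  show "dist x y = norm (x - y)"
    by (rule dist_ell2_def)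
  show "sgn x = x /\<^sub>R norm x"
    by (rule sgn_ell2_def)
  show "uniformity = (INF e\<in>{0<..}. principal {(x :: ell2, y). dist x y < e})"
    by (rule uniformity_ell2_def)
  show "open U \<longleftrightarrow> (\<forall>x\<in>U. eventually (\<lambda>(x', y). x' = x \<longrightarrow> y \<in> U) uniformity)" for U :: "ell2 set"
    by (rule open_ell2_def)
  show "inner x y = inner y x"
    by (simp add: inner_ell2_def mult.commute)
  show "inner (x + y) z = inner x z + inner y z"
    by (simp add: inner_ell2_def distrib_right suminf_add)
  show "inner (r *\<^sub>R x) y = r * inner x y"
    by (simp add: inner_ell2_def mult.assoc suminf_mult)
  show "0 \<le> inner x x"
    unfolding inner_ell2_def by (rule suminf_nonneg) simp_all
  show "inner x x = 0 \<longleftrightarrow> x = 0"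
  proof
    assume "inner x x = 0"
    then have "\<forall>m. coord x m * coord x m = 0"
      unfolding inner_ell2_def by (subst (asm) suminf_eq_zero_iff) simp_all
    then show "x = 0"
      by (intro ell2_eqI) simp
  qed (simp add: inner_ell2_def)
  show "norm x = sqrt (inner x x)"
    by (simp add: norm_ell2_def inner_ell2_def power2_eq_square)
qed

end

lemma sum_coord_square_le_norm: "(\<Sum>m<k. (coord x m)\<^sup>2) \<le> (norm x)\<^sup>2"
proof -
  have "0 \<le> (\<Sum>m. (coord x m)\<^sup>2)"
    by (rule suminf_nonneg) simp_all
  moreover have "(\<Sum>m<k. (coord x m)\<^sup>2) \<le> (\<Sum>m. (coord x m)\<^sup>2)"
    by (rule sum_le_suminf) simp_all
  ultimately show ?thesis
    by (simp add: norm_ell2_def)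
qed

lemma abs_coord_le_norm: "\<bar>coord x m\<bar> \<le> norm x"
proof -
  have "(coord x m)\<^sup>2 \<le> (\<Sum>i<Suc m. (coord x i)\<^sup>2)"
    by (simp add: sum_nonneg)
  also have "\<dots> \<le> (norm x)\<^sup>2"
    by (rule sum_coord_square_le_norm)
  finally show ?thesis
    using abs_le_square_iff[of "coord x m" "norm x"] by simp
qed

instance ell2 :: complete_space
proof
  fix X :: "nat \<Rightarrow> ell2"
  assume "Cauchy X"
  have "\<exists>l. (\<lambda>n. coord (X n) i) \<longlonglongrightarrow> l" for i
  proof -
    have "Cauchy (\<lambda>n. coord (X n) i)"
    proof (rule metric_CauchyI)
      fix e :: real
      assume "0 < e"
      with \<open>Cauchy X\<close> obtain N where "\<And>m n. m \<ge> N \<Longrightarrow> n \<ge> N \<Longrightarrow> dist (X m) (X n) < e"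
        unfolding Cauchy_def by blast
      moreover have "dist (coord (X m) i) (coord (X n) i) \<le> dist (X m) (X n)" for m n
        using abs_coord_le_norm[of "X m - X n" i] by (simp add: dist_norm)
      ultimately show "\<exists>N. \<forall>m\<ge>N. \<forall>n\<ge>N. dist (coord (X m) i) (coord (X n) i) < e"
        by (meson le_less_trans)
    qed
    then show ?thesis
      by (simp add: Cauchy_convergent_iff convergent_def)
  qed
  then obtain l where l: "\<And>i. (\<lambda>n. coord (X n) i) \<longlonglongrightarrow> l i"
    by metis
  have bound: "\<exists>N. \<forall>m\<ge>N. \<forall>k. (\<Sum>i<k. (coord (X m) i - l i)\<^sup>2) \<le> e\<^sup>2" if "0 < e" for e :: real
  proof -
    obtain N where N: "\<And>m n. m \<ge> N \<Longrightarrow> n \<ge> N \<Longrightarrow> dist (X m) (X n) < e"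
      using \<open>Cauchy X\<close> \<open>0 < e\<close> unfolding Cauchy_def by blast
    have "(\<Sum>i<k. (coord (X m) i - l i)\<^sup>2) \<le> e\<^sup>2" if "m \<ge> N" for m k
    proof (rule LIMSEQ_le_const2)
      show "(\<lambda>n. \<Sum>i<k. (coord (X m) i - coord (X n) i)\<^sup>2) \<longlonglongrightarrow> (\<Sum>i<k. (coord (X m) i - l i)\<^sup>2)"
        by (intro tendsto_intros l)
      have "(\<Sum>i<k. (coord (X m) i - coord (X n) i)\<^sup>2) \<le> e\<^sup>2" if "n \<ge> N" for n
      proof -
        have "(\<Sum>i<k. (coord (X m - X n) i)\<^sup>2) \<le> (norm (X m - X n))\<^sup>2"
          by (rule sum_coord_square_le_norm)
        also have "\<dots> \<le> e\<^sup>2"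
          using N[OF \<open>m \<ge> N\<close> that] by (intro power_mono) (simp_all add: dist_norm)
        finally show ?thesis
          by simp
      qed
      then show "\<exists>N. \<forall>n\<ge>N. (\<Sum>i<k. (coord (X m) i - coord (X n) i)\<^sup>2) \<le> e\<^sup>2"
        by blast
    qed
    then show ?thesis
      by blast
  qed
  obtain M where M: "\<And>k. (\<Sum>i<k. (coord (X M) i - l i)\<^sup>2) \<le> 1"
    using bound[of 1] by auto
  have "summable (\<lambda>i. (coord (X M) i - l i)\<^sup>2)"
    by (rule summableI_nonneg_bounded[OF _ M]) simp
  then have "summable (\<lambda>i. (l i - coord (X M) i)\<^sup>2)"
    by (simp add: power2_commute)
  from summable_square_add[OF this summable_coord_square[of "X M"]]
  have "summable (\<lambda>i. (l i)\<^sup>2)"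
    by simp
  then have L: "coord (Abs_ell2 l) = l"
    by (simp add: Abs_ell2_inverse)
  have "X \<longlonglongrightarrow> Abs_ell2 l"
  proof (rule metric_LIMSEQ_I)
    fix e :: real
    assume "0 < e"
    then obtain N where N: "\<And>m k. m \<ge> N \<Longrightarrow> (\<Sum>i<k. (coord (X m) i - l i)\<^sup>2) \<le> (e / 2)\<^sup>2"
      using bound[of "e / 2"] by auto
    have "dist (X m) (Abs_ell2 l) < e" if "m \<ge> N" for m
    proof -
      have "(\<Sum>i. (coord (X m - Abs_ell2 l) i)\<^sup>2) \<le> (e / 2)\<^sup>2"
        using N[OF that] by (intro suminf_le_const summable_coord_square) (simp add: L)
      then have "norm (X m - Abs_ell2 l) \<le> e / 2"
        unfolding norm_ell2_def using \<open>0 < e\<close> by (intro real_le_lsqrt) simp_all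
      then show ?thesis
        using \<open>0 < e\<close> by (simp add: dist_norm)
    qed
    then show "\<exists>N. \<forall>m\<ge>N. dist (X m) (Abs_ell2 l) < e"
      by blast
  qed
  then show "convergent X"
    by (auto simp: convergent_def)
qed

instance ell2 :: banach ..

lift_definition rat_list_ell2 :: "rat list \<Rightarrow> ell2"
  is "\<lambda>rs m. if m < length rs then real_of_rat (rs ! m) else 0"
  subgoal for rs
    by (rule summable_finite[of "{..<length rs}"]) auto
  done

lemma rat_list_ell2_dense:
  assumes "0 < e"
  shows "\<exists>rs. dist x (rat_list_ell2 rs) < e"
proof -
  obtain N where N: "\<bar>\<Sum>i. (coord x (i + N))\<^sup>2\<bar> < e\<^sup>2 / 2"
    using suminf_exist_split[of "e\<^sup>2 / 2" "\<lambda>m. (coord x m)\<^sup>2"] assms by auto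
  define d where "d = e / sqrt (2 * (real N + 1))"
  have d: "0 < d" "d\<^sup>2 = e\<^sup>2 / (2 * (real N + 1))"
    using assms by (auto simp: d_def power_divide)
  have "\<exists>r. \<bar>coord x i - real_of_rat r\<bar> < d" for i
  proof -
    obtain r where "coord x i - d < real_of_rat r" "real_of_rat r < coord x i"
      using of_rat_dense[of "coord x i - d" "coord x i"] d(1) by auto
    then show ?thesis
      by (intro exI[of _ r]) simp
  qed
  then obtain r where r: "\<And>i. \<bar>coord x i - real_of_rat (r i)\<bar> < d"
    by metis
  define y where "y = rat_list_ell2 (map r [0..<N])"
  have y: "coord y i = (if i < N then real_of_rat (r i) else 0)" for i
    unfolding y_def by transfer simp
  have "(\<Sum>i<N. (coord (x - y) i)\<^sup>2) \<le> (\<Sum>i<N. d\<^sup>2)"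
  proof (rule sum_mono)
    fix i
    assume "i \<in> {..<N}"
    then show "(coord (x - y) i)\<^sup>2 \<le> d\<^sup>2"
      using r[of i] d(1) by (simp add: y flip: abs_le_square_iff)
  qed
  also have "\<dots> = e\<^sup>2 / 2 * (real N / (real N + 1))"
    by (simp add: d(2))
  also have "\<dots> \<le> e\<^sup>2 / 2 * 1"
    by (intro mult_left_mono) simp_all
  finally have head: "(\<Sum>i<N. (coord (x - y) i)\<^sup>2) \<le> e\<^sup>2 / 2"
    by simp
  have "(\<Sum>i. (coord (x - y) i)\<^sup>2)
      = (\<Sum>i. (coord (x - y) (i + N))\<^sup>2) + (\<Sum>i<N. (coord (x - y) i)\<^sup>2)"
    by (rule suminf_split_initial_segment[OF summable_coord_square])
  also have "(\<Sum>i. (coord (x - y) (i + N))\<^sup>2) = (\<Sum>i. (coord x (i + N))\<^sup>2)"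
    by (simp add: y)
  finally have "(\<Sum>i. (coord (x - y) i)\<^sup>2) < e\<^sup>2"
    using head N by linarith
  then have "norm (x - y) < e"
    unfolding norm_ell2_def using assms by (intro real_less_lsqrt) simp_all
  then show ?thesis
    unfolding y_def dist_norm by blast
qed

instance ell2 :: second_countable_topology
proof
  define B where "B = range (\<lambda>(rs, n). ball (rat_list_ell2 rs) (1 / real (Suc n)))"
  have "countable B"
    unfolding B_def by simp
  moreover have "topological_basis B"
  proof (rule topological_basisI)
    show "open U" if "U \<in> B" for U
      using that by (auto simp: B_def)
    fix U :: "ell2 set" and x
    assume "open U" "x \<in> U"
    then obtain e where e: "0 < e" "ball x e \<subseteq> U"
      using open_contains_ball by blast
    then obtain n where n: "1 / real (Suc n) < e / 2"
      using nat_approx_posE[of "e / 2"] by auto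
    obtain rs where rs: "dist x (rat_list_ell2 rs) < 1 / real (Suc n)"
      using rat_list_ell2_dense[of "1 / real (Suc n)" x] by auto
    let ?V = "ball (rat_list_ell2 rs) (1 / real (Suc n))"
    have "?V \<subseteq> ball x e"
    proof
      fix z
      assume "z \<in> ?V"
      then have "dist (rat_list_ell2 rs) z < 1 / real (Suc n)"
        by simp
      then have "dist x z < e"
        using rs n dist_triangle[of x z "rat_list_ell2 rs"] by linarith
      then show "z \<in> ball x e"
        by simp
    qed
    moreover have "x \<in> ?V"
      using rs by (simp add: dist_commute)
    moreover have "?V \<in> B"
      unfolding B_def by (rule range_eqI[of _ _ "(rs, n)"]) simp
    ultimately show "\<exists>V\<in>B. x \<in> V \<and> V \<subseteq> U"
      using e(2) by blast
  qed
  ultimately show "\<exists>B :: ell2 set set. countable B \<and> open = generate_topology B"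
    using topological_basis_imp_subbasis by blast
qed

instance ell2 :: polish_space ..


section \<open>Wasserstein distance and empirical measures\<close>

text \<open>The power \<open>a\<^sup>r\<close> for \<open>a \<in> [0, \<infinity>]\<close>; only used for exponents \<open>r > 0\<close>.\<close>

definition ennreal_powr :: "ennreal \<Rightarrow> real \<Rightarrow> ennreal"
  where "ennreal_powr a r = (if a = top then top else ennreal (enn2real a powr r))"

definition prob_measures :: "'a::topological_space measure set"
  where "prob_measures = {\<mu>. prob_space \<mu> \<and> sets \<mu> = sets borel}"

definition couplings ::
    "'a::second_countable_topology measure \<Rightarrow> 'a measure \<Rightarrow> ('a \<times> 'a) measure set"
  where "couplings \<mu> \<nu> =
    {\<xi>. prob_space \<xi> \<and> sets \<xi> = sets (borel \<Otimes>\<^sub>M borel) \<and>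
        distr \<xi> borel fst = \<mu> \<and> distr \<xi> borel snd = \<nu>}"

definition wasserstein ::
    "real \<Rightarrow> 'a::{real_normed_vector, second_countable_topology} measure \<Rightarrow> 'a measure \<Rightarrow> ennreal"
  where "wasserstein p \<mu> \<nu> =
    (INF \<xi>\<in>couplings \<mu> \<nu>.
      ennreal_powr (\<integral>\<^sup>+ (x, y). ennreal (norm (x - y) powr p) \<partial>\<xi>) (1 / p))"

text \<open>The push-forward of the uniform distribution on \<open>{0, \<dots>, n - 1}\<close> under \<open>i \<mapsto> x i\<close>, that is,
  mass \<open>1 / n\<close> at each of \<open>x 0, \<dots>, x (n - 1)\<close>, counted with multiplicity.\<close>

definition empirical_measure :: "nat \<Rightarrow> (nat \<Rightarrow> 'a::topological_space) \<Rightarrow> 'a measure"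
  where "empirical_measure n x = distr (uniform_count_measure {..<n}) borel x"

definition expected_wasserstein ::
    "real \<Rightarrow> nat \<Rightarrow> 'a::{real_normed_vector, second_countable_topology} measure \<Rightarrow> ennreal"
  where "expected_wasserstein p n \<mu> =
    (\<integral>\<^sup>+ x. wasserstein p (empirical_measure n x) \<mu> \<partial>(\<Pi>\<^sub>M i\<in>{..<n}. \<mu>))"


section \<open>Measures with exponentially decaying coordinates\<close>

text \<open>The weight of \<open>coord x m\<close> is \<open>\<gamma> ^ m\<close> because of the indexing from \<open>0\<close>. The inner series is
  taken in \<open>[0, \<infinity>]\<close>, since it may diverge for a square-summable sequence.\<close>

definition P_exp :: "real \<Rightarrow> real \<Rightarrow> real \<Rightarrow> ell2 measure set"
  where "P_exp q \<gamma> M =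
    {\<mu> \<in> prob_measures.
      (\<integral>\<^sup>+ x. ennreal_powr (\<Sum>m. ennreal ((\<gamma> ^ m * coord x m)\<^sup>2)) (q / 2) \<partial>\<mu>) \<le> ennreal (M powr q)}"

end

theory Submission
  imports Defs
begin

text \<open>Write \<open>E = {y. \<Sum>\<^sub>m (\<gamma>\<^sup>m y\<^sub>m)\<^sup>2 \<le> 1}\<close>. At scale \<open>\<gamma>\<^sup>-\<^sup>j\<close> the ellipsoid \<open>E\<close> has entropy
  \<open>j\<^sup>2/2 \<cdot> ln \<gamma> + O(j)\<close>: the lattice of mesh \<open>\<gamma>\<^sup>-\<^sup>j / \<surd>j\<close> in the first \<open>j\<close> coordinates is
  fine enough, and a Chernoff bound with a Gaussian sum counts its points in \<open>E\<close> up to a factor \<open>72\<^sup>j\<close>.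
  Balancing the entropy with \<open>ln n\<close> gives the critical level \<open>j = \<surd>(2 ln n / ln \<gamma>) + O(1)\<close>, where
  \<open>\<gamma>\<^sup>-\<^sup>j\<close> is of the order of the claimed rate.

  For the upper bound, space is cut into dyadic shells, and each rescaled shell into nested cells of
  diameter \<open>O(\<gamma>\<^sup>-\<^sup>j)\<close>. Matching the mass of the empirical measure and of \<open>\<mu>\<close> greedily, first inside the
  finest cells and then what is left over inside coarser and coarser ones, moves across a distance
  \<open>\<gamma>\<^sup>-\<^sup>j\<close> only the total deviation of the empirical frequencies of the cells one level below. The
  deviations of \<open>N\<close> cells of total mass \<open>a\<close> add up to at most \<open>min (2 a) (\<surd>(N a / n))\<close> on average; a
  geometric mean of the two bounds remains summable over the shells because \<open>p < q\<close>, and over the levels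
  because the entropy is quadratic in \<open>j\<close>.

  For the lower bound, \<open>\<mu>\<close> is uniform on a grid of at least \<open>\<gamma>\<^sup>k\<^sup>(\<^sup>k\<^sup>+\<^sup>1\<^sup>)\<^sup>/\<^sup>2\<close> points of the ellipsoid, and the
  same Chernoff bound shows that \<open>n\<close> balls of radius \<open>M \<gamma>\<^sup>-\<^sup>k\<close> cover at most half of them, whatever
  their centres.\<close>


section \<open>Counting lattice points\<close>


text \<open>Two geometric series of ratio \<open>exp (- b)\<close>, one for each sign and both
  containing 0. Each is at most \<open>2 / b\<close>, because \<open>b \<le> 1\<close> gives
  \<open>1 - exp (- b) \<ge> b / 2\<close>.\<close>

lemma sum_exp_neg_abs_int_le:
  fixes b :: real
  assumes "0 < b" "b \<le> 1" "finite S"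
  shows "(\<Sum>i\<in>S. exp (- (b * \<bar>real_of_int i\<bar>))) \<le> 4 / b"
proof -
  define r where "r = exp (- b)"
  have r: "0 < r" "r < 1" using assms by (auto simp: r_def)
  obtain N :: nat where N: "\<And>i. i \<in> S \<Longrightarrow> nat \<bar>i\<bar> < N"
    using finite_nat_bounded[of "(\<lambda>i. nat \<bar>i\<bar>) ` S"] \<open>finite S\<close> by auto
  have geo: "(\<Sum>n<N. r ^ n) \<le> 2 / b"
  proof -
    have "1 + b \<le> exp b" by (rule exp_ge_add_one_self)
    then have "r \<le> 1 / (1 + b)"
      using assms by (simp add: r_def exp_minus field_simps)
    moreover have "b / 2 \<le> 1 - 1 / (1 + b)"
      using assms mult_mono[of b 1 b b] by (simp add: field_simps)
    ultimately have "b / 2 \<le> 1 - r" by linarith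
    then have "1 / (1 - r) \<le> 2 / b"
      using assms r by (simp add: field_simps)
    moreover have "(\<Sum>n<N. r ^ n) \<le> (\<Sum>n. r ^ n)"
      using r by (intro sum_le_suminf) (auto simp: summable_geometric)
    ultimately show ?thesis using r by (simp add: suminf_geometric)
  qed
  have e: "exp (- (b * \<bar>real_of_int i\<bar>)) = r ^ nat \<bar>i\<bar>" for i
    by (simp add: r_def flip: exp_of_nat_mult)
  have "(\<Sum>i\<in>S. exp (- (b * \<bar>real_of_int i\<bar>))) \<le> (\<Sum>i\<in>int ` {..<N} \<union> (\<lambda>n. - int n) ` {..<N}. r ^ nat \<bar>i\<bar>)"
    unfolding e
  proof (rule sum_mono2)
    show "S \<subseteq> int ` {..<N} \<union> (\<lambda>n. - int n) ` {..<N}"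
    proof
      fix i assume "i \<in> S"
      then have "nat \<bar>i\<bar> < N" by (rule N)
      then show "i \<in> int ` {..<N} \<union> (\<lambda>n. - int n) ` {..<N}"
        by (cases "0 \<le> i") (auto simp: image_iff intro: bexI[of _ "nat \<bar>i\<bar>"])
    qed
  qed (use r in auto)
  also have "\<dots> \<le> (\<Sum>i\<in>int ` {..<N}. r ^ nat \<bar>i\<bar>) + (\<Sum>i\<in>(\<lambda>n. - int n) ` {..<N}. r ^ nat \<bar>i\<bar>)"
  proof -
    have "sum f (A \<union> B) \<le> sum f A + sum f B" if "finite A" "finite B" "\<And>x. 0 \<le> f x"
      for f :: "int \<Rightarrow> real" and A B
      using sum.union_inter[OF that(1,2), of f] sum_nonneg[of "A \<inter> B" f] that(3) by auto
    then show ?thesis using r by simp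
  qed
  also have "\<dots> = (\<Sum>n<N. r ^ n) + (\<Sum>n<N. r ^ n)"
    by (subst (1 2) sum.reindex) (auto simp: inj_on_def)
  also have "\<dots> \<le> 4 / b" using geo by simp
  finally show ?thesis .
qed

text \<open>The inequality \<open>u\<^sup>2 \<ge> \<bar>u\<bar> - 1/4\<close> replaces the Gaussian
  by a two-sided exponential, and moving the centre to the lattice point \<open>b * j\<close> costs
  at most 1 in the exponent. The bound is uniform in \<open>c\<close>, which allows balls with
  arbitrary centres later.\<close>

lemma sum_gauss_int_le:
  fixes b c :: real
  assumes "0 < b" "b \<le> 1" "finite S"
  shows "(\<Sum>i\<in>S. exp (- (b * real_of_int i - c)\<^sup>2)) \<le> 24 / b"
proof -
  define j where "j = \<lfloor>c / b\<rfloor>"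
  have j: "b * real_of_int j \<le> c" "c \<le> b * real_of_int j + b"
    using assms floor_divide_lower[of b c] floor_divide_upper[of b c]
    by (auto simp: j_def algebra_simps)
  have "(\<Sum>i\<in>S. exp (- (b * real_of_int i - c)\<^sup>2))
      \<le> (\<Sum>i\<in>S. 6 * exp (- (b * \<bar>real_of_int (i - j)\<bar>)))"
  proof (rule sum_mono)
    fix i
    let ?u = "b * real_of_int i - c"
    have "0 \<le> (\<bar>?u\<bar> - 1/2)\<^sup>2" by simp
    then have "\<bar>?u\<bar> - 1/4 \<le> ?u\<^sup>2"
      by (simp add: power2_diff power2_eq_square algebra_simps flip: abs_mult)
    moreover have "b * \<bar>real_of_int (i - j)\<bar> - 1 \<le> \<bar>?u\<bar>"
    proof -
      have "b * \<bar>real_of_int (i - j)\<bar> = \<bar>b * real_of_int i - b * real_of_int j\<bar>"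
        using assms by (simp add: abs_mult flip: right_diff_distrib)
      then show ?thesis using j assms by linarith
    qed
    ultimately have "exp (- ?u\<^sup>2) \<le> exp (5/4 + - (b * \<bar>real_of_int (i - j)\<bar>))"
      by simp
    also have "\<dots> \<le> 6 * exp (- (b * \<bar>real_of_int (i - j)\<bar>))"
    proof -
      have "exp (5/4::real) \<le> exp (1 + 1)" by simp
      also have "exp (1 + 1 :: real) = exp 1 * exp 1" by (rule exp_add)
      finally have *: "exp (5/4::real) \<le> exp 1 * exp 1" .
      \<comment> \<open>\<open>exp_bound\<close> requires an argument at most 1, so 5/4 is halved
        and the estimate squared.\<close>
      have "exp (5/8::real) \<le> 1 + 5/8 + (5/8)\<^sup>2" by (rule exp_bound) auto
      then have "exp (5/8::real) * exp (5/8) \<le> (1 + 5/8 + (5/8)\<^sup>2) * (1 + 5/8 + (5/8)\<^sup>2)"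
        by (intro mult_mono) auto
      then have "exp (5/4::real) \<le> 6"
        by (simp flip: exp_add add: power2_eq_square)
      then show ?thesis by (subst exp_add) (simp add: mult_right_mono)
    qed
    finally show "exp (- ?u\<^sup>2) \<le> 6 * exp (- (b * \<bar>real_of_int (i - j)\<bar>))" .
  qed
  also have "\<dots> = 6 * (\<Sum>i\<in>(\<lambda>i. i - j) ` S. exp (- (b * \<bar>real_of_int i\<bar>)))"
    by (subst sum.reindex) (auto simp: inj_on_def sum_distrib_left)
  also have "\<dots> \<le> 6 * (4 / b)"
    using assms by (intro mult_left_mono sum_exp_neg_abs_int_le) auto
  finally show ?thesis by simp
qed

text \<open>The triangular exponent is the quadratic entropy; it enters both the count of codes and
  the size of the grid.\<close>

lemma prod_powr_triangle:
  fixes \<gamma> :: real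
  assumes "0 < \<gamma>"
  shows "(\<Prod>m<j. \<gamma> ^ (j - m)) = \<gamma> powr (real j * (real j + 1) / 2)"
proof -
  have "(\<Prod>m<j. \<gamma> ^ (j - m)) = \<gamma> ^ (\<Sum>m<j. j - m)" by (simp add: power_sum)
  also have "(\<Sum>m<j. j - m) = (\<Sum>m<j. Suc m)"
    by (rule sum.reindex_bij_witness[of _ "\<lambda>m. j - Suc m" "\<lambda>m. j - Suc m"]) auto
  also have "\<gamma> ^ (\<Sum>m<j. Suc m) = \<gamma> powr real (\<Sum>m<j. Suc m)"
    using assms by (simp add: powr_realpow del: of_nat_sum)
  also have "real (\<Sum>m<j. Suc m) = real j * (real j + 1) / 2"
    by (induction j) (auto simp: field_simps)
  finally show ?thesis .
qed

text \<open>Chernoff bound: each counted point contributes at least \<open>1\<close> to the sum of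
  \<open>exp (j - \<Sum>\<^sub>m (b\<^sub>m z\<^sub>m - c\<^sub>m)\<^sup>2)\<close>, which factorises over the coordinates.\<close>

lemma card_gauss_le:
  fixes b c :: "nat \<Rightarrow> real" and P :: "(nat \<Rightarrow> int) set"
  assumes b: "\<And>m. m < j \<Longrightarrow> 0 < b m \<and> b m \<le> 1"
    and P: "finite P" "P \<subseteq> extensional {..<j}"
    and close: "\<And>z. z \<in> P \<Longrightarrow> (\<Sum>m<j. (b m * real_of_int (z m) - c m)\<^sup>2) \<le> real j"
  shows "real (card P) \<le> 72 ^ j * (\<Prod>m<j. 1 / b m)"
proof -
  \<comment> \<open>\<open>P\<close> is enlarged to the box of its coordinate projections, over
    which the sum of products factorises.\<close>
  define S where "S m = (\<lambda>z. z m) ` P" for m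
  have S: "finite (S m)" for m using P by (simp add: S_def)
  have PS: "P \<subseteq> PiE {..<j} S"
    using P by (auto simp: PiE_def S_def)
  have "real (card P) = (\<Sum>z\<in>P. 1)" by simp
  also have "\<dots> \<le> (\<Sum>z\<in>P. exp (real j) * (\<Prod>m<j. exp (- (b m * real_of_int (z m) - c m)\<^sup>2)))"
  proof (rule sum_mono)
    fix z assume "z \<in> P"
    then show "1 \<le> exp (real j) * (\<Prod>m<j. exp (- (b m * real_of_int (z m) - c m)\<^sup>2))"
      using close[of z] by (simp add: sum_negf flip: exp_sum exp_add)
  qed
  also have "\<dots> \<le> (\<Sum>z\<in>PiE {..<j} S. exp (real j) * (\<Prod>m<j. exp (- (b m * real_of_int (z m) - c m)\<^sup>2)))"
    using PS S by (intro sum_mono2 finite_PiE) (auto intro!: mult_nonneg_nonneg prod_nonneg)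
  also have "\<dots> = exp (real j) * (\<Prod>m<j. \<Sum>i\<in>S m. exp (- (b m * real_of_int i - c m)\<^sup>2))"
    using S by (subst prod_sum_PiE) (auto simp: sum_distrib_left)
  \<comment> \<open>Each coordinate contributes \<open>exp 1 \<le> 3\<close> from the Chernoff
    factor and \<open>24 / b m\<close> from the Gaussian sum; hence 72.\<close>
  also have "\<dots> \<le> 3 ^ j * (\<Prod>m<j. 24 / b m)"
  proof (intro mult_mono prod_mono conjI)
    have "exp (real j) = exp 1 ^ j" by (simp flip: exp_of_nat_mult)
    also have "\<dots> \<le> 3 ^ j" by (intro power_mono exp_le) auto
    finally show "exp (real j) \<le> 3 ^ j" .
  qed (use b S in \<open>auto intro!: sum_gauss_int_le sum_nonneg prod_nonneg\<close>)
  also have "\<dots> = 72 ^ j * (\<Prod>m<j. 1 / b m)"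
  proof -
    have "(\<Prod>m<j. 24 / b m) = 24 ^ j * (\<Prod>m<j. 1 / b m)"
      by (simp add: prod_dividef)
    then show ?thesis by (simp flip: power_mult_distrib mult.assoc)
  qed
  finally show ?thesis .
qed


section \<open>Greedy matching along increasingly coarse partitions\<close>

text \<open>After steps \<open>0, \<dots>, t - 1\<close> the unmatched part of \<open>M\<close> has density \<open>resid c t M N\<close> with respect to
  \<open>M\<close>, and that of \<open>N\<close> has density \<open>resid c t N M\<close> with respect to \<open>N\<close>. Step \<open>t\<close> couples, inside each
  cell of the partition by \<open>c t\<close>, these two parts by a multiple of their product, so that the lighter
  of the two is used up. On cells without residual mass the quotient is \<open>0/0 = 0\<close>.\<close>

primrec resid :: "(nat \<Rightarrow> 'a \<Rightarrow> 'i) \<Rightarrow> nat \<Rightarrow> 'a measure \<Rightarrow> 'a measure \<Rightarrow> 'a \<Rightarrow> real" where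
  "resid c 0 = (\<lambda>M N x. 1)"
| "resid c (Suc t) = (\<lambda>M N x. resid c t M N x *
     (1 - (\<integral>y. resid c t N M y * indicator {y. c t y = c t x} y \<partial>N) /
       max (\<integral>y. resid c t M N y * indicator {y. c t y = c t x} y \<partial>M)
           (\<integral>y. resid c t N M y * indicator {y. c t y = c t x} y \<partial>N)))"

text \<open>The labelling \<open>d\<close> is independent of \<open>c\<close> because the mass
  balance below concerns cells coarser than those matched so far.\<close>

definition resid_mass ::
    "(nat \<Rightarrow> 'a \<Rightarrow> 'i) \<Rightarrow> nat \<Rightarrow> 'a measure \<Rightarrow> 'a measure \<Rightarrow> ('a \<Rightarrow> 'j) \<Rightarrow> 'j \<Rightarrow> real" where
  "resid_mass c t M N d i = (\<integral>x. resid c t M N x * indicator {x. d x = i} x \<partial>M)"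

definition match_density ::
    "(nat \<Rightarrow> 'a \<Rightarrow> 'i) \<Rightarrow> nat \<Rightarrow> 'a measure \<Rightarrow> 'a measure \<Rightarrow> 'a \<Rightarrow> 'a \<Rightarrow> real" where
  "match_density c t M N x y =
    (if c t x = c t y
     then resid c t M N x * resid c t N M y /
       max (resid_mass c t M N (c t) (c t x)) (resid_mass c t N M (c t) (c t x))
     else 0)"

text \<open>The recursion has to spell out its integrals because \<open>resid_mass\<close> is
  defined from \<open>resid\<close>; from here on this folded form is used.\<close>

lemma resid_Suc:
  "resid c (Suc t) M N x = resid c t M N x *
     (1 - resid_mass c t N M (c t) (c t x) /
       max (resid_mass c t M N (c t) (c t x)) (resid_mass c t N M (c t) (c t x)))"
  by (simp add: resid_mass_def)

declare resid.simps(2) [simp del]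

lemma match_density_swap: "match_density c t M N x y = match_density c t N M y x"
  by (auto simp: match_density_def max.commute mult.commute)

text \<open>\<open>coarser\<close> says that the partitions are nested. Countably many labels make
  lying in the same cell a measurable relation on the product, and \<open>space_UNIV\<close> allows
  cells to be written as plain sets \<open>{x. c t x = i}\<close>.\<close>

locale matching = M: prob_space M + N: prob_space N for M N :: "'a measure" +
  fixes c :: "nat \<Rightarrow> 'a \<Rightarrow> 'i::countable"
  assumes sets_eq: "sets N = sets M"
    and space_UNIV: "space M = UNIV"
    and measurable_label [measurable]: "c t \<in> measurable M (count_space UNIV)"
    and coarser: "c t x = c t y \<Longrightarrow> c (Suc t) x = c (Suc t) y"
begin

lemma measurable_label' [measurable]: "c t \<in> measurable N (count_space UNIV)"
  using measurable_label[of t] measurable_cong_sets[OF sets_eq refl] by blast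

text \<open>One-sided facts are proved for \<open>M\<close> and transferred to \<open>N\<close> by
  this symmetry.\<close>

lemma swap: "matching N M c"
proof
  show "sets M = sets N" by (simp add: sets_eq)
  show "space N = UNIV" using sets_eq_imp_space_eq[OF sets_eq] space_UNIV by simp
qed (use measurable_label' coarser in blast)+

lemma resid_mass_nonneg_gen:
  assumes "\<And>x. 0 \<le> resid c t M N x"
  shows "0 \<le> resid_mass c t M N d i"
  unfolding resid_mass_def using assms by (intro integral_nonneg_AE) auto

text \<open>Both residuals go through one induction, since the factor in the recursion involves the
  masses of both. That factor depends on the point only through its discrete label, which gives
  measurability.\<close>

lemma resid_props:
  "(resid c t M N \<in> borel_measurable M \<and> resid c t N M \<in> borel_measurable M) \<and>
   (\<forall>x. 0 \<le> resid c t M N x \<and> resid c t M N x \<le> 1 \<and> 0 \<le> resid c t N M x \<and> resid c t N M x \<le> 1)"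
proof (induction t)
  case 0
  show ?case by simp
next
  case (Suc t)
  interpret S: matching N M c by (rule swap)
  have [measurable]: "resid c t M N \<in> borel_measurable M" "resid c t N M \<in> borel_measurable M"
    using Suc by auto
  let ?m = "resid_mass c t M N (c t)" and ?n = "resid_mass c t N M (c t)"
  have m: "(\<lambda>x. g (c t x)) \<in> borel_measurable M" for g :: "'i \<Rightarrow> real"
    by (rule measurable_compose[OF measurable_label]) simp
  have nn: "0 \<le> ?m i" "0 \<le> ?n i" for i
    using Suc by (auto intro!: resid_mass_nonneg_gen S.resid_mass_nonneg_gen)
  \<comment> \<open>The case \<open>max a b = 0\<close> is included: the quotient is then 0 and the
    factor 1.\<close>
  have q: "0 \<le> 1 - a / max a b" "1 - a / max a b \<le> 1" "0 \<le> 1 - b / max a b" "1 - b / max a b \<le> 1"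
    if "0 \<le> a" "0 \<le> b" for a b :: real
    using that by (auto simp: divide_le_eq_1 max_def zero_le_divide_iff)
  have qm: "0 \<le> 1 - ?m i / max (?m i) (?n i)" "1 - ?m i / max (?m i) (?n i) \<le> 1"
    "0 \<le> 1 - ?n i / max (?m i) (?n i)" "1 - ?n i / max (?m i) (?n i) \<le> 1" for i
    using q[OF nn] by auto
  have "resid c (Suc t) M N \<in> borel_measurable M" "resid c (Suc t) N M \<in> borel_measurable M"
    unfolding resid_Suc[abs_def]
    using m[of "\<lambda>i. 1 - ?n i / max (?m i) (?n i)"] m[of "\<lambda>i. 1 - ?m i / max (?n i) (?m i)"]
    by (auto intro!: borel_measurable_times)
  moreover have "0 \<le> resid c (Suc t) M N x \<and> resid c (Suc t) M N x \<le> 1 \<and>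
      0 \<le> resid c (Suc t) N M x \<and> resid c (Suc t) N M x \<le> 1" for x
  proof -
    have *: "0 \<le> a * b \<and> a * b \<le> 1" if "0 \<le> a" "a \<le> 1" "0 \<le> b" "b \<le> 1" for a b :: real
      using that mult_mono[of a 1 b 1] by auto
    show ?thesis
      unfolding resid_Suc
      using *[OF _ _ qm(3,4)[of "c t x"]] *[OF _ _ qm(1,2)[of "c t x"]] Suc
      by (auto simp: max.commute)
  qed
  ultimately show ?case by blast
qed

lemma measurable_resid [measurable]: "resid c t M N \<in> borel_measurable M"
  and measurable_resid' [measurable]: "resid c t N M \<in> borel_measurable M"
  and resid_nonneg: "0 \<le> resid c t M N x" and resid_le_1: "resid c t M N x \<le> 1"
  using resid_props by auto

lemma measurable_cell: "Measurable.pred M (\<lambda>x. P (c t x))"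
  using measurable_compose[OF measurable_label[of t], of P "count_space UNIV"] by simp

lemma resid_mass_nonneg: "0 \<le> resid_mass c t M N d i"
  by (rule resid_mass_nonneg_gen) (rule resid_nonneg)

lemma integrable_resid_indicator:
  assumes "Measurable.pred M P"
  shows "integrable M (\<lambda>x. resid c t M N x * indicator {x. P x} x)"
proof (rule M.integrable_const_bound[where B = 1])
  show "(\<lambda>x. resid c t M N x * indicator {x. P x} x) \<in> borel_measurable M"
    using assms space_UNIV by measurable
  show "AE x in M. norm (resid c t M N x * indicator {x. P x} x) \<le> 1"
    using resid_nonneg resid_le_1 by (auto simp: indicator_def)
qed

lemma nn_integral_resid_indicator:
  assumes "Measurable.pred M (\<lambda>x. d x = i)"
  shows "(\<integral>\<^sup>+x. ennreal (resid c t M N x * indicator {x. d x = i} x) \<partial>M) = ennreal (resid_mass c t M N d i)"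
  unfolding resid_mass_def
  by (intro nn_integral_eq_integral integrable_resid_indicator assms)
     (use resid_nonneg in \<open>auto simp: indicator_def\<close>)

lemma measurable_match_density [measurable]:
  "(\<lambda>(x, y). match_density c t M N x y) \<in> borel_measurable (M \<Otimes>\<^sub>M N)"
proof -
  interpret S: matching N M c by (rule swap)
  have [measurable]: "(\<lambda>x. max (resid_mass c t M N (c t) (c t x)) (resid_mass c t N M (c t) (c t x))) \<in> borel_measurable M"
    by (rule measurable_compose[OF measurable_label]) simp
  have [measurable]: "(\<lambda>y. resid c t N M y) \<in> borel_measurable N"
    by (rule S.measurable_resid)
  have [measurable]: "Measurable.pred (M \<Otimes>\<^sub>M N) (\<lambda>p. c t (fst p) = c t (snd p))"
    by measurable
  show ?thesis
    unfolding match_density_def case_prod_beta by measurable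
qed

text \<open>Integrating out \<open>y\<close> turns the second residual into the cell mass
  \<open>?n\<close>, and \<open>?n / max ?m ?n\<close> is exactly the fraction that the recursion
  removes. So the matches of a step have the loss of residual density as their marginal.\<close>

lemma nn_integral_match_density:
  "(\<integral>\<^sup>+y. ennreal (match_density c t M N x y) \<partial>N) = ennreal (resid c t M N x - resid c (Suc t) M N x)"
proof -
  interpret S: matching N M c by (rule swap)
  let ?m = "resid_mass c t M N (c t) (c t x)" and ?n = "resid_mass c t N M (c t) (c t x)"
  have mx: "0 \<le> max ?m ?n" by (rule max.coboundedI1[OF resid_mass_nonneg])
  have "(\<integral>\<^sup>+y. ennreal (match_density c t M N x y) \<partial>N)
      = (\<integral>\<^sup>+y. ennreal (resid c t M N x / max ?m ?n) *
          ennreal (resid c t N M y * indicator {y. c t y = c t x} y) \<partial>N)"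
    using mx resid_nonneg S.resid_nonneg
    by (intro nn_integral_cong)
       (auto simp: match_density_def indicator_def simp flip: ennreal_mult)
  also have "\<dots> = ennreal (resid c t M N x / max ?m ?n) * ennreal ?n"
    using S.measurable_cell[of "\<lambda>i. i = c t x" t] sets_eq_imp_space_eq[OF sets_eq] space_UNIV
    by (subst nn_integral_cmult, measurable) (subst S.nn_integral_resid_indicator, simp_all)
  also have "\<dots> = ennreal (resid c t M N x * ?n / max ?m ?n)"
    using mx resid_nonneg[of t x] S.resid_mass_nonneg[of t "c t" "c t x"] by (simp flip: ennreal_mult)
  also have "resid c t M N x * ?n / max ?m ?n = resid c t M N x - resid c (Suc t) M N x"
    by (simp add: resid_Suc algebra_simps)
  finally show ?thesis .
qed

lemma nn_integral_match_density':
  "(\<integral>\<^sup>+x. ennreal (match_density c t M N x y) \<partial>M) = ennreal (resid c t N M y - resid c (Suc t) N M y)"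
proof -
  interpret S: matching N M c by (rule swap)
  show ?thesis
    using S.nn_integral_match_density[of t y] by (simp add: match_density_swap[of c t N M])
qed

lemma resid_antimono: "resid c (Suc t) M N x \<le> resid c t M N x"
proof -
  interpret S: matching N M c by (rule swap)
  show ?thesis
    unfolding resid_Suc using resid_nonneg[of t x] S.resid_mass_nonneg[of t "c t" "c t x"]
    by (intro mult_left_le) (auto intro!: divide_nonneg_nonneg simp: max.coboundedI2)
qed

lemma nn_integral_match_indicator:
  assumes "Measurable.pred M (\<lambda>x. d x = i)"
  shows "(\<integral>\<^sup>+x. \<integral>\<^sup>+y. ennreal (match_density c t M N x y) * indicator {x. d x = i} x \<partial>N \<partial>M)
    = ennreal (resid_mass c t M N d i - resid_mass c (Suc t) M N d i)"
proof -
  have "(\<integral>\<^sup>+x. \<integral>\<^sup>+y. ennreal (match_density c t M N x y) * indicator {x. d x = i} x \<partial>N \<partial>M)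
     = (\<integral>\<^sup>+x. ennreal ((resid c t M N x - resid c (Suc t) M N x) * indicator {x. d x = i} x) \<partial>M)"
    by (intro nn_integral_cong) (auto simp: indicator_def nn_integral_match_density)
  also have "\<dots> = ennreal (\<integral>x. (resid c t M N x - resid c (Suc t) M N x) * indicator {x. d x = i} x \<partial>M)"
    using integrable_resid_indicator[OF assms] resid_antimono
    by (intro nn_integral_eq_integral) (auto simp: left_diff_distrib indicator_def)
  also have "(\<integral>x. (resid c t M N x - resid c (Suc t) M N x) * indicator {x. d x = i} x \<partial>M)
     = resid_mass c t M N d i - resid_mass c (Suc t) M N d i"
    unfolding resid_mass_def left_diff_distrib
    by (intro Bochner_Integration.integral_diff integrable_resid_indicator assms)
  finally show ?thesis .
qed

lemma resid_mass_antimono: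
  assumes "Measurable.pred M (\<lambda>x. d x = i)"
  shows "resid_mass c (Suc t) M N d i \<le> resid_mass c t M N d i"
  unfolding resid_mass_def
  using integrable_resid_indicator[OF assms] resid_antimono
  by (intro integral_mono) (auto simp: indicator_def)

text \<open>Matched pairs share a cell of \<open>c t\<close> and therefore, by \<open>sat\<close>, a
  cell of \<open>d\<close>. The indicator may thus be moved from \<open>x\<close> to
  \<open>y\<close>, and Fubini shows that both sides lose the same mass.\<close>

lemma resid_mass_balance_step:
  assumes d: "Measurable.pred M (\<lambda>x. d x = i)"
    and sat: "\<And>x y. c t x = c t y \<Longrightarrow> d x = d y"
  shows "resid_mass c t M N d i - resid_mass c (Suc t) M N d i
    = resid_mass c t N M d i - resid_mass c (Suc t) N M d i"
proof -
  interpret S: matching N M c by (rule swap)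
  interpret pair_sigma_finite M N ..
  have d': "Measurable.pred N (\<lambda>x. d x = i)"
    using d measurable_cong_sets[OF sets_eq refl] by blast
  note [measurable] = d d'
  have spN: "space N = UNIV" using sets_eq_imp_space_eq[OF sets_eq] space_UNIV by simp
  have [measurable]: "{x. d x = i} \<in> sets M" "{x. d x = i} \<in> sets N"
    using d d' space_UNIV spN by (auto simp: pred_def)
  have "(\<integral>\<^sup>+x. \<integral>\<^sup>+y. ennreal (match_density c t M N x y) * indicator {x. d x = i} x \<partial>N \<partial>M)
      = (\<integral>\<^sup>+x. \<integral>\<^sup>+y. ennreal (match_density c t M N x y) * indicator {x. d x = i} y \<partial>N \<partial>M)"
    by (intro nn_integral_cong)
       (auto simp: indicator_def match_density_def dest: sat)
  also have "\<dots> = (\<integral>\<^sup>+y. \<integral>\<^sup>+x. ennreal (match_density c t M N x y) * indicator {x. d x = i} y \<partial>M \<partial>N)"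
    by (rule Fubini'[symmetric]) measurable
  also have "\<dots> = (\<integral>\<^sup>+y. \<integral>\<^sup>+x. ennreal (match_density c t N M y x) * indicator {x. d x = i} y \<partial>M \<partial>N)"
    by (simp add: match_density_swap[of c t N M])
  finally show ?thesis
    using nn_integral_match_indicator[OF d, of t] S.nn_integral_match_indicator[OF d', of t]
      resid_mass_antimono[OF d, of t] S.resid_mass_antimono[OF d', of t] by simp
qed

lemma coarser_le: "s \<le> t \<Longrightarrow> c s x = c s y \<Longrightarrow> c t x = c t y"
  by (induction rule: dec_induct) (assumption, blast intro: coarser)

text \<open>Each step removes equal masses from the two sides, so their difference stays what it was
  at the start, where both densities are 1.\<close>

lemma resid_mass_balance:
  assumes d: "Measurable.pred M (\<lambda>x. d x = i)"
    and sat: "\<And>s x y. s < t \<Longrightarrow> c s x = c s y \<Longrightarrow> d x = d y"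
  shows "resid_mass c t M N d i - resid_mass c t N M d i = measure M {x. d x = i} - measure N {x. d x = i}"
  using sat
proof (induction t)
  case 0
  have "{x. d x = i} \<in> sets M" using d space_UNIV by (auto simp: pred_def)
  moreover from this have "{x. d x = i} \<in> sets N" by (simp add: sets_eq)
  ultimately show ?case by (simp add: resid_mass_def)
next
  case (Suc t)
  have "resid_mass c t M N d i - resid_mass c t N M d i = measure M {x. d x = i} - measure N {x. d x = i}"
    by (rule Suc.IH) (blast intro: Suc.prems less_SucI)
  moreover have "resid_mass c t M N d i - resid_mass c (Suc t) M N d i
      = resid_mass c t N M d i - resid_mass c (Suc t) N M d i"
    by (rule resid_mass_balance_step[OF d]) (blast intro: Suc.prems lessI)
  ultimately show ?case by linarith
qed

text \<open>The lighter side of a cell is used up and the heavier keeps the difference. By the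
  balance this is the difference of the original masses, so the leftover does not depend on the
  earlier steps; this turns transport cost into deviations of frequencies.\<close>

lemma resid_mass_Suc:
  "resid_mass c (Suc t) M N (c t) i = max 0 (measure M {x. c t x = i} - measure N {x. c t x = i})"
proof -
  interpret S: matching N M c by (rule swap)
  let ?m = "resid_mass c t M N (c t) i" and ?n = "resid_mass c t N M (c t) i"
  have "resid_mass c (Suc t) M N (c t) i =
     (\<integral>x. (1 - ?n / max ?m ?n) * (resid c t M N x * indicator {x. c t x = i} x) \<partial>M)"
    unfolding resid_mass_def[of c "Suc t"] resid_Suc
    by (intro Bochner_Integration.integral_cong) (auto simp: indicator_def)
  also have "\<dots> = (1 - ?n / max ?m ?n) * ?m"
    by (simp add: resid_mass_def)
  also have "\<dots> = max 0 (?m - ?n)"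
    using resid_mass_nonneg[of t "c t" i] S.resid_mass_nonneg[of t "c t" i]
    by (auto simp: max_def field_simps)
  also have "?m - ?n = measure M {x. c t x = i} - measure N {x. c t x = i}"
    by (rule resid_mass_balance) (fact measurable_cell[of "\<lambda>j. j = i" t], blast intro: coarser_le less_imp_le)
  finally show ?thesis .
qed

text \<open>When all points share one cell, both measures give it mass 1 and nothing is left
  over.\<close>

lemma resid_final:
  assumes "\<And>x y. c T x = c T y"
  shows "AE x in M. resid c (Suc T) M N x = 0"
proof -
  obtain i where i: "\<And>x. c T x = i" using assms by blast
  have "resid_mass c (Suc T) M N (c T) i = 0"
    unfolding resid_mass_Suc using i M.prob_space N.prob_space space_UNIV sets_eq_imp_space_eq[OF sets_eq]
    by simp
  then have "(\<integral>x. resid c (Suc T) M N x \<partial>M) = 0"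
    using i by (simp add: resid_mass_def)
  moreover have "integrable M (resid c (Suc T) M N)"
    using integrable_resid_indicator[of "\<lambda>_. True" "Suc T"] by simp
  ultimately show ?thesis
    using integral_nonneg_eq_0_iff_AE[of M "resid c (Suc T) M N"] resid_nonneg by auto
qed

section \<open>The coupling assembled from all steps, and its cost\<close>

definition coupling :: "nat \<Rightarrow> ('a \<times> 'a) measure" where
  "coupling T = density (M \<Otimes>\<^sub>M N) (\<lambda>(x, y). \<Sum>t\<le>T. ennreal (match_density c t M N x y))"

lemma telescope_resid: "(\<Sum>t\<le>T. resid c t M N x - resid c (Suc t) M N x) = 1 - resid c (Suc T) M N x"
  by (induction T) auto

lemma coupling_nn_integral:
  assumes [measurable]: "(\<lambda>(x, y). \<kappa> x y) \<in> borel_measurable (M \<Otimes>\<^sub>M N)"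
  shows "(\<integral>\<^sup>+(x, y). \<kappa> x y \<partial>coupling T)
    = (\<Sum>t\<le>T. \<integral>\<^sup>+x. \<integral>\<^sup>+y. ennreal (match_density c t M N x y) * \<kappa> x y \<partial>N \<partial>M)"
proof -
  have "(\<integral>\<^sup>+(x, y). \<kappa> x y \<partial>coupling T)
    = (\<integral>\<^sup>+(x, y). (\<Sum>t\<le>T. ennreal (match_density c t M N x y) * \<kappa> x y) \<partial>(M \<Otimes>\<^sub>M N))"
    unfolding coupling_def
    by (subst nn_integral_density) (auto simp: sum_distrib_right case_prod_beta intro!: nn_integral_cong)
  also have "\<dots> = (\<Sum>t\<le>T. \<integral>\<^sup>+(x, y). ennreal (match_density c t M N x y) * \<kappa> x y \<partial>(M \<Otimes>\<^sub>M N))"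
    unfolding case_prod_beta by (subst nn_integral_sum) measurable
  also have "\<dots> = (\<Sum>t\<le>T. \<integral>\<^sup>+x. \<integral>\<^sup>+y. ennreal (match_density c t M N x y) * \<kappa> x y \<partial>N \<partial>M)"
    by (intro sum.cong refl, subst N.nn_integral_fst[symmetric]) simp_all
  finally show ?thesis .
qed

text \<open>The marginals of the steps telescope to 1 minus the final residual, which vanishes
  almost everywhere once \<open>c T\<close> is constant.\<close>

lemma coupling_fst:
  assumes "\<And>x y. c T x = c T y" "A \<in> sets M"
  shows "(\<integral>\<^sup>+(x, y). indicator A x \<partial>coupling T) = emeasure M A"
proof -
  note [measurable] = assms(2)
  have "(\<integral>\<^sup>+(x, y). indicator A x \<partial>coupling T)
    = (\<Sum>t\<le>T. \<integral>\<^sup>+x. \<integral>\<^sup>+y. ennreal (match_density c t M N x y) * indicator A x \<partial>N \<partial>M)"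
    by (rule coupling_nn_integral) measurable
  also have "\<dots> = (\<Sum>t\<le>T. \<integral>\<^sup>+x. ennreal (resid c t M N x - resid c (Suc t) M N x) * indicator A x \<partial>M)"
    by (intro sum.cong nn_integral_cong) (auto simp: indicator_def nn_integral_match_density)
  also have "\<dots> = (\<integral>\<^sup>+x. (\<Sum>t\<le>T. ennreal (resid c t M N x - resid c (Suc t) M N x) * indicator A x) \<partial>M)"
    by (rule nn_integral_sum[symmetric]) measurable
  also have "\<dots> = (\<integral>\<^sup>+x. indicator A x \<partial>M)"
    using resid_final[OF assms(1)] resid_antimono
    by (intro nn_integral_cong_AE)
       (auto simp: telescope_resid simp flip: sum_distrib_right elim!: eventually_mono)
  finally show ?thesis by simp
qed

lemma coupling_snd:
  assumes "\<And>x y. c T x = c T y" "A \<in> sets N"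
  shows "(\<integral>\<^sup>+(x, y). indicator A y \<partial>coupling T) = emeasure N A"
proof -
  interpret S: matching N M c by (rule swap)
  interpret pair_sigma_finite M N ..
  note [measurable] = assms(2)
  have "(\<integral>\<^sup>+(x, y). indicator A y \<partial>coupling T)
    = (\<Sum>t\<le>T. \<integral>\<^sup>+x. \<integral>\<^sup>+y. ennreal (match_density c t M N x y) * indicator A y \<partial>N \<partial>M)"
    by (rule coupling_nn_integral) measurable
  also have "\<dots> = (\<Sum>t\<le>T. \<integral>\<^sup>+y. \<integral>\<^sup>+x. ennreal (match_density c t M N x y) * indicator A y \<partial>M \<partial>N)"
    by (intro sum.cong refl Fubini'[symmetric]) measurable
  also have "\<dots> = (\<Sum>t\<le>T. \<integral>\<^sup>+y. \<integral>\<^sup>+x. ennreal (match_density c t N M y x) * indicator A y \<partial>M \<partial>N)"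
    by (simp add: match_density_swap[of c _ N M])
  also have "\<dots> = (\<integral>\<^sup>+(x, y). indicator A x \<partial>S.coupling T)"
    by (rule S.coupling_nn_integral[symmetric]) measurable
  also have "\<dots> = emeasure N A" by (rule S.coupling_fst[OF assms])
  finally show ?thesis .
qed

text \<open>Splitting the cost into a part in \<open>x\<close> and a part in \<open>y\<close> means
  that each integral sees only one marginal of a step, and that marginal is at most the residual
  before the step. The set \<open>G\<close> of full measure will hold the points with finite
  weighted norm.\<close>

lemma coupling_cost_le:
  assumes [measurable]: "(\<lambda>(x, y). \<kappa> x y) \<in> borel_measurable (M \<Otimes>\<^sub>M N)"
    and d [measurable]: "\<And>t. d t \<in> borel_measurable M" and e [measurable]: "\<And>t. e t \<in> borel_measurable N"
    and G: "AE x in M. x \<in> G" "AE y in N. y \<in> G"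
    and bound: "\<And>t x y. t \<le> T \<Longrightarrow> x \<in> G \<Longrightarrow> y \<in> G \<Longrightarrow> c t x = c t y \<Longrightarrow> \<kappa> x y \<le> d t x + e t y"
  shows "(\<integral>\<^sup>+(x, y). \<kappa> x y \<partial>coupling T)
    \<le> (\<Sum>t\<le>T. (\<integral>\<^sup>+x. ennreal (resid c t M N x) * d t x \<partial>M) + (\<integral>\<^sup>+y. ennreal (resid c t N M y) * e t y \<partial>N))"
proof -
  interpret S: matching N M c by (rule swap)
  interpret pair_sigma_finite M N ..
  have "(\<integral>\<^sup>+x. \<integral>\<^sup>+y. ennreal (match_density c t M N x y) * \<kappa> x y \<partial>N \<partial>M)
      \<le> (\<integral>\<^sup>+x. ennreal (resid c t M N x) * d t x \<partial>M) + (\<integral>\<^sup>+y. ennreal (resid c t N M y) * e t y \<partial>N)"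
    if "t \<le> T" for t
  proof -
    let ?h = "\<lambda>x y. ennreal (match_density c t M N x y)"
    have "(\<integral>\<^sup>+x. \<integral>\<^sup>+y. ?h x y * \<kappa> x y \<partial>N \<partial>M) \<le> (\<integral>\<^sup>+x. \<integral>\<^sup>+y. ?h x y * d t x + ?h x y * e t y \<partial>N \<partial>M)"
      using G(1)
    proof (intro nn_integral_mono_AE, elim eventually_mono)
      fix x assume x: "x \<in> G"
      show "(\<integral>\<^sup>+y. ?h x y * \<kappa> x y \<partial>N) \<le> (\<integral>\<^sup>+y. ?h x y * d t x + ?h x y * e t y \<partial>N)"
        using G(2)
      proof (intro nn_integral_mono_AE, elim eventually_mono)
        fix y assume y: "y \<in> G"
        show "?h x y * \<kappa> x y \<le> ?h x y * d t x + ?h x y * e t y"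
        proof (cases "c t x = c t y")
          case True
          then show ?thesis using bound[OF that x y]
            by (simp flip: distrib_left add: mult_left_mono)
        qed (simp add: match_density_def)
      qed
    qed
    also have "\<dots> = (\<integral>\<^sup>+x. \<integral>\<^sup>+y. ?h x y * d t x \<partial>N \<partial>M) + (\<integral>\<^sup>+x. \<integral>\<^sup>+y. ?h x y * e t y \<partial>N \<partial>M)"
      by (subst nn_integral_add[symmetric], measurable, intro nn_integral_cong nn_integral_add) measurable
    also have "(\<integral>\<^sup>+x. \<integral>\<^sup>+y. ?h x y * e t y \<partial>N \<partial>M) = (\<integral>\<^sup>+y. \<integral>\<^sup>+x. ?h x y * e t y \<partial>M \<partial>N)"
      by (rule Fubini'[symmetric]) measurable
    also have "\<dots> = (\<integral>\<^sup>+y. ennreal (resid c t N M y - resid c (Suc t) N M y) * e t y \<partial>N)"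
      by (intro nn_integral_cong, subst nn_integral_multc, measurable) (simp add: nn_integral_match_density')
    also have "\<dots> \<le> (\<integral>\<^sup>+y. ennreal (resid c t N M y) * e t y \<partial>N)"
      using S.resid_nonneg by (intro nn_integral_mono mult_right_mono ennreal_leI) auto
    also have "(\<integral>\<^sup>+x. \<integral>\<^sup>+y. ?h x y * d t x \<partial>N \<partial>M) = (\<integral>\<^sup>+x. ennreal (resid c t M N x - resid c (Suc t) M N x) * d t x \<partial>M)"
      by (intro nn_integral_cong, subst nn_integral_multc, measurable) (simp add: nn_integral_match_density)
    also have "\<dots> \<le> (\<integral>\<^sup>+x. ennreal (resid c t M N x) * d t x \<partial>M)"
      using resid_nonneg by (intro nn_integral_mono mult_right_mono ennreal_leI) auto
    finally show ?thesis by (simp add: add_left_mono)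
  qed
  then show ?thesis
    unfolding coupling_nn_integral[OF assms(1)] by (intro sum_mono) auto
qed

end

lemma coupling_in_couplings:
  fixes M N :: "'a::second_countable_topology measure"
  assumes "matching M N c" and const: "\<And>x y. c T x = c T y" and "sets M = sets borel"
  shows "matching.coupling M N c T \<in> couplings M N"
proof -
  interpret matching M N c by fact
  have sets [simp]: "sets (coupling T) = sets (borel \<Otimes>\<^sub>M borel)"
    unfolding coupling_def using assms(3) sets_eq by (simp cong: sets_pair_measure_cong)
  have sp: "space (coupling T) = UNIV"
    using sets_eq_imp_space_eq[OF sets] by (simp add: space_pair_measure)
  have fst_in: "fst \<in> measurable (coupling T) borel" and snd_in: "snd \<in> measurable (coupling T) borel"
    by (simp_all add: measurable_cong_sets[OF sets refl])
  have e1: "emeasure (coupling T) (fst -` A) = emeasure M A" if "A \<in> sets M" for A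
  proof -
    have "fst -` A \<inter> space (coupling T) \<in> sets (coupling T)"
      by (rule measurable_sets[OF fst_in]) (use that assms(3) in simp)
    then have "emeasure (coupling T) (fst -` A) = (\<integral>\<^sup>+p. indicator (fst -` A) p \<partial>coupling T)"
      using sp by simp
    also have "\<dots> = (\<integral>\<^sup>+(x, y). indicator A x \<partial>coupling T)"
      by (intro nn_integral_cong) (auto simp: indicator_def)
    finally show ?thesis using coupling_fst[OF const that] by simp
  qed
  have e2: "emeasure (coupling T) (snd -` A) = emeasure N A" if "A \<in> sets N" for A
  proof -
    have "snd -` A \<inter> space (coupling T) \<in> sets (coupling T)"
      by (rule measurable_sets[OF snd_in]) (use that assms(3) sets_eq in simp)
    then have "emeasure (coupling T) (snd -` A) = (\<integral>\<^sup>+p. indicator (snd -` A) p \<partial>coupling T)"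
      using sp by simp
    also have "\<dots> = (\<integral>\<^sup>+(x, y). indicator A y \<partial>coupling T)"
      by (intro nn_integral_cong) (auto simp: indicator_def)
    finally show ?thesis using coupling_snd[OF const that] by simp
  qed
  have "prob_space (coupling T)"
    using e1[of UNIV] M.emeasure_space_1 space_UNIV sets.top[of M] sp by (intro prob_spaceI) simp
  moreover have "distr (coupling T) borel fst = M"
    using assms(3) by (intro measure_eqI) (auto simp: emeasure_distr[OF fst_in] sp e1)
  moreover have "distr (coupling T) borel snd = N"
    using assms(3) sets_eq by (intro measure_eqI) (auto simp: emeasure_distr[OF snd_in] sp e2)
  ultimately show ?thesis by (simp add: couplings_def)
qed


section \<open>Deviation of empirical frequencies\<close>

lemma
  assumes "1 \<le> n"
  shows prob_space_empirical: "prob_space (empirical_measure n x)"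
    and sets_empirical: "sets (empirical_measure n x) = sets borel"
    and measure_empirical: "A \<in> sets borel \<Longrightarrow> measure (empirical_measure n x) A = (\<Sum>i<n. indicator A (x i)) / real n"
proof -
  have meas: "x \<in> measurable (uniform_count_measure {..<n}) borel"
    by (simp add: measurable_def sets_uniform_count_measure space_uniform_count_measure)
  have "prob_space (uniform_count_measure {..<n})"
    using assms by (intro prob_space_uniform_count_measure) (auto simp: lessThan_empty_iff)
  then show "prob_space (empirical_measure n x)"
    unfolding empirical_measure_def by (rule prob_space.prob_space_distr) (rule meas)
  show "sets (empirical_measure n x) = sets borel"
    by (simp add: empirical_measure_def)
  assume "A \<in> sets borel"
  then have "measure (empirical_measure n x) A = measure (uniform_count_measure {..<n}) (x -` A \<inter> {..<n})"
    unfolding empirical_measure_def by (simp add: measure_distr[OF meas] space_uniform_count_measure)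
  also have "\<dots> = card (x -` A \<inter> {..<n}) / n"
    by (subst measure_uniform_count_measure) auto
  also have "real (card (x -` A \<inter> {..<n})) = (\<Sum>i<n. indicator A (x i))"
  proof -
    have "(\<Sum>i<n. indicator A (x i)) = (\<Sum>i<n. if i \<in> x -` A then 1 else 0 :: real)"
      by (intro sum.cong) (auto simp: indicator_def)
    also have "\<dots> = real (card ({..<n} \<inter> x -` A))"
      by (subst sum.If_cases) (auto simp: vimage_def)
    also have "{..<n} \<inter> x -` A = x -` A \<inter> {..<n}" by (rule Int_commute)
    finally show ?thesis by (rule sym)
  qed
  finally show "measure (empirical_measure n x) A = (\<Sum>i<n. indicator A (x i)) / real n" .
qed

lemma (in prob_space) expectation_PiM_component:
  fixes g :: "'a \<Rightarrow> real"
  assumes "i \<in> I" and [measurable]: "g \<in> borel_measurable M"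
  shows "(\<integral>x. g (x i) \<partial>(\<Pi>\<^sub>M i\<in>I. M)) = (\<integral>y. g y \<partial>M)"
proof -
  have "(\<integral>y. g y \<partial>M) = (\<integral>y. g y \<partial>distr (\<Pi>\<^sub>M i\<in>I. M) M (\<lambda>x. x i))"
    using assms(1) by (subst distr_PiM_component) (auto intro: prob_space_axioms)
  also have "\<dots> = (\<integral>x. g (x i) \<partial>(\<Pi>\<^sub>M i\<in>I. M))"
    using assms(1) by (subst integral_distr) auto
  finally show ?thesis by simp
qed

text \<open>Independence of two distinct coordinates, from the product formula with the factor 1 at
  every other index.\<close>

lemma (in prob_space) expectation_PiM_mult:
  fixes g :: "'a \<Rightarrow> real"
  assumes "i \<in> I" "j \<in> I" "i \<noteq> j" "finite I" and g: "integrable M g"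
  shows "(\<integral>x. g (x i) * g (x j) \<partial>(\<Pi>\<^sub>M i\<in>I. M)) = (\<integral>y. g y \<partial>M) * (\<integral>y. g y \<partial>M)"
proof -
  interpret product_sigma_finite "\<lambda>_. M" ..
  let ?f = "\<lambda>k. if k = i \<or> k = j then g else (\<lambda>_. 1)"
  have split: "(\<Prod>k\<in>I. if k = i \<or> k = j then h k else 1) = h i * h j" for h :: "_ \<Rightarrow> real"
  proof -
    have "(\<Prod>k\<in>I. if k = i \<or> k = j then h k else 1) = (\<Prod>k\<in>{i, j}. h k)"
      using assms by (intro prod.mono_neutral_cong_right) auto
    then show ?thesis using assms by simp
  qed
  have "(\<integral>x. (\<Prod>k\<in>I. ?f k (x k)) \<partial>(\<Pi>\<^sub>M i\<in>I. M)) = (\<Prod>k\<in>I. integral\<^sup>L M (?f k))"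
    using assms by (intro product_integral_prod) auto
  also have "(\<lambda>x. \<Prod>k\<in>I. ?f k (x k)) = (\<lambda>x. g (x i) * g (x j))"
  proof
    fix x
    have "(\<Prod>k\<in>I. ?f k (x k)) = (\<Prod>k\<in>I. if k = i \<or> k = j then g (x k) else 1)"
      by (intro prod.cong) auto
    then show "(\<Prod>k\<in>I. ?f k (x k)) = g (x i) * g (x j)" by (simp add: split)
  qed
  also have "(\<Prod>k\<in>I. integral\<^sup>L M (?f k)) = (\<Prod>k\<in>I. if k = i \<or> k = j then integral\<^sup>L M g else 1)"
    by (intro prod.cong) (auto simp: prob_space)
  finally show ?thesis by (simp add: split)
qed

text \<open>The bound \<open>2 * prob A\<close> is the triangle inequality. The other comes from the
  variance: the cross terms of the centred indicators vanish by independence, and each square has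
  expectation at most \<open>prob A\<close>.\<close>

lemma (in prob_space) expected_empirical_deviation:
  assumes A [measurable]: "A \<in> sets M" and n: "1 \<le> n"
  defines "D \<equiv> \<lambda>x. \<bar>prob A - (\<Sum>i<n. indicator A (x i)) / real n\<bar>"
  shows "(\<integral>\<^sup>+x. ennreal (D x) \<partial>(\<Pi>\<^sub>M i\<in>{..<n}. M)) \<le> ennreal (min (2 * prob A) (sqrt (prob A / n)))"
proof -
  define P where "P = (\<Pi>\<^sub>M i\<in>{..<n}. M)"
  interpret P: prob_space P
    unfolding P_def by (intro prob_space_PiM prob_space_axioms)
  define a where "a = prob A"
  have a: "0 \<le> a" "a \<le> 1" by (auto simp: a_def)
  define g where "g = (\<lambda>y. indicator A y - a)"
  have g_meas [measurable]: "g \<in> borel_measurable M" by (simp add: g_def)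
  have comp [measurable]: "(\<lambda>x. x i) \<in> measurable P M" if "i < n" for i
    using that by (simp add: P_def)
  have g_le: "\<bar>g y\<bar> \<le> 1" for y using a by (auto simp: g_def indicator_def)
  have g_int: "integrable M g"
    by (rule integrable_const_bound[where B=1]) (use g_le in auto)
  have [simp]: "integrable M (indicat_real A)"
    by (rule integrable_const_bound[where B=1]) (auto simp: indicator_def)
  have g0: "(\<integral>y. g y \<partial>M) = 0"
    unfolding g_def
    by (subst Bochner_Integration.integral_diff) (auto simp: a_def prob_space)
  have g2: "(\<integral>y. g y * g y \<partial>M) \<le> a"
  proof -
    have "(\<integral>y. g y * g y \<partial>M) = (\<integral>y. (1 - 2 * a) * indicator A y + a\<^sup>2 \<partial>M)"
      by (intro Bochner_Integration.integral_cong)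
         (auto simp: g_def indicator_def power2_eq_square algebra_simps)
    also have "\<dots> = (1 - 2 * a) * a + a\<^sup>2"
      by (subst Bochner_Integration.integral_add)
         (auto simp: a_def prob_space)
    also have "\<dots> \<le> a" by (simp add: power2_eq_square algebra_simps)
    finally show ?thesis .
  qed
  have gg_int: "integrable P (\<lambda>x. g (x i) * g (x j))" if "i < n" "j < n" for i j
  proof (rule P.integrable_const_bound[where B=1])
    show "AE x in P. norm (g (x i) * g (x j)) \<le> 1"
      using g_le by (intro AE_I2) (simp add: abs_mult mult_le_one)
  qed (use that in measurable)
  have D: "D x = \<bar>(\<Sum>i<n. g (x i))\<bar> / n" for x
  proof -
    have "(\<Sum>i<n. g (x i)) = (\<Sum>i<n. indicator A (x i)) - n * a"
      by (simp add: g_def sum_subtractf)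
    then have "D x = \<bar>- (\<Sum>i<n. g (x i)) / n\<bar>"
      using n by (simp add: D_def a_def diff_divide_distrib)
    then show ?thesis by (simp add: abs_divide)
  qed
  have D_meas [measurable]: "D \<in> borel_measurable P" unfolding D[abs_def] by measurable
  have D_le: "D x \<le> 1" for x
  proof -
    have "\<bar>(\<Sum>i<n. g (x i))\<bar> \<le> (\<Sum>i<n. 1)" by (intro order_trans[OF sum_abs] sum_mono g_le)
    then show ?thesis using n by (simp add: D divide_le_eq_1)
  qed
  have D_int: "integrable P D"
    by (rule P.integrable_const_bound[where B=1]) (use D_le in \<open>auto simp: D_def\<close>)
  have sq: "(\<integral>x. (D x)\<^sup>2 \<partial>P) \<le> a / n"
  proof -
    have "(D x)\<^sup>2 = (\<Sum>i<n. \<Sum>j<n. g (x i) * g (x j)) / n\<^sup>2" for x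
      by (simp add: D power_divide power2_eq_square sum_product)
    then have "(\<integral>x. (D x)\<^sup>2 \<partial>P) = (\<integral>x. (\<Sum>i<n. \<Sum>j<n. g (x i) * g (x j)) \<partial>P) / n\<^sup>2"
      by simp
    also have "(\<integral>x. (\<Sum>i<n. \<Sum>j<n. g (x i) * g (x j)) \<partial>P) = (\<Sum>i<n. \<integral>x. (\<Sum>j<n. g (x i) * g (x j)) \<partial>P)"
      by (intro Bochner_Integration.integral_sum Bochner_Integration.integrable_sum gg_int) auto
    also have "\<dots> = (\<Sum>i<n. \<Sum>j<n. \<integral>x. g (x i) * g (x j) \<partial>P)"
      by (intro sum.cong refl Bochner_Integration.integral_sum gg_int) auto
    also have "(\<Sum>i<n. \<Sum>j<n. \<integral>x. g (x i) * g (x j) \<partial>P) = (\<Sum>i<n. \<Sum>j<n. if i = j then \<integral>y. g y * g y \<partial>M else 0)"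
    proof (intro sum.cong refl)
      fix i j assume "i \<in> {..<n}" "j \<in> {..<n}"
      then show "(\<integral>x. g (x i) * g (x j) \<partial>P) = (if i = j then \<integral>y. g y * g y \<partial>M else 0)"
        using expectation_PiM_component[of i "{..<n}" "\<lambda>y. g y * g y"]
          expectation_PiM_mult[of i "{..<n}" j, OF _ _ _ _ g_int] g0
        by (auto simp: P_def)
    qed
    also have "\<dots> = n * (\<integral>y. g y * g y \<partial>M)" by simp
    also have "\<dots> / n\<^sup>2 \<le> n * a / n\<^sup>2"
      using g2 n by (intro divide_right_mono mult_left_mono) auto
    also have "\<dots> = a / n" using n by (simp add: power2_eq_square)
    finally show ?thesis .
  qed
  have sq_int: "integrable P (\<lambda>x. (D x)\<^sup>2)"
  proof (rule P.integrable_const_bound[where B=1])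
    have "norm ((D x)\<^sup>2) \<le> 1" for x
      using power_le_one[of "D x" 2] D_le[of x] by (simp add: D_def)
    then show "AE x in P. norm ((D x)\<^sup>2) \<le> 1" by simp
  qed measurable
  have 1: "(\<integral>x. D x \<partial>P) \<le> 2 * a"
  proof -
    have ind_int: "integrable P (\<lambda>x. indicator A (x i) :: real)" if "i \<in> {..<n}" for i
      by (rule P.integrable_const_bound[where B=1]) (use that in \<open>auto simp: indicator_def\<close>)
    have "(\<integral>x. D x \<partial>P) \<le> (\<integral>x. a + (\<Sum>i<n. indicator A (x i)) / n \<partial>P)"
    proof (intro integral_mono)
      fix x
      have "0 \<le> (\<Sum>i<n. indicator A (x i)) / real n" by (intro divide_nonneg_nonneg sum_nonneg) auto
      then show "D x \<le> a + (\<Sum>i<n. indicator A (x i)) / real n"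
        using a unfolding D_def a_def by linarith
    next
      show "integrable P (\<lambda>x. a + (\<Sum>i<n. indicator A (x i)) / real n)"
        by (intro Bochner_Integration.integrable_add integrable_divide Bochner_Integration.integrable_sum ind_int P.integrable_const)
    qed (rule D_int)
    also have "\<dots> = a + (\<Sum>i<n. (\<integral>x. indicator A (x i) \<partial>P)) / n"
      using ind_int P.prob_space
      by (subst Bochner_Integration.integral_add)
         (auto simp: Bochner_Integration.integral_sum intro!: integrable_divide Bochner_Integration.integrable_sum)
    also have "(\<Sum>i<n. (\<integral>x. indicator A (x i) \<partial>P)) = (\<Sum>i<n. a)"
      using expectation_PiM_component[of _ "{..<n}" "indicator A"] unfolding P_def
      by (intro sum.cong) (auto simp: a_def)
    finally show ?thesis using n by simp
  qed
  have 2: "(\<integral>x. D x \<partial>P) \<le> sqrt (a / n)"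
  proof (cases "a = 0")
    case True
    then show ?thesis using 1 by simp
  next
    case False
    \<comment> \<open>The second moment controls the first through
      \<open>D x \<le> ((D x)\<^sup>2 / l + l) / 2\<close>, with \<open>l\<close> equal to the bound
      aimed at; it must be positive, so \<open>a = 0\<close> was split off.\<close>
    define l where "l = sqrt (a / n)"
    have l: "0 < l" "l * l = a / n" using False a n by (auto simp: l_def)
    have "(\<integral>x. D x \<partial>P) \<le> (\<integral>x. ((D x)\<^sup>2 / l + l) / 2 \<partial>P)"
    proof (intro integral_mono)
      fix x
      have "0 \<le> (D x - l)\<^sup>2" by simp
      then show "D x \<le> ((D x)\<^sup>2 / l + l) / 2"
        using l(1) by (simp add: field_simps power2_eq_square)
    qed (use D_int sq_int in auto)
    also have "\<dots> = ((\<integral>x. (D x)\<^sup>2 \<partial>P) / l + l) / 2"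
      using sq_int P.prob_space by simp
    also have "\<dots> \<le> ((a / n) / l + l) / 2"
      using sq l(1) by (intro divide_right_mono add_right_mono) auto
    also have "\<dots> = l" using l by (simp flip: l(2))
    finally show ?thesis by (simp add: l_def)
  qed
  have "(\<integral>\<^sup>+x. ennreal (D x) \<partial>P) = ennreal (\<integral>x. D x \<partial>P)"
    using D_int by (intro nn_integral_eq_integral) (auto simp: D_def)
  then show ?thesis using 1 2 by (simp add: P_def a_def ennreal_leI)
qed

text \<open>For \<open>a \<le> r\<close> the first term is used and \<open>a powr \<eta>\<close> is
  raised to \<open>r powr \<eta>\<close>. For larger \<open>a\<close> the second is used and
  \<open>r powr (1/2 - \<eta>)\<close> is raised to a power of \<open>a\<close>, which is where
  \<open>\<eta> \<le> 1/2\<close> enters.\<close>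

lemma min_le_interpolate:
  fixes a r \<eta> :: real
  assumes "0 \<le> a" "0 < r" "0 < \<eta>" "\<eta> \<le> 1/2"
  shows "min (2 * a) (sqrt (r * a)) \<le> 2 * (a powr (1 - \<eta>) * r powr \<eta>)"
proof (cases "a = 0")
  case False
  then have a: "0 < a" using assms by simp
  show ?thesis
  proof (cases "a \<le> r")
    case True
    have "a = a powr (1 - \<eta>) * a powr \<eta>" using a by (simp flip: powr_add)
    also have "\<dots> \<le> a powr (1 - \<eta>) * r powr \<eta>"
      using True assms by (intro mult_left_mono powr_mono2) auto
    finally show ?thesis by (simp add: min_le_iff_disj)
  next
    case False
    have "sqrt (r * a) = r powr (1/2) * a powr (1/2)"
      using a assms by (simp add: powr_half_sqrt real_sqrt_mult)
    also have "r powr (1/2) = r powr (1/2 - \<eta>) * r powr \<eta>" by (simp flip: powr_add)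
    also have "r powr (1/2 - \<eta>) * r powr \<eta> * a powr (1/2) \<le> a powr (1/2 - \<eta>) * r powr \<eta> * a powr (1/2)"
      using False assms by (intro mult_right_mono powr_mono2) auto
    also have "\<dots> = a powr ((1/2 - \<eta>) + 1/2) * r powr \<eta>" by (simp only: powr_add mult_ac)
    finally have "sqrt (r * a) \<le> a powr (1 - \<eta>) * r powr \<eta>" by simp
    moreover have "0 \<le> a powr (1 - \<eta>) * r powr \<eta>" by simp
    ultimately show ?thesis by linarith
  qed
qed simp

text \<open>Cauchy-Schwarz over at most \<open>N\<close> cells bounds the sum of the roots by
  \<open>sqrt (N / n * b)\<close>; the interpolation is then applied with
  \<open>r = N / n\<close>.\<close>

lemma sum_min_le_interpolate:
  fixes a :: "'z \<Rightarrow> real"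
  assumes "finite Z" "\<And>z. z \<in> Z \<Longrightarrow> 0 \<le> a z" "(\<Sum>z\<in>Z. a z) \<le> b" "real (card Z) \<le> N" "0 < N"
    and "1 \<le> n" "0 < \<eta>" "\<eta> \<le> 1/2"
  shows "(\<Sum>z\<in>Z. min (2 * a z) (sqrt (a z / real n))) \<le> 2 * (b powr (1 - \<eta>) * (N / n) powr \<eta>)"
proof -
  have b: "0 \<le> b" using sum_nonneg[of Z a] assms by auto
  have "(\<Sum>z\<in>Z. min (2 * a z) (sqrt (a z / real n))) \<le> (\<Sum>z\<in>Z. 2 * a z)"
    by (intro sum_mono) auto
  also have "\<dots> \<le> 2 * b" using assms by (simp flip: sum_distrib_left)
  finally have 1: "(\<Sum>z\<in>Z. min (2 * a z) (sqrt (a z / real n))) \<le> 2 * b" .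
  have "(\<Sum>z\<in>Z. min (2 * a z) (sqrt (a z / real n))) \<le> (\<Sum>z\<in>Z. sqrt (a z / real n))"
    by (intro sum_mono) auto
  also have "\<dots> \<le> sqrt (N / n * b)"
  proof (rule real_le_rsqrt)
    have "(\<Sum>z\<in>Z. sqrt (a z / real n))\<^sup>2 \<le> (\<Sum>z\<in>Z. 1\<^sup>2) * (\<Sum>z\<in>Z. (sqrt (a z / real n))\<^sup>2)"
      using Cauchy_Schwarz_ineq_sum[of "\<lambda>_. 1" "\<lambda>z. sqrt (a z / real n)" Z] by simp
    also have "(\<Sum>z\<in>Z. (sqrt (a z / real n))\<^sup>2) = (\<Sum>z\<in>Z. a z) / n"
      using assms by (simp add: sum_divide_distrib)
    also have "(\<Sum>z\<in>Z. 1\<^sup>2) * ((\<Sum>z\<in>Z. a z) / n) \<le> N * (b / n)"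
      using assms sum_nonneg[of Z a] by (intro mult_mono divide_right_mono) auto
    finally show "(\<Sum>z\<in>Z. sqrt (a z / real n))\<^sup>2 \<le> N / n * b" by simp
  qed
  finally have "(\<Sum>z\<in>Z. min (2 * a z) (sqrt (a z / real n))) \<le> min (2 * b) (sqrt (N / n * b))"
    using 1 by simp
  also have "\<dots> \<le> 2 * (b powr (1 - \<eta>) * (N / n) powr \<eta>)"
    using b assms by (intro min_le_interpolate) auto
  finally show ?thesis .
qed


section \<open>Nested cells in dyadic shells\<close>

lemma ell2_norm_le:
  assumes "0 \<le> r" "\<And>K. (\<Sum>m<K. (coord x m)\<^sup>2) \<le> r\<^sup>2"
  shows "norm x \<le> r"
  unfolding norm_ell2_def using assms
  by (intro real_le_lsqrt suminf_le_const) auto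

lemma borel_measurable_coord [measurable]: "(\<lambda>x. coord x m) \<in> borel_measurable borel"
proof -
  have "bounded_linear (\<lambda>x. coord x m)"
    by (rule bounded_linear_intro[where K = 1]) (use abs_coord_le_norm in auto)
  then show ?thesis
    by (intro borel_measurable_continuous_onI linear_continuous_on)
qed

definition wnorm2 :: "real \<Rightarrow> ell2 \<Rightarrow> ennreal" where
  "wnorm2 \<gamma> x = (\<Sum>m. ennreal ((\<gamma> ^ m * coord x m)\<^sup>2))"

text \<open>A divergent series gives the value 0, and hence shell 0 when \<open>M > 0\<close>.
  Statements relating this value to the point itself therefore assume
  \<open>wnorm2 \<gamma> x < top\<close>.\<close>

definition wnorm :: "real \<Rightarrow> ell2 \<Rightarrow> real" where
  "wnorm \<gamma> x = sqrt (enn2real (wnorm2 \<gamma> x))"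

definition shell :: "real \<Rightarrow> real \<Rightarrow> ell2 \<Rightarrow> nat" where
  "shell \<gamma> M x = (LEAST s. wnorm \<gamma> x \<le> M * 2 ^ s)"

text \<open>Partial sums avoid the junk value of a divergent series.\<close>

definition ellipsoid :: "real \<Rightarrow> ell2 set" where
  "ellipsoid \<gamma> = {y. \<forall>K. (\<Sum>m<K. (\<gamma> ^ m * coord y m)\<^sup>2) \<le> 1}"

text \<open>Rounding toward zero does not increase absolute values, hence maps the ellipsoid into itself.\<close>

definition toward_zero :: "real \<Rightarrow> int" where
  "toward_zero u = (if 0 \<le> u then \<lfloor>u\<rfloor> else \<lceil>u\<rceil>)"

text \<open>The factor \<open>1 / sqrt j\<close> makes \<open>j\<close> coordinate errors of this
  size add up to \<open>1 / \<gamma> ^ j\<close> in norm. At \<open>j = 0\<close> the value is 0,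
  which is harmless because no coordinate is rounded.\<close>

definition mesh :: "real \<Rightarrow> nat \<Rightarrow> real" where
  "mesh \<gamma> j = 1 / (\<gamma> ^ j * sqrt (real j))"

definition code :: "real \<Rightarrow> nat \<Rightarrow> ell2 \<Rightarrow> int list" where
  "code \<gamma> j y = map (\<lambda>m. toward_zero (coord y m / mesh \<gamma> j)) [0..<j]"

text \<open>The level is the length of the list, so a code determines its own mesh.\<close>

lift_definition decode :: "real \<Rightarrow> int list \<Rightarrow> ell2" is
  "\<lambda>\<gamma> z m. if m < length z then mesh \<gamma> (length z) * real_of_int (z ! m) else 0"
  subgoal for \<gamma> z
    by (rule summable_finite[of "{..<length z}"]) auto
  done

text \<open>This is the ellipsoid condition in lattice units: for
  \<open>y m = mesh \<gamma> j * z m\<close> one has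
  \<open>\<gamma> ^ m * y m = z m / (\<gamma> ^ (j - m) * sqrt j)\<close>.\<close>

definition codes :: "real \<Rightarrow> nat \<Rightarrow> int list set" where
  "codes \<gamma> j = {z. length z = j \<and> (\<Sum>m<j. (real_of_int (z ! m) / \<gamma> ^ (j - m))\<^sup>2) \<le> real j}"

text \<open>The label at step \<open>t \<le> k\<close> encodes the approximation of level \<open>k - t\<close>. It is computed from the
  previous label rather than from the point, which makes the cells nested; the price is a geometric
  series of rounding errors. The final step merges all shells into one cell.\<close>

primrec label :: "real \<Rightarrow> real \<Rightarrow> nat \<Rightarrow> nat \<Rightarrow> ell2 \<Rightarrow> nat \<times> int list" where
  "label \<gamma> M k 0 x = (shell \<gamma> M x, code \<gamma> k (x /\<^sub>R (M * 2 ^ shell \<gamma> M x)))"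
| "label \<gamma> M k (Suc t) x = (if t < k
     then (fst (label \<gamma> M k t x), code \<gamma> (k - Suc t) (decode \<gamma> (snd (label \<gamma> M k t x))))
     else (0, []))"

section \<open>Rounding errors and the number of codes\<close>

lemma toward_zero_abs_le: "\<bar>real_of_int (toward_zero u)\<bar> \<le> \<bar>u\<bar>"
proof (cases "0 \<le> u")
  case False
  then have "\<lceil>u\<rceil> \<le> 0" by (simp add: ceiling_le_iff)
  then show ?thesis using False le_of_int_ceiling[of u] by (simp add: toward_zero_def)
qed (simp add: toward_zero_def)

lemma toward_zero_dist: "\<bar>real_of_int (toward_zero u) - u\<bar> \<le> 1"
  unfolding toward_zero_def by (auto simp: abs_if) linarith+

lemma measurable_toward_zero [measurable]: "toward_zero \<in> measurable borel (count_space UNIV)"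
  unfolding toward_zero_def[abs_def] by measurable

lemma coord_decode: "coord (decode \<gamma> z) m = (if m < length z then mesh \<gamma> (length z) * real_of_int (z ! m) else 0)"
  by transfer simp

lemma length_code [simp]: "length (code \<gamma> j y) = j"
  by (simp add: code_def)

lemma coord_decode_code:
  "coord (decode \<gamma> (code \<gamma> j y)) m = (if m < j then mesh \<gamma> j * real_of_int (toward_zero (coord y m / mesh \<gamma> j)) else 0)"
  unfolding coord_decode by (simp add: code_def)

lemma mesh_pos: "1 < \<gamma> \<Longrightarrow> 0 < j \<Longrightarrow> 0 < mesh \<gamma> j"
  by (simp add: mesh_def)

lemma abs_coord_decode_code_le:
  assumes "1 < \<gamma>"
  shows "\<bar>coord (decode \<gamma> (code \<gamma> j y)) m\<bar> \<le> \<bar>coord y m\<bar>"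
proof (cases "m < j")
  case True
  then have h: "0 < mesh \<gamma> j" using assms by (intro mesh_pos) auto
  have "mesh \<gamma> j * \<bar>real_of_int (toward_zero (coord y m / mesh \<gamma> j))\<bar> \<le> mesh \<gamma> j * \<bar>coord y m / mesh \<gamma> j\<bar>"
    using h by (intro mult_left_mono toward_zero_abs_le) auto
  then show ?thesis using h True by (simp add: coord_decode_code abs_mult)
qed (simp add: coord_decode_code)

lemma decode_code_ellipsoid:
  assumes "1 < \<gamma>" "y \<in> ellipsoid \<gamma>"
  shows "decode \<gamma> (code \<gamma> j y) \<in> ellipsoid \<gamma>"
  unfolding ellipsoid_def
proof (intro CollectI allI)
  fix K
  have "(\<Sum>m<K. (\<gamma> ^ m * coord (decode \<gamma> (code \<gamma> j y)) m)\<^sup>2) \<le> (\<Sum>m<K. (\<gamma> ^ m * coord y m)\<^sup>2)"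
    using assms abs_coord_decode_code_le[OF assms(1)]
    by (intro sum_mono) (auto simp: power_mult_distrib abs_le_square_iff intro!: mult_left_mono)
  also have "\<dots> \<le> 1" using assms by (simp add: ellipsoid_def)
  finally show "(\<Sum>m<K. (\<gamma> ^ m * coord (decode \<gamma> (code \<gamma> j y)) m)\<^sup>2) \<le> 1" .
qed

text \<open>The first \<open>j\<close> coordinates each err by at most the mesh. Beyond them the
  point itself is small, because its weights are at least \<open>\<gamma> ^ j\<close>. Both parts
  have squared norm at most \<open>(1 / \<gamma> ^ j)\<^sup>2\<close>.\<close>

lemma norm_decode_code_diff_le:
  assumes "1 < \<gamma>" "y \<in> ellipsoid \<gamma>"
  shows "norm (decode \<gamma> (code \<gamma> j y) - y) \<le> 2 / \<gamma> ^ j"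
proof (rule ell2_norm_le)
  fix K
  let ?d = "decode \<gamma> (code \<gamma> j y) - y"
  have termwise: "(coord ?d m)\<^sup>2 \<le> (if m < j then (mesh \<gamma> j)\<^sup>2 else 0) + (1 / \<gamma> ^ j)\<^sup>2 * (\<gamma> ^ m * coord y m)\<^sup>2" for m
  proof (cases "m < j")
    case True
    then have h: "0 < mesh \<gamma> j" using assms by (intro mesh_pos) auto
    have "coord ?d m = mesh \<gamma> j * (real_of_int (toward_zero (coord y m / mesh \<gamma> j)) - coord y m / mesh \<gamma> j)"
      using True h by (simp add: coord_decode_code right_diff_distrib)
    then have "\<bar>coord ?d m\<bar> \<le> mesh \<gamma> j * 1"
      using h toward_zero_dist by (simp only: abs_mult abs_of_pos) (intro mult_left_mono, auto)
    then have "(coord ?d m)\<^sup>2 \<le> (mesh \<gamma> j)\<^sup>2" using h by (simp flip: abs_le_square_iff)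
    then have "(coord ?d m)\<^sup>2 \<le> (mesh \<gamma> j)\<^sup>2 + (1 / \<gamma> ^ j)\<^sup>2 * (\<gamma> ^ m * coord y m)\<^sup>2"
      by (rule add_increasing2[rotated]) simp
    then show ?thesis using True by (simp only: if_True)
  next
    case False
    then have "\<gamma> ^ j \<le> \<gamma> ^ m" using assms by (intro power_increasing) auto
    then have "1 \<le> (1 / \<gamma> ^ j)\<^sup>2 * (\<gamma> ^ m)\<^sup>2" using assms
      by (simp add: power_divide power_mono)
    then have "1 * (coord y m)\<^sup>2 \<le> ((1 / \<gamma> ^ j)\<^sup>2 * (\<gamma> ^ m)\<^sup>2) * (coord y m)\<^sup>2"
      by (intro mult_right_mono) auto
    then show ?thesis using False by (simp add: coord_decode_code power_mult_distrib)
  qed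
  have "(\<Sum>m<K. (coord ?d m)\<^sup>2)
      \<le> (\<Sum>m<K. if m < j then (mesh \<gamma> j)\<^sup>2 else 0) + (1 / \<gamma> ^ j)\<^sup>2 * (\<Sum>m<K. (\<gamma> ^ m * coord y m)\<^sup>2)"
    unfolding sum_distrib_left sum.distrib[symmetric] by (intro sum_mono termwise)
  also have "(\<Sum>m<K. if m < j then (mesh \<gamma> j)\<^sup>2 else 0) \<le> (1 / \<gamma> ^ j)\<^sup>2"
  proof -
    have "(\<Sum>m<K. if m < j then (mesh \<gamma> j)\<^sup>2 else 0) = (\<Sum>m\<in>{..<K} \<inter> {..<j}. (mesh \<gamma> j)\<^sup>2)"
      by (subst sum.inter_restrict) auto
    also have "\<dots> \<le> (\<Sum>m<j. (mesh \<gamma> j)\<^sup>2)" by (intro sum_mono2) auto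
    also have "\<dots> \<le> (1 / \<gamma> ^ j)\<^sup>2"
      by (cases "j = 0") (auto simp: mesh_def power_divide power_mult_distrib)
    finally show ?thesis .
  qed
  also have "(1 / \<gamma> ^ j)\<^sup>2 * (\<Sum>m<K. (\<gamma> ^ m * coord y m)\<^sup>2) \<le> (1 / \<gamma> ^ j)\<^sup>2 * 1"
    using assms by (intro mult_left_mono) (auto simp: ellipsoid_def)
  finally have "(\<Sum>m<K. (coord ?d m)\<^sup>2) \<le> 2 * (1 / \<gamma> ^ j)\<^sup>2" by simp
  also have "\<dots> \<le> (2 / \<gamma> ^ j)\<^sup>2" by (simp add: power_divide divide_right_mono)
  finally show "(\<Sum>m<K. (coord ?d m)\<^sup>2) \<le> (2 / \<gamma> ^ j)\<^sup>2" .
qed (use assms in auto)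

lemma code_in_codes:
  assumes "1 < \<gamma>" "y \<in> ellipsoid \<gamma>"
  shows "code \<gamma> j y \<in> codes \<gamma> j"
proof -
  have "(real_of_int (code \<gamma> j y ! m) / \<gamma> ^ (j - m))\<^sup>2 \<le> real j * (\<gamma> ^ m * coord y m)\<^sup>2" if "m < j" for m
  proof -
    have h: "0 < mesh \<gamma> j" using assms that by (intro mesh_pos) auto
    have "\<bar>real_of_int (code \<gamma> j y ! m)\<bar> \<le> \<bar>coord y m / mesh \<gamma> j\<bar>"
      using that toward_zero_abs_le[of "coord y m / mesh \<gamma> j"] by (simp add: code_def)
    then have "\<bar>real_of_int (code \<gamma> j y ! m) / \<gamma> ^ (j - m)\<bar> \<le> \<bar>coord y m / mesh \<gamma> j / \<gamma> ^ (j - m)\<bar>"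
      using assms by (simp only: abs_divide) (intro divide_right_mono, auto simp: abs_divide)
    also have "coord y m / mesh \<gamma> j / \<gamma> ^ (j - m) = sqrt j * (\<gamma> ^ m * coord y m)"
    proof -
      have "\<gamma> ^ j = \<gamma> ^ m * \<gamma> ^ (j - m)" using that by (simp flip: power_add)
      then show ?thesis using assms by (simp add: mesh_def)
    qed
    finally have "(real_of_int (code \<gamma> j y ! m) / \<gamma> ^ (j - m))\<^sup>2 \<le> (sqrt j * (\<gamma> ^ m * coord y m))\<^sup>2"
      by (simp only: abs_le_square_iff)
    then show ?thesis by (simp add: power_mult_distrib)
  qed
  then have "(\<Sum>m<j. (real_of_int (code \<gamma> j y ! m) / \<gamma> ^ (j - m))\<^sup>2) \<le> (\<Sum>m<j. real j * (\<gamma> ^ m * coord y m)\<^sup>2)"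
    by (intro sum_mono) auto
  also have "\<dots> \<le> real j * 1"
    unfolding sum_distrib_left[symmetric] using assms
    by (intro mult_left_mono) (auto simp: ellipsoid_def)
  finally show ?thesis by (simp add: codes_def)
qed

text \<open>The cardinality is the Chernoff count with centre 0 and steps
  \<open>1 / \<gamma> ^ (j - m)\<close>, whose inverses multiply to the triangular power.\<close>

lemma
  assumes "1 < \<gamma>"
  shows finite_codes: "finite (codes \<gamma> j)"
    and card_codes_le: "real (card (codes \<gamma> j)) \<le> 72 ^ j * \<gamma> powr (real j * (real j + 1) / 2)"
proof -
  \<comment> \<open>This crude box serves only for finiteness, a hypothesis of the sharper
    count.\<close>
  define B where "B = \<lceil>\<gamma> ^ j * sqrt j\<rceil>"
  have "codes \<gamma> j \<subseteq> {z. set z \<subseteq> {-B..B} \<and> length z = j}"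
  proof (rule subsetI, intro CollectI conjI subsetI)
    fix z i assume z: "z \<in> codes \<gamma> j" and "i \<in> set z"
    then obtain m where m: "m < j" "i = z ! m" by (auto simp: codes_def in_set_conv_nth)
    have "(real_of_int i / \<gamma> ^ (j - m))\<^sup>2 \<le> (\<Sum>m<j. (real_of_int (z ! m) / \<gamma> ^ (j - m))\<^sup>2)"
      unfolding m(2) using m(1) by (intro member_le_sum) auto
    also have "\<dots> \<le> (sqrt j)\<^sup>2" using z by (simp add: codes_def)
    finally have "\<bar>real_of_int i\<bar> / \<gamma> ^ (j - m) \<le> sqrt j"
      using assms by (subst (asm) abs_le_square_iff[symmetric]) simp
    then have "\<bar>real_of_int i\<bar> \<le> \<gamma> ^ (j - m) * sqrt j"
      using assms by (simp add: divide_le_eq mult.commute)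
    also have "\<dots> \<le> \<gamma> ^ j * sqrt j"
      using assms by (intro mult_right_mono power_increasing) auto
    finally show "i \<in> {-B..B}" unfolding B_def by (auto simp: abs_le_iff) linarith+
  qed (auto simp: codes_def)
  then show fin: "finite (codes \<gamma> j)"
    by (rule finite_subset) (simp add: finite_lists_length_eq)
  \<comment> \<open>The count is stated for extensional functions, so lists are carried over
    injectively.\<close>
  define F where "F z = restrict (\<lambda>m. z ! m) {..<j}" for z :: "int list"
  have inj: "inj_on F (codes \<gamma> j)"
  proof (rule inj_onI)
    fix z w assume *: "z \<in> codes \<gamma> j" "w \<in> codes \<gamma> j" "F z = F w"
    have "z ! m = w ! m" if "m < j" for m
      using fun_cong[OF *(3), of m] that by (simp add: F_def)
    with * show "z = w" by (intro nth_equalityI) (auto simp: codes_def)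
  qed
  have "real (card (F ` codes \<gamma> j)) \<le> 72 ^ j * (\<Prod>m<j. 1 / (1 / \<gamma> ^ (j - m)))"
  proof (rule card_gauss_le[where c = "\<lambda>_. 0"])
    show "0 < 1 / \<gamma> ^ (j - m) \<and> 1 / \<gamma> ^ (j - m) \<le> 1" if "m < j" for m
      using assms by (simp add: one_le_power)
    show "F ` codes \<gamma> j \<subseteq> extensional {..<j}" by (auto simp: F_def)
    show "(\<Sum>m<j. (1 / \<gamma> ^ (j - m) * real_of_int (z m) - 0)\<^sup>2) \<le> real j" if "z \<in> F ` codes \<gamma> j" for z
      using that by (auto simp: F_def codes_def)
  qed (use fin in auto)
  then show "real (card (codes \<gamma> j)) \<le> 72 ^ j * \<gamma> powr (real j * (real j + 1) / 2)"
    using assms prod_powr_triangle[of \<gamma> j] by (simp add: card_image[OF inj])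
qed

section \<open>Accuracy and measurability of the nested labels\<close>

lemma fst_label: "t \<le> k \<Longrightarrow> fst (label \<gamma> M k t x) = shell \<gamma> M x"
  by (induction t) auto

lemma label_coarser: "label \<gamma> M k t x = label \<gamma> M k t y \<Longrightarrow> label \<gamma> M k (Suc t) x = label \<gamma> M k (Suc t) y"
  by simp

text \<open>One coarsening adds an error \<open>2 / \<gamma> ^ j\<close> to the error inherited from
  level \<open>j + 1\<close>. The constant \<open>B = 2 * \<gamma> / (\<gamma> - 1)\<close> is the
  sum of the resulting series and solves \<open>2 + B / \<gamma> = B\<close>. Staying in the
  ellipsoid is part of the induction, as the next rounding requires it.\<close>

lemma label_approx:
  assumes "1 < \<gamma>" "t \<le> k" and y: "x /\<^sub>R (M * 2 ^ shell \<gamma> M x) \<in> ellipsoid \<gamma>"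
  shows "snd (label \<gamma> M k t x) \<in> codes \<gamma> (k - t) \<and> decode \<gamma> (snd (label \<gamma> M k t x)) \<in> ellipsoid \<gamma> \<and>
    norm (decode \<gamma> (snd (label \<gamma> M k t x)) - x /\<^sub>R (M * 2 ^ shell \<gamma> M x)) \<le> 2 * \<gamma> / (\<gamma> - 1) / \<gamma> ^ (k - t)"
  using \<open>t \<le> k\<close>
proof (induction t)
  case 0
  let ?y = "x /\<^sub>R (M * 2 ^ shell \<gamma> M x)"
  have "norm (decode \<gamma> (code \<gamma> k ?y) - ?y) \<le> 2 / \<gamma> ^ k"
    by (rule norm_decode_code_diff_le[OF assms(1) y])
  also have "\<dots> \<le> 2 * \<gamma> / (\<gamma> - 1) / \<gamma> ^ k"
    using assms(1) by (intro divide_right_mono) (auto simp: field_simps)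
  finally show ?case
    using code_in_codes[OF assms(1) y, of k] decode_code_ellipsoid[OF assms(1) y, of k] by simp
next
  case (Suc t)
  let ?y = "x /\<^sub>R (M * 2 ^ shell \<gamma> M x)"
  define w where "w = decode \<gamma> (snd (label \<gamma> M k t x))"
  define j where "j = k - Suc t"
  have j: "k - t = Suc j" using Suc.prems by (simp add: j_def)
  have w: "w \<in> ellipsoid \<gamma>" "norm (w - ?y) \<le> 2 * \<gamma> / (\<gamma> - 1) / \<gamma> ^ Suc j"
    using Suc by (auto simp: w_def j)
  have eq: "snd (label \<gamma> M k (Suc t) x) = code \<gamma> j w"
    using Suc.prems by (simp add: w_def j_def)
  have "norm (decode \<gamma> (code \<gamma> j w) - ?y) \<le> norm (decode \<gamma> (code \<gamma> j w) - w) + norm (w - ?y)"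
    using norm_triangle_ineq[of "decode \<gamma> (code \<gamma> j w) - w" "w - ?y"] by simp
  also have "\<dots> \<le> 2 / \<gamma> ^ j + 2 * \<gamma> / (\<gamma> - 1) / \<gamma> ^ Suc j"
    by (intro add_mono norm_decode_code_diff_le assms w)
  also have "\<dots> = (2 + 2 / (\<gamma> - 1)) / \<gamma> ^ j"
    using assms(1) by (simp add: add_divide_distrib)
  also have "2 + 2 / (\<gamma> - 1) = 2 * \<gamma> / (\<gamma> - 1)"
    using assms(1) by (simp add: field_simps)
  finally show ?case
    unfolding eq using code_in_codes[OF assms(1) w(1), of j] decode_code_ellipsoid[OF assms(1) w(1), of j]
    by (simp add: j_def)
qed

lemma wnorm2_measurable [measurable]: "wnorm2 \<gamma> \<in> borel_measurable borel"
  unfolding wnorm2_def[abs_def] by measurable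

lemma wnorm_measurable [measurable]: "wnorm \<gamma> \<in> borel_measurable borel"
  unfolding wnorm_def[abs_def] by measurable

lemma shell_measurable [measurable]: "shell \<gamma> M \<in> measurable borel (count_space UNIV)"
  unfolding shell_def[abs_def] by measurable

text \<open>Only the initial label looks at the point; every later one is a function of a discrete
  value.\<close>

lemma label_measurable: "label \<gamma> M k t \<in> measurable borel (count_space UNIV)"
proof (induction t)
  case 0
  show ?case
  proof (subst measurable_count_space_eq_countable, simp, intro conjI ballI)
    fix a :: "nat \<times> int list"
    obtain s z where a: "a = (s, z)" by (cases a)
    \<comment> \<open>Fixing the shell at \<open>s\<close> makes the scaling a constant, so the
      preimage of one label is cut out by finitely many coordinate conditions.\<close>
    have "label \<gamma> M k 0 x = a \<longleftrightarrow> shell \<gamma> M x = s \<and> length z = k \<and>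
        (\<forall>m\<in>{..<k}. toward_zero (inverse (M * 2 ^ s) * coord x m / mesh \<gamma> k) = z ! m)" for x
      unfolding a label.simps code_def list_eq_iff_nth_eq prod.inject coord_scaleR by auto
    then have "label \<gamma> M k 0 -` {a} \<inter> space borel = {x \<in> space borel. shell \<gamma> M x = s \<and> length z = k \<and>
        (\<forall>m\<in>{..<k}. toward_zero (inverse (M * 2 ^ s) * coord x m / mesh \<gamma> k) = z ! m)}"
      by blast
    also have "\<dots> \<in> sets borel"
    proof -
      have [measurable]: "Measurable.pred borel (\<lambda>x. shell \<gamma> M x = s)"
        by (rule measurable_compose[OF shell_measurable]) simp
      have [measurable]: "Measurable.pred borel (\<lambda>x. toward_zero (inverse (M * 2 ^ s) * coord x m / mesh \<gamma> k) = z ! m)" for m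
        by (rule measurable_compose[OF _ measurable_compose[OF measurable_toward_zero]]) simp_all
      show ?thesis by measurable
    qed
    finally show "label \<gamma> M k 0 -` {a} \<inter> space borel \<in> sets borel" .
  qed simp
next
  case (Suc t)
  have "(\<lambda>x. (\<lambda>l. if t < k then (fst l, code \<gamma> (k - Suc t) (decode \<gamma> (snd l))) else (0, [])) (label \<gamma> M k t x))
      \<in> measurable borel (count_space UNIV)"
    by (rule measurable_compose[OF Suc]) simp
  moreover have "label \<gamma> M k (Suc t)
      = (\<lambda>x. (\<lambda>l. if t < k then (fst l, code \<gamma> (k - Suc t) (decode \<gamma> (snd l))) else (0, [])) (label \<gamma> M k t x))"
    by (rule ext) simp
  ultimately show ?case by (simp only:)
qed

lemma wnorm_shell:
  assumes "0 < M"
  shows "wnorm \<gamma> x \<le> M * 2 ^ shell \<gamma> M x"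
proof -
  obtain s :: nat where "wnorm \<gamma> x / M < 2 ^ s" using real_arch_pow[of 2 "wnorm \<gamma> x / M"] by auto
  then have "wnorm \<gamma> x \<le> M * 2 ^ s" using assms by (simp add: field_simps)
  then show ?thesis unfolding shell_def by (rule LeastI)
qed

lemma shell_gt:
  assumes "s < shell \<gamma> M x"
  shows "M * 2 ^ s < wnorm \<gamma> x"
  using not_less_Least[of s "\<lambda>s. wnorm \<gamma> x \<le> M * 2 ^ s"] assms by (simp add: shell_def)

lemma sum_le_wnorm:
  assumes "wnorm2 \<gamma> x < top"
  shows "(\<Sum>m<K. (\<gamma> ^ m * coord x m)\<^sup>2) \<le> (wnorm \<gamma> x)\<^sup>2"
proof -
  have "ennreal (\<Sum>m<K. (\<gamma> ^ m * coord x m)\<^sup>2) = (\<Sum>m<K. ennreal ((\<gamma> ^ m * coord x m)\<^sup>2))"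
    by (rule sum_ennreal[symmetric]) simp
  also have "\<dots> \<le> wnorm2 \<gamma> x"
    unfolding wnorm2_def by (rule sum_le_suminf) simp_all
  also have "wnorm2 \<gamma> x = ennreal ((wnorm \<gamma> x)\<^sup>2)"
    using assms by (simp add: wnorm_def)
  finally show ?thesis by (subst (asm) ennreal_le_iff) auto
qed

lemma scaled_in_ellipsoid:
  assumes "0 < M" "wnorm2 \<gamma> x < top"
  shows "x /\<^sub>R (M * 2 ^ shell \<gamma> M x) \<in> ellipsoid \<gamma>"
  unfolding ellipsoid_def
proof (intro CollectI allI)
  fix K
  define r where "r = M * 2 ^ shell \<gamma> M x"
  have r: "0 < r" using assms by (simp add: r_def)
  have "(\<Sum>m<K. (\<gamma> ^ m * coord (x /\<^sub>R r) m)\<^sup>2) = (\<Sum>m<K. (\<gamma> ^ m * coord x m)\<^sup>2) / r\<^sup>2"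
    by (simp add: sum_divide_distrib power_mult_distrib field_simps)
  also have "\<dots> \<le> (wnorm \<gamma> x)\<^sup>2 / r\<^sup>2"
    by (intro divide_right_mono sum_le_wnorm assms) auto
  also have "\<dots> \<le> 1"
    using wnorm_shell[OF assms(1), of \<gamma> x] r
      power_mono[of "wnorm \<gamma> x" r 2] by (simp add: r_def[symmetric] wnorm_def)
  finally show "(\<Sum>m<K. (\<gamma> ^ m * coord (x /\<^sub>R (M * 2 ^ shell \<gamma> M x)) m)\<^sup>2) \<le> 1"
    by (simp only: r_def)
qed

lemma norm_le_wnorm:
  assumes "1 < \<gamma>" "wnorm2 \<gamma> x < top"
  shows "norm x \<le> wnorm \<gamma> x"
proof (rule ell2_norm_le)
  fix K
  have "(\<Sum>m<K. (coord x m)\<^sup>2) \<le> (\<Sum>m<K. (\<gamma> ^ m * coord x m)\<^sup>2)"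
  proof (rule sum_mono)
    fix m
    have "1 * \<bar>coord x m\<bar> \<le> \<gamma> ^ m * \<bar>coord x m\<bar>"
      using assms by (intro mult_right_mono one_le_power) auto
    then show "(coord x m)\<^sup>2 \<le> (\<gamma> ^ m * coord x m)\<^sup>2"
      using assms by (simp flip: abs_le_square_iff add: abs_mult)
  qed
  also have "\<dots> \<le> (wnorm \<gamma> x)\<^sup>2" by (rule sum_le_wnorm[OF assms(2)])
  finally show "(\<Sum>m<K. (coord x m)\<^sup>2) \<le> (wnorm \<gamma> x)\<^sup>2" .
qed (simp add: wnorm_def)

text \<open>Equal labels mean a common scale and a common decoded centre, so the distance is at most
  twice the approximation error, scaled back.\<close>

lemma norm_diff_label_le:
  assumes "1 < \<gamma>" "0 < M" "t \<le> k" "wnorm2 \<gamma> x < top" "wnorm2 \<gamma> y < top"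
    and eq: "label \<gamma> M k t x = label \<gamma> M k t y"
  shows "norm (x - y) \<le> M * 2 ^ shell \<gamma> M y * (4 * \<gamma> / (\<gamma> - 1) / \<gamma> ^ (k - t))"
proof -
  have s: "shell \<gamma> M x = shell \<gamma> M y"
    using fst_label[OF \<open>t \<le> k\<close>, of \<gamma> M] eq by metis
  define r where "r = M * 2 ^ shell \<gamma> M y"
  have r: "0 < r" using assms by (simp add: r_def)
  let ?w = "decode \<gamma> (snd (label \<gamma> M k t y))" and ?b = "2 * \<gamma> / (\<gamma> - 1) / \<gamma> ^ (k - t)"
  have "norm (?w - x /\<^sub>R r) \<le> ?b" "norm (?w - y /\<^sub>R r) \<le> ?b"
    using label_approx[OF assms(1,3) scaled_in_ellipsoid[OF assms(2,4)]]
      label_approx[OF assms(1,3) scaled_in_ellipsoid[OF assms(2,5)]] s eq by (simp_all add: r_def)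
  then have "norm (x /\<^sub>R r - y /\<^sub>R r) \<le> ?b + ?b"
    using norm_triangle_ineq4[of "?w - y /\<^sub>R r" "?w - x /\<^sub>R r"] by simp
  moreover have "x - y = r *\<^sub>R (x /\<^sub>R r - y /\<^sub>R r)" using r by (simp add: scaleR_diff_right)
  then have "norm (x - y) = r * norm (x /\<^sub>R r - y /\<^sub>R r)" using r by (metis norm_scaleR abs_of_pos)
  ultimately have "norm (x - y) \<le> r * (?b + ?b)" using r by (simp only: mult_left_mono less_imp_le)
  then show ?thesis by (simp add: r_def)
qed


section \<open>Transport cost of the empirical measure\<close>

lemma suminf_mult_indicator_singleton:
  fixes v :: "nat \<Rightarrow> ennreal"
  shows "(\<Sum>s. v s * indicator {y. \<sigma> y = s} x) = v (\<sigma> x)"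
proof -
  have "(\<Sum>s. v s * indicator {y. \<sigma> y = s} x) = (\<Sum>s\<in>{\<sigma> x}. v s * indicator {y. \<sigma> y = s} x)"
    by (rule suminf_finite) (auto simp: indicator_def)
  then show ?thesis by simp
qed

lemma nn_integral_nat_levels:
  fixes v :: "nat \<Rightarrow> ennreal"
  assumes [measurable]: "\<sigma> \<in> measurable M (count_space UNIV)" "f \<in> borel_measurable M"
    and "space M = UNIV"
  shows "(\<integral>\<^sup>+x. f x * v (\<sigma> x) \<partial>M) = (\<Sum>s. v s * (\<integral>\<^sup>+x. f x * indicator {y. \<sigma> y = s} x \<partial>M))"
proof -
  have ms [measurable]: "{y. \<sigma> y = s} \<in> sets M" for s
  proof -
    have "\<sigma> -` {s} \<inter> space M \<in> sets M" by (rule measurable_sets[OF assms(1)]) simp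
    then show ?thesis using assms(3) by (simp add: vimage_def)
  qed
  have "f x * v (\<sigma> x) = (\<Sum>s. v s * (f x * indicator {y. \<sigma> y = s} x))" for x
  proof -
    have "f x * v (\<sigma> x) = f x * (\<Sum>s. v s * indicator {y. \<sigma> y = s} x)"
      by (simp only: suminf_mult_indicator_singleton)
    also have "\<dots> = (\<Sum>s. f x * (v s * indicator {y. \<sigma> y = s} x))"
      by (rule ennreal_suminf_cmult[symmetric])
    finally show ?thesis by (simp only: mult.left_commute)
  qed
  then have "(\<integral>\<^sup>+x. f x * v (\<sigma> x) \<partial>M) = (\<integral>\<^sup>+x. (\<Sum>s. v s * (f x * indicator {y. \<sigma> y = s} x)) \<partial>M)"
    by (simp only:)
  also have "\<dots> = (\<Sum>s. v s * (\<integral>\<^sup>+x. f x * indicator {y. \<sigma> y = s} x \<partial>M))"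
    by (subst nn_integral_suminf, measurable, subst nn_integral_cmult) auto
  finally show ?thesis .
qed

text \<open>The weight depends only on the shell \<open>\<sigma> x\<close>, and \<open>K s\<close>
  collects the labels met in shell \<open>s\<close>. On each cell the mass left over after step
  \<open>t\<close> is at most the deviation of its frequency.\<close>

lemma (in matching) nn_integral_resid_levels_le:
  fixes v :: "nat \<Rightarrow> ennreal" and K :: "nat \<Rightarrow> 'i set"
  assumes \<sigma>: "\<sigma> \<in> measurable M (count_space UNIV)"
    and K: "\<And>s. finite (K s)" "AE x in M. c t x \<in> K (\<sigma> x)"
  shows "(\<integral>\<^sup>+x. ennreal (resid c (Suc t) M N x) * v (\<sigma> x) \<partial>M)
    \<le> (\<Sum>s. v s * (\<Sum>i\<in>K s. ennreal \<bar>measure M {x. c t x = i} - measure N {x. c t x = i}\<bar>))"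
proof -
  have le: "(\<integral>\<^sup>+x. ennreal (resid c (Suc t) M N x) * indicator {y. \<sigma> y = s} x \<partial>M)
      \<le> (\<Sum>i\<in>K s. ennreal \<bar>measure M {x. c t x = i} - measure N {x. c t x = i}\<bar>)" for s
  proof -
    have [measurable]: "{x. c t x = i} \<in> sets M" for i
      using measurable_cell[of "\<lambda>j. j = i" t] space_UNIV by (simp add: pred_def)
    have "(\<integral>\<^sup>+x. ennreal (resid c (Suc t) M N x) * indicator {y. \<sigma> y = s} x \<partial>M)
       \<le> (\<integral>\<^sup>+x. (\<Sum>i\<in>K s. ennreal (resid c (Suc t) M N x * indicator {x. c t x = i} x)) \<partial>M)"
      using K(2)
    proof (intro nn_integral_mono_AE, elim eventually_mono)
      fix x assume x: "c t x \<in> K (\<sigma> x)"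
      show "ennreal (resid c (Suc t) M N x) * indicator {y. \<sigma> y = s} x
        \<le> (\<Sum>i\<in>K s. ennreal (resid c (Suc t) M N x * indicator {x. c t x = i} x))"
      proof (cases "\<sigma> x = s")
        case True
        have "ennreal (resid c (Suc t) M N x) = (\<Sum>i\<in>{c t x}. ennreal (resid c (Suc t) M N x * indicator {x. c t x = i} x))"
          by simp
        also have "\<dots> \<le> (\<Sum>i\<in>K s. ennreal (resid c (Suc t) M N x * indicator {x. c t x = i} x))"
          using x True K(1) by (intro sum_mono2) auto
        finally show ?thesis using True by simp
      qed simp
    qed
    also have "\<dots> = (\<Sum>i\<in>K s. \<integral>\<^sup>+x. ennreal (resid c (Suc t) M N x * indicator {x. c t x = i} x) \<partial>M)"
      by (rule nn_integral_sum) measurable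
    also have "\<dots> = (\<Sum>i\<in>K s. ennreal (resid_mass c (Suc t) M N (c t) i))"
      by (intro sum.cong refl nn_integral_resid_indicator) (rule measurable_cell[of "\<lambda>j. j = _"])
    also have "\<dots> \<le> (\<Sum>i\<in>K s. ennreal \<bar>measure M {x. c t x = i} - measure N {x. c t x = i}\<bar>)"
      unfolding resid_mass_Suc by (intro sum_mono ennreal_leI) auto
    finally show ?thesis .
  qed
  show ?thesis
    by (subst nn_integral_nat_levels[OF \<sigma>])
       (use space_UNIV in \<open>auto intro!: suminf_le mult_left_mono le simp del: sum_ennreal\<close>)
qed

lemma ennreal_powr_mono:
  assumes "a \<le> b" "0 \<le> r"
  shows "ennreal_powr a r \<le> ennreal_powr b r"
proof (cases "b = top")
  case False
  then have "a \<noteq> top" using assms by (auto simp: top_unique)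
  then show ?thesis using False assms
    by (auto simp: ennreal_powr_def less_top intro!: ennreal_leI powr_mono2 enn2real_mono)
qed (simp add: ennreal_powr_def)

text \<open>A bound for the \<open>p\<close>-th power of the diameter of a cell of level \<open>j - 1\<close> in shell \<open>s\<close>: mass left over
  at level \<open>j\<close> is matched one level above. For \<open>j = 0\<close> it bounds the cost of matching across shells.\<close>

definition cell_weight :: "real \<Rightarrow> real \<Rightarrow> real \<Rightarrow> nat \<Rightarrow> nat \<Rightarrow> real" where
  "cell_weight p \<gamma> M j s = (M * 2 ^ s * (4 * \<gamma> * \<gamma> / (\<gamma> - 1) / \<gamma> ^ j)) powr p"

definition cell_deviation :: "ell2 measure \<Rightarrow> real \<Rightarrow> real \<Rightarrow> nat \<Rightarrow> nat \<Rightarrow> (nat \<Rightarrow> ell2) \<Rightarrow> nat \<Rightarrow> nat \<times> int list \<Rightarrow> ennreal" where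
  "cell_deviation \<mu> \<gamma> M k n x t i = ennreal \<bar>measure \<mu> {y. label \<gamma> M k t y = i} -
     (\<Sum>l<n. indicator {y. label \<gamma> M k t y = i} (x l)) / real n\<bar>"

text \<open>The first sum is step 0, where the full mass may be matched inside cells of level
  \<open>k\<close>. The term for \<open>t\<close> pays for matching at step \<open>t + 1\<close>
  what step \<open>t\<close> left over; \<open>t = k\<close> is the merging of all shells. The
  factor 2 accounts for the residuals of both measures.\<close>

definition transport_cost :: "ell2 measure \<Rightarrow> real \<Rightarrow> real \<Rightarrow> real \<Rightarrow> nat \<Rightarrow> nat \<Rightarrow> (nat \<Rightarrow> ell2) \<Rightarrow> ennreal" where
  "transport_cost \<mu> p \<gamma> M k n x =
     (\<Sum>s. ennreal (cell_weight p \<gamma> M (Suc k) s) * emeasure \<mu> {y. shell \<gamma> M y = s}) +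
     (\<Sum>t\<le>k. 2 * (\<Sum>s. ennreal (cell_weight p \<gamma> M (k - t) s) *
        (\<Sum>i\<in>{s} \<times> codes \<gamma> (k - t). cell_deviation \<mu> \<gamma> M k n x t i)))"

lemma AE_empirical:
  assumes "1 \<le> n" "\<And>i. i < n \<Longrightarrow> P (x i)" "{y. P y} \<in> sets borel"
  shows "AE y in empirical_measure n x. P y"
proof -
  have "x \<in> measurable (uniform_count_measure {..<n}) borel"
    by (simp add: measurable_def sets_uniform_count_measure space_uniform_count_measure)
  then show ?thesis
    unfolding empirical_measure_def using assms
    by (subst AE_distr_iff) (auto simp: space_uniform_count_measure intro!: AE_I2)
qed

text \<open>The greedy coupling along the labels is one competitor in the infimum.\<close>

lemma wasserstein_empirical_le:
  assumes "1 < \<gamma>" "0 < M" "1 \<le> p" "1 \<le> n"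
    and \<mu>: "prob_space \<mu>" "sets \<mu> = sets borel" "AE y in \<mu>. wnorm2 \<gamma> y < top"
    and x: "\<And>i. i < n \<Longrightarrow> wnorm2 \<gamma> (x i) < top"
  shows "wasserstein p (empirical_measure n x) \<mu> \<le> ennreal_powr (transport_cost \<mu> p \<gamma> M k n x) (1 / p)"
proof -
  define e where "e = empirical_measure n x"
  define c where "c = label \<gamma> M k"
  have e: "prob_space e" "sets e = sets borel"
    unfolding e_def using assms(4) by (simp_all add: prob_space_empirical sets_empirical)
  have AE_e: "AE y in e. wnorm2 \<gamma> y < top"
    unfolding e_def by (rule AE_empirical[OF assms(4)]) (use x in auto)
  interpret e: prob_space e by fact
  interpret \<mu>: prob_space \<mu> by fact
  have spe: "space e = UNIV" "space \<mu> = UNIV"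
    using sets_eq_imp_space_eq[OF e(2)] sets_eq_imp_space_eq[OF \<mu>(2)] by auto
  interpret matching e \<mu> c
  proof unfold_locales
    show "sets \<mu> = sets e" using e(2) \<mu>(2) by simp
    show "c t \<in> measurable e (count_space UNIV)" for t
      unfolding c_def using label_measurable measurable_cong_sets[OF e(2) refl] by blast
    show "c (Suc t) y = c (Suc t) z" if "c t y = c t z" for t y z
      using that unfolding c_def by (rule label_coarser)
  qed (rule spe)
  interpret S: matching \<mu> e c by (rule swap)
  have const: "c (Suc k) y = c (Suc k) z" for y z by (simp add: c_def)
  define W where "W j y = ennreal (cell_weight p \<gamma> M j (shell \<gamma> M y))" for j y
  define G where "G = {y. wnorm2 \<gamma> y < top}"
  have shell_e [measurable]: "shell \<gamma> M \<in> measurable e (count_space UNIV)"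
    and shell_\<mu> [measurable]: "shell \<gamma> M \<in> measurable \<mu> (count_space UNIV)"
    using shell_measurable measurable_cong_sets[OF e(2) refl] measurable_cong_sets[OF \<mu>(2) refl] by blast+
  have We [measurable]: "W j \<in> borel_measurable e" for j
    unfolding W_def by (rule measurable_compose[OF shell_e]) simp
  have W\<mu> [measurable]: "W j \<in> borel_measurable \<mu>" for j
    unfolding W_def by (rule measurable_compose[OF shell_\<mu>]) simp
  have norm_le: "norm y \<le> M * 2 ^ shell \<gamma> M y" if "y \<in> G" for y
    using norm_le_wnorm[OF assms(1)] wnorm_shell[OF assms(2), of \<gamma> y] that by (fastforce simp: G_def)
  have B: "4 \<le> 4 * \<gamma> * \<gamma> / (\<gamma> - 1)"
  proof -
    have "1 * (\<gamma> - 1) \<le> \<gamma> * \<gamma>" using assms(1) by (intro mult_mono) auto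
    then show ?thesis using assms(1) by (simp add: field_simps)
  qed
  \<comment> \<open>Across shells the distance is bounded by the two norms, hence by the larger of
    the two shell radii up to a factor; \<open>B\<close> shows that the constant in
    \<open>cell_weight\<close> is large enough.\<close>
  have root: "ennreal (norm (y - z) powr p) \<le> W 0 y + W 0 z" if "y \<in> G" "z \<in> G" for y z
  proof -
    define a b where "a = M * 2 ^ shell \<gamma> M y" and "b = M * 2 ^ shell \<gamma> M z"
    have ab: "0 < a" "0 < b" using assms(2) by (auto simp: a_def b_def)
    have "norm (y - z) \<le> a + b"
      using norm_triangle_ineq4[of y z] norm_le[OF that(1)] norm_le[OF that(2)] by (simp add: a_def b_def)
    also have "\<dots> \<le> 4 * max a b" using ab by auto
    finally have "norm (y - z) powr p \<le> (4 * max a b) powr p"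
      using assms(3) by (intro powr_mono2) auto
    also have "\<dots> \<le> (a * 4) powr p + (b * 4) powr p" using ab by (auto simp: max_def mult.commute)
    also have "\<dots> \<le> (a * (4 * \<gamma> * \<gamma> / (\<gamma> - 1))) powr p + (b * (4 * \<gamma> * \<gamma> / (\<gamma> - 1))) powr p"
      using ab assms(3) B by (intro add_mono powr_mono2 mult_left_mono) auto
    finally show ?thesis
      by (simp add: W_def cell_weight_def a_def b_def ennreal_leI flip: ennreal_plus)
  qed
  have inner: "ennreal (norm (y - z) powr p) \<le> W (Suc k - t) z"
    if "y \<in> G" "z \<in> G" "t \<le> k" "c t y = c t z" for y z t
  proof -
    have "norm (y - z) \<le> M * 2 ^ shell \<gamma> M z * (4 * \<gamma> / (\<gamma> - 1) / \<gamma> ^ (k - t))"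
      using that assms(1,2) by (intro norm_diff_label_le) (auto simp: G_def c_def)
    also have "4 * \<gamma> / (\<gamma> - 1) / \<gamma> ^ (k - t) = 4 * \<gamma> * \<gamma> / (\<gamma> - 1) / \<gamma> ^ (Suc k - t)"
      using that(3) assms(1) by (simp add: Suc_diff_le)
    finally show ?thesis
      unfolding W_def cell_weight_def using assms(3) by (intro ennreal_leI powr_mono2) auto
  qed
  have labels: "AE y in \<mu>. c t y \<in> {shell \<gamma> M y} \<times> codes \<gamma> (k - t)"
    and labels': "AE y in e. c t y \<in> {shell \<gamma> M y} \<times> codes \<gamma> (k - t)" if "t \<le> k" for t
  proof -
    have "c t y \<in> {shell \<gamma> M y} \<times> codes \<gamma> (k - t)" if "wnorm2 \<gamma> y < top" for y
      using label_approx[OF assms(1) \<open>t \<le> k\<close> scaled_in_ellipsoid[OF assms(2) that]]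
        fst_label[OF \<open>t \<le> k\<close>, of \<gamma> M y] by (simp add: c_def mem_Times_iff)
    then show "AE y in \<mu>. c t y \<in> {shell \<gamma> M y} \<times> codes \<gamma> (k - t)"
      "AE y in e. c t y \<in> {shell \<gamma> M y} \<times> codes \<gamma> (k - t)"
      using \<mu>(3) AE_e by (auto elim!: eventually_mono)
  qed
  have dev: "ennreal \<bar>measure \<mu> {y. c t y = i} - measure e {y. c t y = i}\<bar> = cell_deviation \<mu> \<gamma> M k n x t i"
    "ennreal \<bar>measure e {y. c t y = i} - measure \<mu> {y. c t y = i}\<bar> = cell_deviation \<mu> \<gamma> M k n x t i" for t i
  proof -
    have "{y. c t y = i} \<in> sets borel"
      using measurable_cell[of "\<lambda>j. j = i" t] spe e(2) by (simp add: pred_def)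
    then show "ennreal \<bar>measure \<mu> {y. c t y = i} - measure e {y. c t y = i}\<bar> = cell_deviation \<mu> \<gamma> M k n x t i"
      "ennreal \<bar>measure e {y. c t y = i} - measure \<mu> {y. c t y = i}\<bar> = cell_deviation \<mu> \<gamma> M k n x t i"
      unfolding cell_deviation_def e_def
      by (simp_all add: measure_empirical[OF assms(4)] c_def abs_minus_commute)
  qed
  define R where "R t = (\<Sum>s. ennreal (cell_weight p \<gamma> M (k - t) s) *
        (\<Sum>i\<in>{s} \<times> codes \<gamma> (k - t). cell_deviation \<mu> \<gamma> M k n x t i))" for t
  have fin: "finite ({s} \<times> codes \<gamma> j)" for s :: nat and j using finite_codes[OF assms(1)] by auto
  have R\<mu>: "(\<integral>\<^sup>+y. ennreal (resid c (Suc t) \<mu> e y) * W (k - t) y \<partial>\<mu>) \<le> R t" if "t \<le> k" for t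
    unfolding W_def R_def dev(1)[symmetric]
    by (rule S.nn_integral_resid_levels_le[OF shell_\<mu> fin labels[OF that]])
  have Re: "(\<integral>\<^sup>+y. ennreal (resid c (Suc t) e \<mu> y) * W (k - t) y \<partial>e) \<le> R t" if "t \<le> k" for t
    unfolding W_def R_def dev(2)[symmetric]
    by (rule nn_integral_resid_levels_le[OF shell_e fin labels'[OF that]])
  \<comment> \<open>Inside a shell the whole cost is charged to the second point, since both points
    have the same weight; only the merging of the shells charges the first point as well.\<close>
  define d where "d t = (if t = Suc k then W 0 else (\<lambda>_. 0))" for t
  have [measurable]: "d t \<in> borel_measurable e" for t by (simp add: d_def)
  have "(\<integral>\<^sup>+(y, z). ennreal (norm (y - z) powr p) \<partial>coupling (Suc k))
    \<le> (\<Sum>t\<le>Suc k. (\<integral>\<^sup>+y. ennreal (resid c t e \<mu> y) * d t y \<partial>e) +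
          (\<integral>\<^sup>+z. ennreal (resid c t \<mu> e z) * W (Suc k - t) z \<partial>\<mu>))"
  proof (rule coupling_cost_le[where G = G])
    have "sets (e \<Otimes>\<^sub>M \<mu>) = sets (borel \<Otimes>\<^sub>M borel)"
      by (intro sets_pair_measure_cong e(2) \<mu>(2))
    moreover have "(\<lambda>(y, z). ennreal (norm (y - z :: ell2) powr p)) \<in> borel_measurable (borel \<Otimes>\<^sub>M borel)"
      unfolding case_prod_beta by measurable
    ultimately show "(\<lambda>(y, z). ennreal (norm (y - z) powr p)) \<in> borel_measurable (e \<Otimes>\<^sub>M \<mu>)"
      using measurable_cong_sets by blast
    show "AE y in e. y \<in> G" "AE y in \<mu>. y \<in> G" using AE_e \<mu>(3) by (auto simp: G_def)
    show "ennreal (norm (y - z) powr p) \<le> d t y + W (Suc k - t) z"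
      if "t \<le> Suc k" "y \<in> G" "z \<in> G" "c t y = c t z" for t y z
      using root[OF that(2,3)] inner[OF that(2,3) _ that(4)] that(1) by (auto simp: d_def le_Suc_eq)
  qed auto
  \<comment> \<open>Step 0 is split off: its residual density is 1 and \<open>d 0\<close>
    vanishes.\<close>
  also have "\<dots> = (\<integral>\<^sup>+z. W (Suc k) z \<partial>\<mu>) +
      (\<Sum>t\<le>k. (\<integral>\<^sup>+y. ennreal (resid c (Suc t) e \<mu> y) * d (Suc t) y \<partial>e) +
        (\<integral>\<^sup>+z. ennreal (resid c (Suc t) \<mu> e z) * W (k - t) z \<partial>\<mu>))"
    by (subst sum.atMost_Suc_shift) (simp add: d_def)
  also have "\<dots> \<le> (\<integral>\<^sup>+z. W (Suc k) z \<partial>\<mu>) + (\<Sum>t\<le>k. R t + R t)"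
    using R\<mu> Re Re[of k] by (intro add_left_mono sum_mono add_mono) (auto simp: d_def)
  also have "(\<integral>\<^sup>+z. W (Suc k) z \<partial>\<mu>) = (\<Sum>s. ennreal (cell_weight p \<gamma> M (Suc k) s) * emeasure \<mu> {y. shell \<gamma> M y = s})"
  proof -
    have ms: "{y. shell \<gamma> M y = s} \<in> sets \<mu>" for s
      using measurable_sets[OF shell_\<mu>, of "{s}"] spe by (simp add: vimage_def)
    show ?thesis
      using nn_integral_nat_levels[OF shell_\<mu> _ spe(2), of "\<lambda>_. 1" "\<lambda>s. ennreal (cell_weight p \<gamma> M (Suc k) s)"] ms
      by (simp add: W_def)
  qed
  finally have "(\<integral>\<^sup>+(y, z). ennreal (norm (y - z) powr p) \<partial>coupling (Suc k)) \<le> transport_cost \<mu> p \<gamma> M k n x"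
    by (simp add: transport_cost_def R_def mult_2)
  then have "ennreal_powr (\<integral>\<^sup>+(y, z). ennreal (norm (y - z) powr p) \<partial>coupling (Suc k)) (1 / p)
      \<le> ennreal_powr (transport_cost \<mu> p \<gamma> M k n x) (1 / p)"
    using assms(3) by (intro ennreal_powr_mono) auto
  moreover have "coupling (Suc k) \<in> couplings e \<mu>"
    by (rule coupling_in_couplings) (use const e(2) in \<open>auto intro: matching_axioms\<close>)
  ultimately show ?thesis
    unfolding wasserstein_def e_def[symmetric] by (rule INF_lower2[rotated])
qed


section \<open>The upper bound\<close>

definition decay_rate :: "real \<Rightarrow> nat \<Rightarrow> real" where
  "decay_rate \<gamma> n = exp (- sqrt (2 * ln \<gamma> * ln (real n)))"

definition critical_level :: "real \<Rightarrow> nat \<Rightarrow> real" where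
  "critical_level \<gamma> n = sqrt (2 * ln (real n) / ln \<gamma>)"

text \<open>The critical level \<open>L\<close> solves
  \<open>L\<^sup>2 / 2 * ln \<gamma> = ln n\<close>, and multiplying \<open>L\<close> by
  \<open>ln \<gamma>\<close> gives the exponent of the claimed rate.\<close>

lemma
  assumes "1 < \<gamma>" "1 \<le> n"
  shows critical_level_nonneg: "0 \<le> critical_level \<gamma> n"
    and powr_critical_level: "\<gamma> powr ((critical_level \<gamma> n)\<^sup>2 / 2) = real n"
    and decay_rate_eq: "decay_rate \<gamma> n = \<gamma> powr (- critical_level \<gamma> n)"
proof -
  have lg: "0 < ln \<gamma>" and ln: "0 \<le> ln (real n)" using assms by auto
  show "0 \<le> critical_level \<gamma> n" using lg ln by (simp add: critical_level_def)
  have "(critical_level \<gamma> n)\<^sup>2 / 2 * ln \<gamma> = ln (real n)"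
    using lg ln by (simp add: critical_level_def)
  then show "\<gamma> powr ((critical_level \<gamma> n)\<^sup>2 / 2) = real n"
    using assms by (simp add: powr_def)
  have "critical_level \<gamma> n * ln \<gamma> = sqrt (2 * ln (real n) / ln \<gamma>) * sqrt ((ln \<gamma>)\<^sup>2)"
    using lg by (simp add: critical_level_def)
  also have "\<dots> = sqrt (2 * ln \<gamma> * ln (real n))"
    using lg by (subst real_sqrt_mult[symmetric]) (simp add: power2_eq_square)
  finally show "decay_rate \<gamma> n = \<gamma> powr (- critical_level \<gamma> n)"
    using assms by (simp add: powr_def decay_rate_def)
qed

definition code_bound :: "real \<Rightarrow> nat \<Rightarrow> real" where
  "code_bound \<gamma> j = 72 ^ j * \<gamma> powr (real j * (real j + 1) / 2)"

lemma code_bound_pos: "1 < \<gamma> \<Longrightarrow> 0 < code_bound \<gamma> j"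
  by (simp add: code_bound_def)

lemma sum_power_diff_le:
  fixes r :: real
  assumes "0 \<le> r" "r < 1"
  shows "(\<Sum>j\<le>k. r ^ (k - j)) \<le> 1 / (1 - r)"
proof -
  have "(\<Sum>j\<le>k. r ^ (k - j)) = (\<Sum>j\<le>k. r ^ j)"
    by (rule sum.reindex_bij_witness[of _ "\<lambda>j. k - j" "\<lambda>j. k - j"]) auto
  also have "\<dots> = (\<Sum>j<Suc k. r ^ j)" by (simp add: lessThan_Suc_atMost)
  also have "\<dots> \<le> (\<Sum>j. r ^ j)"
    using assms by (intro sum_le_suminf) (auto simp: summable_geometric)
  finally show ?thesis using assms by (simp add: suminf_geometric)
qed

text \<open>Since \<open>code_bound \<gamma> j\<close> has logarithm \<open>j\<^sup>2/2 \<cdot> ln \<gamma> + O(j)\<close>, staying a constant \<open>a\<close> below the critical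
  level makes \<open>code_bound \<gamma> j / n\<close> decay geometrically in \<open>k - j\<close>, at any prescribed rate.\<close>

lemma level_choice:
  fixes \<gamma> p \<eta> :: real
  assumes "1 < \<gamma>" "1 \<le> p" "0 < \<eta>"
  defines "a \<equiv> 2 * (ln 72 / ln \<gamma>) + 1 + (p + 1) / \<eta>"
  assumes "1 \<le> n"
  shows "\<exists>k. (1 / \<gamma> ^ Suc k) powr p + 4 * (\<Sum>j\<le>k. (1 / \<gamma> ^ j) powr p * (code_bound \<gamma> j / n) powr \<eta>)
      \<le> (1 + 4 * (\<gamma> / (\<gamma> - 1))) * (1 / \<gamma> ^ k) powr p
    \<and> 1 / \<gamma> ^ k \<le> \<gamma> powr (a + 1) * decay_rate \<gamma> n"
proof -
  define L where "L = critical_level \<gamma> n"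
  define C where "C = ln 72 / ln \<gamma>"
  \<comment> \<open>This is 0 when the critical level is below \<open>a\<close>; the bound
    \<open>L - a - 1 \<le> k\<close> survives the truncation, and \<open>expo\<close> treats
    \<open>k = 0\<close> separately.\<close>
  define k where "k = nat \<lfloor>L - a\<rfloor>"
  have lg: "0 < ln \<gamma>" using assms by simp
  have C: "0 < C" using lg by (simp add: C_def)
  have a: "0 < a" "a = 2 * C + 1 + (p + 1) / \<eta>"
    using C assms by (auto simp: a_def C_def[symmetric] intro!: add_pos_pos divide_pos_pos)
  have L: "0 \<le> L" "\<gamma> powr (L\<^sup>2 / 2) = n"
    using critical_level_nonneg powr_critical_level assms by (auto simp: L_def)
  have inv: "1 / \<gamma> ^ j = \<gamma> powr (- real j)" for j
    using assms by (simp add: powr_minus powr_realpow divide_inverse)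
  have N: "code_bound \<gamma> j = \<gamma> powr (C * j + real j * (real j + 1) / 2)" for j
  proof -
    have "\<gamma> powr C = 72" using lg assms by (simp add: powr_def C_def)
    then have "(72::real) ^ j = \<gamma> powr (C * j)"
      using assms by (simp add: powr_realpow flip: powr_powr)
    then show ?thesis by (simp add: code_bound_def powr_add)
  qed
  \<comment> \<open>The offset \<open>a\<close> is \<open>D + Q\<close>: \<open>D\<close> absorbs
    the linear terms in the logarithm of \<open>code_bound\<close>, and \<open>Q\<close> supplies
    the geometric decay.\<close>
  define D where "D = 2 * C + 1"
  define Q where "Q = (p + 1) / \<eta>"
  have expo: "C * j + real j * (real j + 1) / 2 - L\<^sup>2 / 2 \<le> - (real (k - j) * ((p + 1) / \<eta>))" if "j \<le> k" for j
  proof (cases "k = 0")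
    case True
    then show ?thesis using that by simp
  next
    case False
    then have "real k + a \<le> L" unfolding k_def by linarith
    then have "(real k + a)\<^sup>2 \<le> L\<^sup>2" using a by (intro power_mono) auto
    moreover have "(real k)\<^sup>2 + 2 * a * real k \<le> (real k + a)\<^sup>2" by (simp add: power2_sum)
    ultimately have L2: "(real k)\<^sup>2 + 2 * a * real k \<le> L\<^sup>2" by linarith
    have jk: "(real j)\<^sup>2 \<le> (real k)\<^sup>2" using that by simp
    have ak: "2 * a * real k = 2 * (D * real k) + 2 * (real k * Q)"
      unfolding a(2) Q_def[symmetric] D_def by (simp add: algebra_simps)
    have D: "D * real j \<le> D * real k" "0 \<le> D * real k" "0 \<le> real j * Q"
      using that C assms by (auto intro!: mult_left_mono simp: Q_def D_def)
    have e1: "C * real j + real j * (real j + 1) / 2 = (D * real j + (real j)\<^sup>2) / 2"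
      by (simp add: D_def field_simps power2_eq_square)
    have e2: "real (k - j) * Q = real k * Q - real j * Q"
      using that by (simp add: of_nat_diff left_diff_distrib)
    \<comment> \<open>With the products replaced by variables the estimate is linear.\<close>
    have "(dj + jj) / 2 - ll / 2 \<le> - (kq - jq)"
      if "kk + ak \<le> ll" "jj \<le> kk" "ak = 2 * dk + 2 * kq" "dj \<le> dk" "0 \<le> dk" "0 \<le> jq"
      for dj jj ll kq jq kk ak dk :: real
      using that by (simp add: field_simps)
    from this[OF L2 jk ak D] show ?thesis unfolding Q_def[symmetric] e1 e2 .
  qed
  \<comment> \<open>Of the decay \<open>(k - j) * (p + 1)\<close> in the exponent,
    \<open>(k - j) * p\<close> lowers the factor of level \<open>j\<close> to that of level
    \<open>k\<close>; what remains is a geometric series.\<close>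
  have term_le: "(1 / \<gamma> ^ j) powr p * (code_bound \<gamma> j / n) powr \<eta> \<le> (1 / \<gamma> ^ k) powr p * (1 / \<gamma>) ^ (k - j)"
    if "j \<le> k" for j
  proof -
    have "code_bound \<gamma> j / n = \<gamma> powr (C * j + real j * (real j + 1) / 2 - L\<^sup>2 / 2)"
      unfolding N L(2)[symmetric] by (simp add: powr_diff)
    also have "\<dots> \<le> \<gamma> powr (- (real (k - j) * ((p + 1) / \<eta>)))"
      using assms expo[OF that] by (intro powr_mono) auto
    finally have "(code_bound \<gamma> j / n) powr \<eta> \<le> (\<gamma> powr (- (real (k - j) * ((p + 1) / \<eta>)))) powr \<eta>"
      using assms by (intro powr_mono2) (auto simp: code_bound_def)
    also have "\<dots> = \<gamma> powr (- (real (k - j) * (p + 1)))"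
      using assms by (simp add: powr_powr)
    finally have "(1 / \<gamma> ^ j) powr p * (code_bound \<gamma> j / n) powr \<eta>
        \<le> \<gamma> powr (- real j * p) * \<gamma> powr (- (real (k - j) * (p + 1)))"
      unfolding inv powr_powr by (intro mult_left_mono) auto
    also have "\<dots> = \<gamma> powr (- real k * p) * \<gamma> powr (- real (k - j))"
      using that by (simp add: of_nat_diff algebra_simps flip: powr_add)
    also have "\<gamma> powr (- real (k - j)) = (1 / \<gamma>) ^ (k - j)"
      using inv[of "k - j"] by (simp add: power_one_over)
    finally show ?thesis unfolding inv powr_powr by simp
  qed
  have "(\<Sum>j\<le>k. (1 / \<gamma> ^ j) powr p * (code_bound \<gamma> j / n) powr \<eta>) \<le> (\<Sum>j\<le>k. (1 / \<gamma> ^ k) powr p * (1 / \<gamma>) ^ (k - j))"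
    by (intro sum_mono term_le) auto
  also have "\<dots> = (1 / \<gamma> ^ k) powr p * (\<Sum>j\<le>k. (1 / \<gamma>) ^ (k - j))" by (simp add: sum_distrib_left)
  also have "\<dots> \<le> (1 / \<gamma> ^ k) powr p * (1 / (1 - 1 / \<gamma>))"
    using assms by (intro mult_left_mono sum_power_diff_le) auto
  also have "1 / (1 - 1 / \<gamma>) = \<gamma> / (\<gamma> - 1)" using assms by (simp add: field_simps)
  finally have s: "(\<Sum>j\<le>k. (1 / \<gamma> ^ j) powr p * (code_bound \<gamma> j / n) powr \<eta>) \<le> (1 / \<gamma> ^ k) powr p * (\<gamma> / (\<gamma> - 1))" .
  have "1 / \<gamma> ^ Suc k \<le> 1 / \<gamma> ^ k"
    using assms by (intro divide_left_mono power_increasing) auto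
  then have mono: "(1 / \<gamma> ^ Suc k) powr p \<le> (1 / \<gamma> ^ k) powr p"
    using assms by (intro powr_mono2) auto
  have 1: "(1 / \<gamma> ^ Suc k) powr p + 4 * (\<Sum>j\<le>k. (1 / \<gamma> ^ j) powr p * (code_bound \<gamma> j / n) powr \<eta>)
      \<le> (1 + 4 * (\<gamma> / (\<gamma> - 1))) * (1 / \<gamma> ^ k) powr p"
  proof -
    have *: "(1 + 4 * g) * X = X + 4 * (X * g)" for g X :: real by (simp add: algebra_simps)
    show ?thesis
      unfolding * by (rule add_mono[OF mono mult_left_mono[OF s]]) simp
  qed
  have "L - a - 1 \<le> real k" unfolding k_def by linarith
  then have "1 / \<gamma> ^ k \<le> \<gamma> powr (a + 1 - L)"
    unfolding inv using assms by (intro powr_mono) auto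
  also have "\<dots> = \<gamma> powr (a + 1) * decay_rate \<gamma> n"
    using decay_rate_eq[OF assms(1) \<open>1 \<le> n\<close>]
    by (simp only: L_def[symmetric] diff_conv_add_uminus powr_add)
  finally show ?thesis using 1 by blast
qed

section \<open>Shell masses under the moment condition, and the expected cost\<close>

lemma P_expD:
  assumes "\<mu> \<in> P_exp q \<gamma> M"
  shows "prob_space \<mu>" "sets \<mu> = sets borel"
    "(\<integral>\<^sup>+x. ennreal_powr (wnorm2 \<gamma> x) (q / 2) \<partial>\<mu>) \<le> ennreal (M powr q)"
  using assms by (auto simp: P_exp_def prob_measures_def wnorm2_def)

lemma borel_measurable_ennreal_powr [measurable (raw)]:
  assumes [measurable]: "f \<in> borel_measurable M"
  shows "(\<lambda>x. ennreal_powr (f x) r) \<in> borel_measurable M"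
  unfolding ennreal_powr_def by measurable

lemma P_exp_finite:
  assumes "\<mu> \<in> P_exp q \<gamma> M"
  shows "AE x in \<mu>. wnorm2 \<gamma> x < top"
proof -
  note \<mu> = P_expD[OF assms]
  note [measurable_cong] = \<mu>(2)
  have "(\<integral>\<^sup>+x. ennreal_powr (wnorm2 \<gamma> x) (q / 2) \<partial>\<mu>) \<noteq> \<infinity>"
    using \<mu>(3) by (auto simp: top_unique)
  then have "AE x in \<mu>. ennreal_powr (wnorm2 \<gamma> x) (q / 2) \<noteq> \<infinity>"
    by (intro nn_integral_PInf_AE) measurable
  then show ?thesis
    by (rule eventually_mono) (auto simp: ennreal_powr_def top.not_eq_extremum split: if_splits)
qed

text \<open>Markov's inequality at the inner radius \<open>M * 2 ^ (s - 1)\<close>; for shell 0 the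
  bound exceeds 1. Points with a divergent series cause no trouble, because the integrand is
  infinite there.\<close>

lemma P_exp_shell_le:
  assumes "\<mu> \<in> P_exp q \<gamma> M" "0 < M" "0 < q"
  shows "measure \<mu> {x. shell \<gamma> M x = s} \<le> 2 powr (q - q * s)"
proof (cases s)
  case 0
  interpret prob_space \<mu> by (rule P_expD[OF assms(1)])
  have "measure \<mu> {x. shell \<gamma> M x = s} \<le> 2 powr 0" by simp
  also have "\<dots> \<le> 2 powr (q - q * s)" using 0 assms by (intro powr_mono) auto
  finally show ?thesis .
next
  case (Suc r)
  note \<mu> = P_expD[OF assms(1)]
  note [measurable_cong] = \<mu>(2)
  interpret prob_space \<mu> by (rule \<mu>)
  let ?A = "{x. shell \<gamma> M x = s}"
  have A: "?A \<in> sets \<mu>"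
    using measurable_sets[OF shell_measurable, of "{s}" \<gamma> M] by (simp add: \<mu>(2) vimage_def)
  define b where "b = (M * 2 ^ r) powr q"
  have b: "0 < b" using assms by (simp add: b_def)
  have "ennreal (b * measure \<mu> ?A) = ennreal b * emeasure \<mu> ?A"
    using b by (simp add: emeasure_eq_measure ennreal_mult)
  also have "\<dots> = (\<integral>\<^sup>+x. ennreal b * indicator ?A x \<partial>\<mu>)"
    using A by (simp add: nn_integral_cmult_indicator)
  also have "\<dots> \<le> (\<integral>\<^sup>+x. ennreal_powr (wnorm2 \<gamma> x) (q / 2) \<partial>\<mu>)"
  proof (rule nn_integral_mono)
    fix x
    show "ennreal b * indicator ?A x \<le> ennreal_powr (wnorm2 \<gamma> x) (q / 2)"
    proof (cases "x \<in> ?A \<and> wnorm2 \<gamma> x \<noteq> top")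
      case True
      then have "M * 2 ^ r < wnorm \<gamma> x" using shell_gt[of r \<gamma> M x] Suc by simp
      then have "b \<le> wnorm \<gamma> x powr q" unfolding b_def using assms by (intro powr_mono2) auto
      also have "wnorm \<gamma> x powr q = enn2real (wnorm2 \<gamma> x) powr (q / 2)"
        by (simp add: wnorm_def powr_half_sqrt[symmetric] powr_powr)
      finally show ?thesis using True by (simp add: ennreal_powr_def ennreal_leI)
    qed (auto simp: ennreal_powr_def indicator_def)
  qed
  also note \<mu>(3)
  finally have "b * measure \<mu> ?A \<le> M powr q" by (subst (asm) ennreal_le_iff) auto
  then have "measure \<mu> ?A \<le> M powr q / b" using b by (simp add: field_simps)
  also have "M powr q / b = 2 powr (q - q * s)"
    using assms Suc by (simp add: b_def powr_mult powr_powr powr_minus powr_realpow[symmetric] field_simps flip: powr_add)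
  finally show ?thesis .
qed

text \<open>In each shell and level the expected deviations are interpolated, with the shell mass as
  total and \<open>code_bound\<close> as number of cells. The 4 is the 2 in
  \<open>transport_cost\<close> times the 2 of the interpolation.\<close>

lemma expected_transport_cost_le:
  assumes "1 < \<gamma>" "0 < M" "1 \<le> p" "1 \<le> n" "0 < \<eta>" "\<eta> \<le> 1/2"
    and \<mu>: "prob_space \<mu>" "sets \<mu> = sets borel"
  defines "a \<equiv> \<lambda>s. measure \<mu> {y. shell \<gamma> M y = s} powr (1 - \<eta>)"
  shows "(\<integral>\<^sup>+x. transport_cost \<mu> p \<gamma> M k n x \<partial>(\<Pi>\<^sub>M i\<in>{..<n}. \<mu>))
    \<le> (\<Sum>s. ennreal (cell_weight p \<gamma> M (Suc k) s * a s)) +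
       (\<Sum>j\<le>k. ennreal (4 * (code_bound \<gamma> j / n) powr \<eta>) * (\<Sum>s. ennreal (cell_weight p \<gamma> M j s * a s)))"
    and "transport_cost \<mu> p \<gamma> M k n \<in> borel_measurable (\<Pi>\<^sub>M i\<in>{..<n}. \<mu>)"
proof -
  interpret prob_space \<mu> by (rule \<mu>)
  define P where "P = (\<Pi>\<^sub>M i\<in>{..<n}. \<mu>)"
  interpret P: prob_space P
    unfolding P_def by (intro prob_space_PiM prob_space_axioms)
  have sp: "space \<mu> = UNIV" using sets_eq_imp_space_eq[OF \<mu>(2)] by simp
  have cellm [measurable]: "{y. label \<gamma> M k t y = i} \<in> sets \<mu>" for t i
    using measurable_sets[OF label_measurable, of "{i}" \<gamma> M k t] by (simp add: \<mu>(2) vimage_def)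
  have shellm [measurable]: "{y. shell \<gamma> M y = s} \<in> sets \<mu>" for s
    using measurable_sets[OF shell_measurable, of "{s}" \<gamma> M] by (simp add: \<mu>(2) vimage_def)
  have comp [measurable]: "(\<lambda>x. x l) \<in> measurable P \<mu>" if "l < n" for l
    using that by (simp add: P_def)
  have devm [measurable]: "(\<lambda>x. cell_deviation \<mu> \<gamma> M k n x t i) \<in> borel_measurable P" for t i
    unfolding cell_deviation_def by measurable
  show "transport_cost \<mu> p \<gamma> M k n \<in> borel_measurable (\<Pi>\<^sub>M i\<in>{..<n}. \<mu>)"
    unfolding transport_cost_def[abs_def] P_def[symmetric] by measurable
  have dev: "(\<integral>\<^sup>+x. (\<Sum>i\<in>{s} \<times> codes \<gamma> (k - t). cell_deviation \<mu> \<gamma> M k n x t i) \<partial>P)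
      \<le> ennreal (2 * (a s * (code_bound \<gamma> (k - t) / n) powr \<eta>))" if "t \<le> k" for s t
  proof -
    let ?Z = "{s} \<times> codes \<gamma> (k - t)" and ?m = "\<lambda>i. measure \<mu> {y. label \<gamma> M k t y = i}"
    have "(\<integral>\<^sup>+x. (\<Sum>i\<in>?Z. cell_deviation \<mu> \<gamma> M k n x t i) \<partial>P) = (\<Sum>i\<in>?Z. \<integral>\<^sup>+x. cell_deviation \<mu> \<gamma> M k n x t i \<partial>P)"
      by (rule nn_integral_sum) measurable
    also have "\<dots> \<le> (\<Sum>i\<in>?Z. ennreal (min (2 * ?m i) (sqrt (?m i / n))))"
      unfolding cell_deviation_def P_def by (intro sum_mono expected_empirical_deviation cellm assms)
    also have "\<dots> = ennreal (\<Sum>i\<in>?Z. min (2 * ?m i) (sqrt (?m i / n)))"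
      by (intro sum_ennreal) auto
    also have "\<dots> \<le> ennreal (2 * (measure \<mu> {y. shell \<gamma> M y = s} powr (1 - \<eta>) * (code_bound \<gamma> (k - t) / n) powr \<eta>))"
    proof (intro ennreal_leI sum_min_le_interpolate)
      show "(\<Sum>i\<in>?Z. ?m i) \<le> measure \<mu> {y. shell \<gamma> M y = s}"
      proof -
        have "(\<Sum>i\<in>?Z. ?m i) = measure \<mu> (\<Union>i\<in>?Z. {y. label \<gamma> M k t y = i})"
          using finite_codes[OF assms(1)]
          by (intro finite_measure_finite_Union[symmetric]) (auto simp: disjoint_family_on_def)
        also have "\<dots> \<le> measure \<mu> {y. shell \<gamma> M y = s}"
        proof (intro finite_measure_mono shellm subsetI)
          fix y assume "y \<in> (\<Union>i\<in>?Z. {y. label \<gamma> M k t y = i})"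
          then show "y \<in> {y. shell \<gamma> M y = s}"
            using fst_label[OF \<open>t \<le> k\<close>, of \<gamma> M y] by auto
        qed
        finally show ?thesis .
      qed
      show "real (card ?Z) \<le> code_bound \<gamma> (k - t)"
        using card_codes_le[OF assms(1), of "k - t"] by (simp add: code_bound_def card_cartesian_product)
    qed (use assms finite_codes code_bound_pos in auto)
    finally show ?thesis by (simp add: a_def)
  qed
  have w0: "0 \<le> cell_weight p \<gamma> M j s" for j s by (simp add: cell_weight_def)
  have a0: "0 \<le> a s" for s by (simp add: a_def)
  have part: "(\<integral>\<^sup>+x. 2 * (\<Sum>s. ennreal (cell_weight p \<gamma> M (k - t) s) *
        (\<Sum>i\<in>{s} \<times> codes \<gamma> (k - t). cell_deviation \<mu> \<gamma> M k n x t i)) \<partial>P)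
      \<le> ennreal (4 * (code_bound \<gamma> (k - t) / n) powr \<eta>) * (\<Sum>s. ennreal (cell_weight p \<gamma> M (k - t) s * a s))"
    if "t \<le> k" for t
  proof -
    let ?w = "cell_weight p \<gamma> M (k - t)" and ?c = "(code_bound \<gamma> (k - t) / n) powr \<eta>"
    have "(\<integral>\<^sup>+x. 2 * (\<Sum>s. ennreal (?w s) * (\<Sum>i\<in>{s} \<times> codes \<gamma> (k - t). cell_deviation \<mu> \<gamma> M k n x t i)) \<partial>P)
      = 2 * (\<Sum>s. ennreal (?w s) * (\<integral>\<^sup>+x. (\<Sum>i\<in>{s} \<times> codes \<gamma> (k - t). cell_deviation \<mu> \<gamma> M k n x t i) \<partial>P))"
      by (subst nn_integral_cmult, measurable, subst nn_integral_suminf, measurable, subst nn_integral_cmult) auto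
    also have "\<dots> \<le> 2 * (\<Sum>s. ennreal (?w s) * ennreal (2 * (a s * ?c)))"
      by (intro mult_left_mono suminf_le dev[OF that]) auto
    also have "\<dots> = (\<Sum>s. 2 * (ennreal (?w s) * ennreal (2 * (a s * ?c))))"
      by (rule ennreal_suminf_cmult[symmetric])
    also have "\<dots> = (\<Sum>s. ennreal (4 * ?c) * ennreal (?w s * a s))"
    proof (intro suminf_cong)
      fix s
      have "2 * (ennreal (?w s) * ennreal (2 * (a s * ?c))) = ennreal 2 * (ennreal (?w s) * ennreal (2 * (a s * ?c)))"
        by simp
      also have "\<dots> = ennreal (2 * (?w s * (2 * (a s * ?c))))"
        using w0 a0 by (simp only: ennreal_mult[symmetric] mult_nonneg_nonneg powr_ge_zero zero_le_numeral)
      also have "2 * (?w s * (2 * (a s * ?c))) = (4 * ?c) * (?w s * a s)" by simp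
      also have "ennreal \<dots> = ennreal (4 * ?c) * ennreal (?w s * a s)"
        using w0 a0 by (intro ennreal_mult) auto
      finally show "2 * (ennreal (?w s) * ennreal (2 * (a s * ?c))) = ennreal (4 * ?c) * ennreal (?w s * a s)" .
    qed
    also have "\<dots> = ennreal (4 * ?c) * (\<Sum>s. ennreal (?w s * a s))"
      by (rule ennreal_suminf_cmult)
    finally show ?thesis .
  qed
  have "(\<integral>\<^sup>+x. transport_cost \<mu> p \<gamma> M k n x \<partial>P) =
     (\<Sum>s. ennreal (cell_weight p \<gamma> M (Suc k) s) * emeasure \<mu> {y. shell \<gamma> M y = s}) +
     (\<Sum>t\<le>k. \<integral>\<^sup>+x. 2 * (\<Sum>s. ennreal (cell_weight p \<gamma> M (k - t) s) *
        (\<Sum>i\<in>{s} \<times> codes \<gamma> (k - t). cell_deviation \<mu> \<gamma> M k n x t i)) \<partial>P)"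
    unfolding transport_cost_def
    by (subst nn_integral_add, measurable, subst nn_integral_sum) (auto simp: P.emeasure_space_1)
  also have "\<dots> \<le> (\<Sum>s. ennreal (cell_weight p \<gamma> M (Suc k) s * a s)) +
     (\<Sum>t\<le>k. ennreal (4 * (code_bound \<gamma> (k - t) / n) powr \<eta>) * (\<Sum>s. ennreal (cell_weight p \<gamma> M (k - t) s * a s)))"
  proof (intro add_mono sum_mono part suminf_le)
    fix s
    \<comment> \<open>A number in \<open>[0, 1]\<close> grows under an exponent below 1, so the step
      0 term gets the same form as the others.\<close>
    have "measure \<mu> {y. shell \<gamma> M y = s} \<le> a s"
    proof (cases "measure \<mu> {y. shell \<gamma> M y = s} = 0")
      case False
      then have "0 < measure \<mu> {y. shell \<gamma> M y = s}" using zero_less_measure_iff by blast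
      then have "measure \<mu> {y. shell \<gamma> M y = s} powr 1 \<le> a s"
        unfolding a_def using assms by (intro powr_mono') auto
      then show ?thesis by simp
    qed (simp add: a_def)
    then show "ennreal (cell_weight p \<gamma> M (Suc k) s) * emeasure \<mu> {y. shell \<gamma> M y = s}
        \<le> ennreal (cell_weight p \<gamma> M (Suc k) s * a s)"
      unfolding emeasure_eq_measure using w0
      by (subst ennreal_mult[symmetric]) (auto intro!: ennreal_leI mult_left_mono)
  qed auto
  also have "(\<Sum>t\<le>k. ennreal (4 * (code_bound \<gamma> (k - t) / n) powr \<eta>) * (\<Sum>s. ennreal (cell_weight p \<gamma> M (k - t) s * a s)))
    = (\<Sum>j\<le>k. ennreal (4 * (code_bound \<gamma> j / n) powr \<eta>) * (\<Sum>s. ennreal (cell_weight p \<gamma> M j s * a s)))"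
    by (rule sum.reindex_bij_witness[of _ "\<lambda>j. k - j" "\<lambda>j. k - j"]) auto
  finally show "(\<integral>\<^sup>+x. transport_cost \<mu> p \<gamma> M k n x \<partial>(\<Pi>\<^sub>M i\<in>{..<n}. \<mu>))
    \<le> (\<Sum>s. ennreal (cell_weight p \<gamma> M (Suc k) s * a s)) +
       (\<Sum>j\<le>k. ennreal (4 * (code_bound \<gamma> j / n) powr \<eta>) * (\<Sum>s. ennreal (cell_weight p \<gamma> M j s * a s)))"
    by (simp only: P_def)
qed


text \<open>With this exponent the masses decay like \<open>2 powr (- s * (p + q) / 2)\<close>,
  halfway between \<open>p\<close> and \<open>q\<close>, while the weights grow like
  \<open>2 powr (s * p)\<close>. The product is geometric with ratio \<open>\<rho>\<close>, below 1
  because \<open>p < q\<close>.\<close>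

lemma sum_cell_weight_le:
  fixes p q \<gamma> M :: real
  assumes "1 \<le> p" "p < q" "1 < \<gamma>" "0 < M"
    and m: "\<And>s. 0 \<le> m s" "\<And>s. m s \<le> 2 powr (q - q * real s)"
  defines "\<rho> \<equiv> 2 powr (- ((q - p) / 2))"
  shows "(\<Sum>s. ennreal (cell_weight p \<gamma> M j s * m s powr (1 - (q - p) / (2 * q))))
    \<le> ennreal ((4 * \<gamma> * \<gamma> / (\<gamma> - 1)) powr p * 2 powr ((p + q) / 2) / (1 - \<rho>) * M powr p * (1 / \<gamma> ^ j) powr p)"
proof -
  let ?B = "4 * \<gamma> * \<gamma> / (\<gamma> - 1)" and ?\<eta> = "(q - p) / (2 * q)"
  define K where "K = ?B powr p * 2 powr ((p + q) / 2) * M powr p * (1 / \<gamma> ^ j) powr p"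
  have K: "0 \<le> K" by (simp add: K_def)
  have \<eta>: "0 \<le> 1 - ?\<eta>" "q * (1 - ?\<eta>) = (p + q) / 2" using assms by (simp_all add: field_simps)
  have \<rho>: "0 < \<rho>" "\<rho> < 1"
    unfolding \<rho>_def using assms by (auto intro!: powr_less_one)
  have "cell_weight p \<gamma> M j s * m s powr (1 - ?\<eta>) \<le> K * \<rho> ^ s" for s
  proof -
    have "m s powr (1 - ?\<eta>) \<le> (2 powr (q - q * real s)) powr (1 - ?\<eta>)"
      using m \<eta> by (intro powr_mono2) auto
    also have "\<dots> = 2 powr ((q * (1 - ?\<eta>)) * (1 - real s))"
      unfolding powr_powr by (rule arg_cong[where f = "\<lambda>x. 2 powr x"]) (simp add: algebra_simps)
    also have "\<dots> = 2 powr ((p + q) / 2 * (1 - real s))" by (simp only: \<eta>)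
    finally have ms: "m s powr (1 - ?\<eta>) \<le> 2 powr ((p + q) / 2 * (1 - real s))" .
    have "cell_weight p \<gamma> M j s = M powr p * (2 powr real s) powr p * (?B powr p * (1 / \<gamma> ^ j) powr p)"
    proof -
      have "cell_weight p \<gamma> M j s = (M * 2 powr real s * (?B * (1 / \<gamma> ^ j))) powr p"
        unfolding cell_weight_def by (simp add: powr_realpow)
      then show ?thesis using assms by (simp only: powr_mult mult_nonneg_nonneg)
    qed
    then have "cell_weight p \<gamma> M j s * m s powr (1 - ?\<eta>)
        \<le> M powr p * (2 powr real s) powr p * (?B powr p * (1 / \<gamma> ^ j) powr p) * 2 powr ((p + q) / 2 * (1 - real s))"
      using ms by (simp only:) (intro mult_left_mono, auto)
    also have "\<dots> = M powr p * (?B powr p * (1 / \<gamma> ^ j) powr p) * (2 powr (real s * p) * 2 powr ((p + q) / 2 * (1 - real s)))"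
      by (simp add: powr_powr)
    also have "2 powr (real s * p) * 2 powr ((p + q) / 2 * (1 - real s)) = 2 powr ((p + q) / 2) * (2::real) powr (real s * (- ((q - p) / 2)))"
      unfolding powr_add[symmetric] by (rule arg_cong[where f = "\<lambda>x. 2 powr x"]) (simp add: field_simps)
    also have "(2::real) powr (real s * (- ((q - p) / 2))) = \<rho> ^ s"
      unfolding \<rho>_def by (simp add: powr_powr mult.commute flip: powr_realpow)
    finally show ?thesis by (simp add: K_def mult_ac)
  qed
  then have "(\<Sum>s. ennreal (cell_weight p \<gamma> M j s * m s powr (1 - ?\<eta>))) \<le> (\<Sum>s. ennreal (K * \<rho> ^ s))"
    by (intro suminf_le ennreal_leI) auto
  also have "\<dots> = ennreal (K * (1 / (1 - \<rho>)))"
    using K \<rho> by (intro suminf_ennreal_eq sums_mult geometric_sums) auto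
  finally show ?thesis by (simp add: K_def mult_ac)
qed

text \<open>Used in place of Jensen's inequality: a linear majorant of the concave function \<open>a\<^sup>1\<^sup>/\<^sup>p\<close>,
  tight up to a constant factor at \<open>a = \<epsilon>\<^sup>p\<close>.\<close>

lemma ennreal_powr_le_linear:
  assumes "0 < \<epsilon>" "1 \<le> p"
  shows "ennreal_powr a (1 / p) \<le> ennreal \<epsilon> + ennreal (\<epsilon> powr (1 - p)) * a"
proof (cases "a = top")
  case True
  then show ?thesis using assms by (simp add: ennreal_mult_top)
next
  case False
  define t where "t = enn2real a"
  have a: "a = ennreal t" "0 \<le> t" using False by (simp_all add: t_def less_top)
  have "t powr (1 / p) \<le> \<epsilon> + \<epsilon> powr (1 - p) * t"
  proof (cases "t \<le> \<epsilon> powr p")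
    case True
    then have "t powr (1 / p) \<le> (\<epsilon> powr p) powr (1 / p)"
      using a assms by (intro powr_mono2) auto
    also have "\<dots> = \<epsilon>" using assms by (simp add: powr_powr)
    finally show ?thesis using a by (simp add: add_increasing2)
  next
    case False
    have "0 < \<epsilon> powr p" using assms by simp
    then have t: "0 < t" using False by linarith
    have "t powr (1 / p) = t * t powr (1 / p - 1)" using t by (simp add: powr_diff)
    also have "\<dots> \<le> t * (\<epsilon> powr p) powr (1 / p - 1)"
      using False assms t by (intro mult_left_mono powr_mono2') auto
    also have "(\<epsilon> powr p) powr (1 / p - 1) = \<epsilon> powr (1 - p)"
      using assms by (simp add: powr_powr right_diff_distrib)
    finally show ?thesis using assms by (simp add: mult.commute)
  qed
  then have "ennreal (t powr (1 / p)) \<le> ennreal (\<epsilon> + \<epsilon> powr (1 - p) * t)" by (rule ennreal_leI)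
  then show ?thesis using a assms by (simp add: ennreal_powr_def ennreal_mult)
qed

text \<open>Being linear in the cost, the majorant can be integrated termwise. Only this majorant
  has to be measurable in the sample.\<close>

lemma expected_wasserstein_le_cost:
  assumes "1 < \<gamma>" "0 < M" "1 \<le> p" "1 \<le> n" "0 < \<epsilon>" and \<mu>: "\<mu> \<in> P_exp q \<gamma> M"
    and meas: "transport_cost \<mu> p \<gamma> M k n \<in> borel_measurable (\<Pi>\<^sub>M i\<in>{..<n}. \<mu>)"
  shows "expected_wasserstein p n \<mu> \<le> ennreal \<epsilon> +
    ennreal (\<epsilon> powr (1 - p)) * (\<integral>\<^sup>+x. transport_cost \<mu> p \<gamma> M k n x \<partial>(\<Pi>\<^sub>M i\<in>{..<n}. \<mu>))"
proof -
  define P where "P = (\<Pi>\<^sub>M i\<in>{..<n}. \<mu>)"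
  interpret prob_space \<mu> by (rule P_expD[OF \<mu>])
  interpret P: prob_space P
    unfolding P_def by (intro prob_space_PiM prob_space_axioms)
  have [measurable]: "transport_cost \<mu> p \<gamma> M k n \<in> borel_measurable P"
    using meas by (simp add: P_def)
  have "AE x in P. \<forall>i\<in>{..<n}. wnorm2 \<gamma> (x i) < top"
  proof (intro AE_finite_allI)
    fix i assume "i \<in> {..<n}"
    then show "AE x in P. wnorm2 \<gamma> (x i) < top"
      unfolding P_def by (intro AE_PiM_component[where P = "\<lambda>y. wnorm2 \<gamma> y < top"] P_exp_finite[OF \<mu>]) (auto intro: prob_space_axioms)
  qed simp
  then have "AE x in P. wasserstein p (empirical_measure n x) \<mu>
      \<le> ennreal \<epsilon> + ennreal (\<epsilon> powr (1 - p)) * transport_cost \<mu> p \<gamma> M k n x"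
  proof (rule eventually_mono)
    fix x assume "\<forall>i\<in>{..<n}. wnorm2 \<gamma> (x i) < top"
    then have "wasserstein p (empirical_measure n x) \<mu> \<le> ennreal_powr (transport_cost \<mu> p \<gamma> M k n x) (1 / p)"
      by (intro wasserstein_empirical_le assms P_expD[OF \<mu>] P_exp_finite[OF \<mu>]) auto
    also have "\<dots> \<le> ennreal \<epsilon> + ennreal (\<epsilon> powr (1 - p)) * transport_cost \<mu> p \<gamma> M k n x"
      by (rule ennreal_powr_le_linear[OF assms(5,3)])
    finally show "wasserstein p (empirical_measure n x) \<mu>
      \<le> ennreal \<epsilon> + ennreal (\<epsilon> powr (1 - p)) * transport_cost \<mu> p \<gamma> M k n x" .
  qed
  then have "(\<integral>\<^sup>+x. wasserstein p (empirical_measure n x) \<mu> \<partial>P)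
    \<le> (\<integral>\<^sup>+x. ennreal \<epsilon> + ennreal (\<epsilon> powr (1 - p)) * transport_cost \<mu> p \<gamma> M k n x \<partial>P)"
    by (rule nn_integral_mono_AE)
  also have "\<dots> = ennreal \<epsilon> + ennreal (\<epsilon> powr (1 - p)) * (\<integral>\<^sup>+x. transport_cost \<mu> p \<gamma> M k n x \<partial>P)"
    by (subst nn_integral_add, measurable, subst nn_integral_cmult) (auto simp: P.emeasure_space_1)
  finally show ?thesis by (simp add: expected_wasserstein_def P_def)
qed

lemma upper_bound:
  fixes p q \<gamma> :: real
  assumes "1 \<le> p" "p < q" "1 < \<gamma>"
  shows "\<exists>C>0. \<forall>M n \<mu>. 0 < M \<longrightarrow> 1 \<le> n \<longrightarrow> \<mu> \<in> P_exp q \<gamma> M \<longrightarrow>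
    expected_wasserstein p n \<mu> \<le> ennreal (C * M * decay_rate \<gamma> n)"
proof -
  define \<eta> where "\<eta> = (q - p) / (2 * q)"
  have \<eta>: "0 < \<eta>" "\<eta> \<le> 1/2" using assms by (auto simp: \<eta>_def field_simps)
  define a where "a = 2 * (ln 72 / ln \<gamma>) + 1 + (p + 1) / \<eta>"
  define \<rho> where "\<rho> = (2::real) powr (- ((q - p) / 2))"
  have \<rho>: "\<rho> < 1" unfolding \<rho>_def using assms by (auto intro!: powr_less_one)
  define K where "K = (4 * \<gamma> * \<gamma> / (\<gamma> - 1)) powr p * 2 powr ((p + q) / 2) / (1 - \<rho>)"
  have K: "0 \<le> K" using \<rho> by (simp add: K_def)
  define D where "D = 1 + 4 * (\<gamma> / (\<gamma> - 1))"
  have D: "0 \<le> D" using assms by (simp add: D_def)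
  define C where "C = (1 + K * D) * \<gamma> powr (a + 1)"
  have KD: "0 \<le> K * D" using K D by simp
  have C: "0 < C" unfolding C_def using KD assms by (intro mult_pos_pos) auto
  have "expected_wasserstein p n \<mu> \<le> ennreal (C * M * decay_rate \<gamma> n)"
    if M: "0 < M" and n: "1 \<le> n" and \<mu>: "\<mu> \<in> P_exp q \<gamma> M" for M n \<mu>
  proof -
    obtain k where k: "(1 / \<gamma> ^ Suc k) powr p + 4 * (\<Sum>j\<le>k. (1 / \<gamma> ^ j) powr p * (code_bound \<gamma> j / n) powr \<eta>)
        \<le> D * (1 / \<gamma> ^ k) powr p" "1 / \<gamma> ^ k \<le> \<gamma> powr (a + 1) * decay_rate \<gamma> n"
      using level_choice[OF assms(3,1) \<eta>(1) n] unfolding a_def D_def by blast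
    \<comment> \<open>The expected cost will be at most a constant times
      \<open>\<epsilon> powr p\<close>, so at this point the linear majorant loses only a
      constant.\<close>
    define \<epsilon> where "\<epsilon> = M * (1 / \<gamma> ^ k)"
    have \<epsilon>: "0 < \<epsilon>" using M assms by (simp add: \<epsilon>_def)
    note \<mu>' = P_expD[OF \<mu>]
    let ?a = "\<lambda>s. measure \<mu> {y. shell \<gamma> M y = s} powr (1 - \<eta>)"
    have sh: "(\<Sum>s. ennreal (cell_weight p \<gamma> M j s * ?a s)) \<le> ennreal (K * M powr p * (1 / \<gamma> ^ j) powr p)" for j
      unfolding \<eta>_def K_def \<rho>_def
      by (intro sum_cell_weight_le assms M P_exp_shell_le[OF \<mu> M]) (use assms in auto)
    have "(\<integral>\<^sup>+x. transport_cost \<mu> p \<gamma> M k n x \<partial>(\<Pi>\<^sub>M i\<in>{..<n}. \<mu>))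
      \<le> (\<Sum>s. ennreal (cell_weight p \<gamma> M (Suc k) s * ?a s)) +
         (\<Sum>j\<le>k. ennreal (4 * (code_bound \<gamma> j / n) powr \<eta>) * (\<Sum>s. ennreal (cell_weight p \<gamma> M j s * ?a s)))"
      by (rule expected_transport_cost_le(1)[OF assms(3) M assms(1) n \<eta> \<mu>'(1,2)])
    also have "\<dots> \<le> ennreal (K * M powr p * (1 / \<gamma> ^ Suc k) powr p) +
         (\<Sum>j\<le>k. ennreal (4 * (code_bound \<gamma> j / n) powr \<eta>) * ennreal (K * M powr p * (1 / \<gamma> ^ j) powr p))"
      by (intro add_mono sum_mono mult_left_mono sh) auto
    also have "\<dots> = ennreal (K * M powr p * (1 / \<gamma> ^ Suc k) powr p) +
         (\<Sum>j\<le>k. ennreal (4 * (code_bound \<gamma> j / n) powr \<eta> * (K * M powr p * (1 / \<gamma> ^ j) powr p)))"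
      using K by (simp add: ennreal_mult)
    also have "\<dots> = ennreal (K * M powr p * (1 / \<gamma> ^ Suc k) powr p +
         (\<Sum>j\<le>k. 4 * (code_bound \<gamma> j / n) powr \<eta> * (K * M powr p * (1 / \<gamma> ^ j) powr p)))"
      using K by (subst sum_ennreal) (auto intro!: ennreal_plus[symmetric] sum_nonneg mult_nonneg_nonneg)
    also have "K * M powr p * (1 / \<gamma> ^ Suc k) powr p +
         (\<Sum>j\<le>k. 4 * (code_bound \<gamma> j / n) powr \<eta> * (K * M powr p * (1 / \<gamma> ^ j) powr p))
       = K * M powr p * ((1 / \<gamma> ^ Suc k) powr p + 4 * (\<Sum>j\<le>k. (1 / \<gamma> ^ j) powr p * (code_bound \<gamma> j / n) powr \<eta>))"
      by (simp add: distrib_left sum_distrib_left mult_ac)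
    also have "ennreal \<dots> \<le> ennreal (K * M powr p * (D * (1 / \<gamma> ^ k) powr p))"
      using K by (intro ennreal_leI mult_left_mono k) auto
    also have "K * M powr p * (D * (1 / \<gamma> ^ k) powr p) = K * D * \<epsilon> powr p"
      unfolding \<epsilon>_def using M assms by (subst powr_mult) auto
    finally have cost: "(\<integral>\<^sup>+x. transport_cost \<mu> p \<gamma> M k n x \<partial>(\<Pi>\<^sub>M i\<in>{..<n}. \<mu>)) \<le> ennreal (K * D * \<epsilon> powr p)" .
    have "expected_wasserstein p n \<mu> \<le> ennreal \<epsilon> +
      ennreal (\<epsilon> powr (1 - p)) * (\<integral>\<^sup>+x. transport_cost \<mu> p \<gamma> M k n x \<partial>(\<Pi>\<^sub>M i\<in>{..<n}. \<mu>))"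
      by (rule expected_wasserstein_le_cost[OF assms(3) M assms(1) n \<epsilon> \<mu>])
         (rule expected_transport_cost_le(2)[OF assms(3) M assms(1) n \<eta> \<mu>'(1,2)])
    also have "\<dots> \<le> ennreal \<epsilon> + ennreal (\<epsilon> powr (1 - p)) * ennreal (K * D * \<epsilon> powr p)"
      by (intro add_left_mono mult_left_mono cost) auto
    also have "\<dots> = ennreal (\<epsilon> + \<epsilon> powr (1 - p) * (K * D * \<epsilon> powr p))"
      using \<epsilon> KD by (simp add: ennreal_mult)
    also have "\<epsilon> powr (1 - p) * (K * D * \<epsilon> powr p) = K * D * \<epsilon>"
      using \<epsilon> by (simp add: powr_diff)
    also have "\<epsilon> + K * D * \<epsilon> = (1 + K * D) * M * (1 / \<gamma> ^ k)" by (simp add: \<epsilon>_def algebra_simps)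
    also have "ennreal \<dots> \<le> ennreal ((1 + K * D) * M * (\<gamma> powr (a + 1) * decay_rate \<gamma> n))"
      using KD M by (intro ennreal_leI mult_left_mono k) auto
    finally show ?thesis by (simp add: C_def mult_ac)
  qed
  with C show ?thesis by blast
qed


section \<open>The lower bound\<close>

text \<open>In every coupling the first point is a sample, so whenever the second lies outside the
  balls, an event of probability at least 1/2, the distance exceeds \<open>\<delta>\<close>. Since
  \<open>1 \<le> p\<close>, the root of the factor 1/2 is still at least 1/2.\<close>

lemma wasserstein_empirical_ge:
  fixes \<mu> :: "'a::{real_normed_vector, second_countable_topology} measure"
  assumes "1 \<le> p" "0 < \<delta>" "1 \<le> n" and \<mu>: "prob_space \<mu>" "sets \<mu> = sets borel"
    and small: "measure \<mu> (\<Union>i<n. cball (x i) \<delta>) \<le> 1 / 2"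
  shows "ennreal (\<delta> / 2) \<le> wasserstein p (empirical_measure n x) \<mu>"
  unfolding wasserstein_def
proof (rule INF_greatest)
  fix \<xi> assume "\<xi> \<in> couplings (empirical_measure n x) \<mu>"
  then have \<xi>: "prob_space \<xi>" "sets \<xi> = sets (borel \<Otimes>\<^sub>M borel)"
    "distr \<xi> borel fst = empirical_measure n x" "distr \<xi> borel snd = \<mu>"
    by (auto simp: couplings_def)
  interpret \<mu>: prob_space \<mu> by fact
  define U where "U = (\<Union>i<n. cball (x i) \<delta>)"
  have U: "U \<in> sets borel" unfolding U_def by (intro borel_closed closed_UN) auto
  have "AE y in empirical_measure n x. y \<in> x ` {..<n}"
    by (rule AE_empirical[OF assms(3)]) (auto intro!: borel_closed finite_imp_closed)
  then have "AE w in \<xi>. fst w \<in> x ` {..<n}"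
    unfolding \<xi>(3)[symmetric]
    by (rule AE_distrD[rotated]) (simp add: measurable_cong_sets[OF \<xi>(2) refl])
  then have le: "AE w :: 'a \<times> 'a in \<xi>. ennreal (\<delta> powr p) * indicator (- U) (snd w) \<le> ennreal (norm (fst w - snd w) powr p)"
  proof (rule eventually_mono)
    fix w :: "'a \<times> 'a" assume "fst w \<in> x ` {..<n}"
    then obtain i where i: "i < n" "fst w = x i" by auto
    show "ennreal (\<delta> powr p) * indicator (- U) (snd w) \<le> ennreal (norm (fst w - snd w) powr p)"
    proof (cases "snd w \<in> U")
      case False
      then have "\<not> dist (x i) (snd w) \<le> \<delta>" using i by (auto simp: U_def)
      then have "\<delta> \<le> norm (fst w - snd w)" using i by (simp add: dist_norm)
      then have "\<delta> powr p \<le> norm (fst w - snd w) powr p" using assms by (intro powr_mono2) auto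
      then show ?thesis by (simp add: indicator_def ennreal_leI)
    qed simp
  qed
  have "1 / 2 \<le> measure \<mu> (- U)"
    using \<mu>.prob_compl[of U] small U sets_eq_imp_space_eq[OF \<mu>(2)] \<mu>(2)
    by (simp add: U_def[symmetric] Compl_eq_Diff_UNIV)
  then have "ennreal (\<delta> powr p / 2) \<le> ennreal (\<delta> powr p * measure \<mu> (- U))"
    using assms by (intro ennreal_leI) (simp add: field_simps)
  also have "\<dots> = ennreal (\<delta> powr p) * emeasure \<mu> (- U)"
    by (simp add: \<mu>.emeasure_eq_measure ennreal_mult)
  also have "\<dots> = (\<integral>\<^sup>+z. ennreal (\<delta> powr p) * indicator (- U) z \<partial>\<mu>)"
    using U \<mu>(2) by (intro nn_integral_cmult_indicator[symmetric]) auto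
  also have "\<dots> = (\<integral>\<^sup>+w. ennreal (\<delta> powr p) * indicator (- U) (snd w) \<partial>\<xi>)"
    unfolding \<xi>(4)[symmetric] using U
    by (subst nn_integral_distr) (auto simp: measurable_cong_sets[OF \<xi>(2) refl])
  also have "\<dots> \<le> (\<integral>\<^sup>+w. ennreal (norm (fst w - snd w) powr p) \<partial>\<xi>)"
    by (rule nn_integral_mono_AE[OF le])
  finally have "ennreal (\<delta> powr p / 2) \<le> (\<integral>\<^sup>+(y, z). ennreal (norm (y - z) powr p) \<partial>\<xi>)"
    by (simp add: case_prod_unfold)
  then have "ennreal_powr (ennreal (\<delta> powr p / 2)) (1 / p)
      \<le> ennreal_powr (\<integral>\<^sup>+(y, z). ennreal (norm (y - z) powr p) \<partial>\<xi>) (1 / p)"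
    using assms by (intro ennreal_powr_mono) auto
  moreover have "\<delta> / 2 \<le> (\<delta> powr p / 2) powr (1 / p)"
  proof -
    have "(1 / 2 :: real) powr 1 \<le> (1 / 2) powr (1 / p)"
      using assms by (intro powr_mono') auto
    then have "\<delta> * (1 / 2) \<le> \<delta> * (1 / 2) powr (1 / p)" using assms by (intro mult_left_mono) auto
    also have "\<dots> = (\<delta> powr p * (1 / 2)) powr (1 / p)"
      using assms by (subst powr_mult) (auto simp: powr_powr)
    finally show ?thesis by simp
  qed
  ultimately show "ennreal (\<delta> / 2) \<le> ennreal_powr (\<integral>\<^sup>+(y, z). ennreal (norm (y - z) powr p) \<partial>\<xi>) (1 / p)"
    by (elim order_trans[rotated]) (simp add: ennreal_powr_def ennreal_leI)
qed

section \<open>Uniform measures on lattice grids in the ellipsoid\<close>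

definition grid :: "real \<Rightarrow> nat \<Rightarrow> (nat \<Rightarrow> int) set" where
  "grid \<gamma> k = PiE {..<k} (\<lambda>m. {0..\<lfloor>\<gamma> ^ (k - m)\<rfloor>})"

text \<open>In units of the spacing \<open>M * mesh \<gamma> k\<close>, a ball of radius
  \<open>M / \<gamma> ^ k\<close> has radius \<open>sqrt k\<close>, as the Chernoff count
  asks.\<close>

lift_definition grid_point :: "real \<Rightarrow> real \<Rightarrow> nat \<Rightarrow> (nat \<Rightarrow> int) \<Rightarrow> ell2" is
  "\<lambda>\<gamma> M k z m. if m < k then M * mesh \<gamma> k * real_of_int (z m) else 0"
  subgoal for \<gamma> M k z
    by (rule summable_finite[of "{..<k}"]) auto
  done

definition grid_measure :: "real \<Rightarrow> real \<Rightarrow> nat \<Rightarrow> ell2 measure" where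
  "grid_measure \<gamma> M k = distr (uniform_count_measure (grid \<gamma> k)) borel (grid_point \<gamma> M k)"

lemma coord_grid_point:
  "coord (grid_point \<gamma> M k z) m = (if m < k then M * mesh \<gamma> k * real_of_int (z m) else 0)"
  by transfer simp

lemma finite_grid [simp]: "finite (grid \<gamma> k)"
  by (auto simp: grid_def intro!: finite_PiE)

lemma card_grid_ge:
  assumes "1 < \<gamma>"
  shows "\<gamma> powr (real k * (real k + 1) / 2) \<le> real (card (grid \<gamma> k))"
proof -
  have "\<gamma> powr (real k * (real k + 1) / 2) = (\<Prod>m<k. \<gamma> ^ (k - m))"
    using assms by (simp add: prod_powr_triangle)
  also have "\<dots> \<le> (\<Prod>m<k. real (card {0..\<lfloor>\<gamma> ^ (k - m)\<rfloor>}))"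
  proof (intro prod_mono conjI)
    fix m
    have "0 \<le> \<gamma> ^ (k - m)" using assms by simp
    then show "\<gamma> ^ (k - m) \<le> real (card {0..\<lfloor>\<gamma> ^ (k - m)\<rfloor>})" by simp
  qed (use assms in auto)
  also have "\<dots> = real (card (grid \<gamma> k))" by (simp add: grid_def card_PiE)
  finally show ?thesis .
qed

lemma grid_nonempty:
  assumes "1 < \<gamma>"
  shows "grid \<gamma> k \<noteq> {}"
  using card_grid_ge[OF assms, of k] assms by (auto simp: not_le)

lemma
  assumes "1 < \<gamma>"
  shows prob_space_grid_measure: "prob_space (grid_measure \<gamma> M k)"
    and sets_grid_measure: "sets (grid_measure \<gamma> M k) = sets borel"
    and measure_grid_measure: "A \<in> sets borel \<Longrightarrow>
      measure (grid_measure \<gamma> M k) A = real (card {z \<in> grid \<gamma> k. grid_point \<gamma> M k z \<in> A}) / real (card (grid \<gamma> k))"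
    and AE_grid_measure: "{x. P x} \<in> sets borel \<Longrightarrow> (\<And>z. z \<in> grid \<gamma> k \<Longrightarrow> P (grid_point \<gamma> M k z)) \<Longrightarrow>
      AE x in grid_measure \<gamma> M k. P x"
proof -
  have meas: "grid_point \<gamma> M k \<in> measurable (uniform_count_measure (grid \<gamma> k)) borel"
    by (simp add: measurable_def sets_uniform_count_measure space_uniform_count_measure)
  have "prob_space (uniform_count_measure (grid \<gamma> k))"
    using grid_nonempty[OF assms] by (intro prob_space_uniform_count_measure) auto
  then show "prob_space (grid_measure \<gamma> M k)"
    unfolding grid_measure_def by (rule prob_space.prob_space_distr) (rule meas)
  show "sets (grid_measure \<gamma> M k) = sets borel" by (simp add: grid_measure_def)
  show "measure (grid_measure \<gamma> M k) A = real (card {z \<in> grid \<gamma> k. grid_point \<gamma> M k z \<in> A}) / real (card (grid \<gamma> k))"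
    if "A \<in> sets borel"
  proof -
    have "measure (grid_measure \<gamma> M k) A = measure (uniform_count_measure (grid \<gamma> k)) (grid_point \<gamma> M k -` A \<inter> grid \<gamma> k)"
      using that unfolding grid_measure_def by (simp add: measure_distr[OF meas] space_uniform_count_measure)
    also have "grid_point \<gamma> M k -` A \<inter> grid \<gamma> k = {z \<in> grid \<gamma> k. grid_point \<gamma> M k z \<in> A}" by auto
    finally show ?thesis by (simp add: measure_uniform_count_measure)
  qed
  show "AE x in grid_measure \<gamma> M k. P x"
    if "{x. P x} \<in> sets borel" "\<And>z. z \<in> grid \<gamma> k \<Longrightarrow> P (grid_point \<gamma> M k z)"
    unfolding grid_measure_def using that
    by (subst AE_distr_iff[OF meas]) (auto simp: space_uniform_count_measure intro!: AE_I2)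
qed

lemma wnorm2_grid_point_le:
  assumes "1 < \<gamma>" "0 < M" "z \<in> grid \<gamma> k"
  shows "wnorm2 \<gamma> (grid_point \<gamma> M k z) \<le> ennreal (M\<^sup>2)"
proof -
  \<comment> \<open>The ranges in \<open>grid\<close> are chosen so that each of the
    \<open>k\<close> coordinates uses at most an equal share of the squared weighted norm.\<close>
  have "(\<gamma> ^ m * coord (grid_point \<gamma> M k z) m)\<^sup>2 \<le> M\<^sup>2 / real k" if "m < k" for m
  proof -
    have "z m \<in> {0..\<lfloor>\<gamma> ^ (k - m)\<rfloor>}" using assms(3) that by (auto simp: grid_def PiE_def)
    then have z: "0 \<le> real_of_int (z m)" "real_of_int (z m) \<le> \<gamma> ^ (k - m)" by (auto simp: le_floor_iff)
    have "\<gamma> ^ m * coord (grid_point \<gamma> M k z) m \<le> \<gamma> ^ m * (M * mesh \<gamma> k * \<gamma> ^ (k - m))"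
      using that z assms by (auto simp: coord_grid_point mesh_def intro!: mult_left_mono divide_right_mono)
    also have "\<dots> = M * mesh \<gamma> k * (\<gamma> ^ m * \<gamma> ^ (k - m))" by simp
    also have "\<gamma> ^ m * \<gamma> ^ (k - m) = \<gamma> ^ k" using that by (simp flip: power_add)
    also have "M * mesh \<gamma> k * \<gamma> ^ k = M / sqrt k" using assms that by (simp add: mesh_def)
    finally have "\<gamma> ^ m * coord (grid_point \<gamma> M k z) m \<le> M / sqrt k" .
    moreover have "0 \<le> \<gamma> ^ m * coord (grid_point \<gamma> M k z) m"
      using that z assms by (simp add: coord_grid_point mesh_def)
    ultimately have "(\<gamma> ^ m * coord (grid_point \<gamma> M k z) m)\<^sup>2 \<le> (M / sqrt k)\<^sup>2" by (intro power_mono)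
    then show ?thesis by (simp add: power_divide)
  qed
  then have "(\<Sum>m<k. (\<gamma> ^ m * coord (grid_point \<gamma> M k z) m)\<^sup>2) \<le> (\<Sum>m<k. M\<^sup>2 / real k)"
    by (intro sum_mono) auto
  also have "\<dots> \<le> M\<^sup>2" by simp
  finally have "ennreal (\<Sum>m<k. (\<gamma> ^ m * coord (grid_point \<gamma> M k z) m)\<^sup>2) \<le> ennreal (M\<^sup>2)" by (rule ennreal_leI)
  moreover have "wnorm2 \<gamma> (grid_point \<gamma> M k z) = (\<Sum>m<k. ennreal ((\<gamma> ^ m * coord (grid_point \<gamma> M k z) m)\<^sup>2))"
    unfolding wnorm2_def by (rule suminf_finite) (auto simp: coord_grid_point)
  ultimately show ?thesis by simp
qed

lemma grid_measure_in_P_exp: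
  assumes "1 < \<gamma>" "0 < M" "0 < q"
  shows "grid_measure \<gamma> M k \<in> P_exp q \<gamma> M"
proof -
  interpret prob_space "grid_measure \<gamma> M k" by (rule prob_space_grid_measure[OF assms(1)])
  have "{x. wnorm2 \<gamma> x \<le> ennreal (M\<^sup>2)} \<in> sets borel" by measurable
  then have "AE x in grid_measure \<gamma> M k. wnorm2 \<gamma> x \<le> ennreal (M\<^sup>2)"
    by (rule AE_grid_measure[OF assms(1)]) (rule wnorm2_grid_point_le[OF assms(1,2)])
  then have "AE x in grid_measure \<gamma> M k. ennreal_powr (wnorm2 \<gamma> x) (q / 2) \<le> ennreal (M powr q)"
  proof (rule eventually_mono)
    fix x assume "wnorm2 \<gamma> x \<le> ennreal (M\<^sup>2)"
    then have "ennreal_powr (wnorm2 \<gamma> x) (q / 2) \<le> ennreal_powr (ennreal (M\<^sup>2)) (q / 2)"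
      using assms by (intro ennreal_powr_mono) auto
    also have "\<dots> = ennreal (M powr q)"
    proof -
      have "M\<^sup>2 powr (q / 2) = (M powr 2) powr (q / 2)" using assms by simp
      also have "\<dots> = M powr q" by (simp add: powr_powr del: powr_numeral)
      finally show ?thesis by (simp add: ennreal_powr_def)
    qed
    finally show "ennreal_powr (wnorm2 \<gamma> x) (q / 2) \<le> ennreal (M powr q)" .
  qed
  then have "(\<integral>\<^sup>+x. ennreal_powr (wnorm2 \<gamma> x) (q / 2) \<partial>grid_measure \<gamma> M k) \<le> (\<integral>\<^sup>+x. ennreal (M powr q) \<partial>grid_measure \<gamma> M k)"
    by (rule nn_integral_mono_AE)
  then show ?thesis
    using prob_space_grid_measure[OF assms(1)] sets_grid_measure[OF assms(1)]
    by (simp add: P_exp_def prob_measures_def wnorm2_def emeasure_space_1)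
qed

text \<open>In lattice units all steps are 1, so the Chernoff count has no product factor left. Its
  centre is arbitrary, hence so is \<open>c\<close>.\<close>

lemma card_grid_ball_le:
  assumes "1 < \<gamma>" "0 < M" "0 < k"
  shows "real (card {z \<in> grid \<gamma> k. grid_point \<gamma> M k z \<in> cball c (M / \<gamma> ^ k)}) \<le> 72 ^ k"
proof -
  define h where "h = M * mesh \<gamma> k"
  have h: "0 < h" using assms by (simp add: h_def mesh_pos)
  let ?P = "{z \<in> grid \<gamma> k. grid_point \<gamma> M k z \<in> cball c (M / \<gamma> ^ k)}"
  have "real (card ?P) \<le> 72 ^ k * (\<Prod>m<k. 1 / 1)"
  proof (rule card_gauss_le[where c = "\<lambda>m. coord c m / h"])
    show "?P \<subseteq> extensional {..<k}" by (auto simp: grid_def PiE_def)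
    fix z assume "z \<in> ?P"
    then have d: "norm (grid_point \<gamma> M k z - c) \<le> M / \<gamma> ^ k" by (simp add: dist_norm norm_minus_commute)
    have "(1 * real_of_int (z m) - coord c m / h)\<^sup>2 = (coord (grid_point \<gamma> M k z - c) m)\<^sup>2 / h\<^sup>2" if "m < k" for m
    proof -
      have "1 * real_of_int (z m) - coord c m / h = coord (grid_point \<gamma> M k z - c) m / h"
        using that h by (simp add: coord_grid_point h_def[symmetric] diff_divide_distrib)
      then show ?thesis by (simp only: power_divide)
    qed
    then have "(\<Sum>m<k. (1 * real_of_int (z m) - coord c m / h)\<^sup>2) = (\<Sum>m<k. (coord (grid_point \<gamma> M k z - c) m)\<^sup>2) / h\<^sup>2"
      by (simp add: sum_divide_distrib)
    also have "\<dots> \<le> (norm (grid_point \<gamma> M k z - c))\<^sup>2 / h\<^sup>2"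
      by (intro divide_right_mono sum_coord_square_le_norm) auto
    also have "\<dots> \<le> (M / \<gamma> ^ k)\<^sup>2 / h\<^sup>2"
      using d by (intro divide_right_mono power_mono) auto
    also have "\<dots> = real k"
      using assms by (simp add: h_def mesh_def power_mult_distrib power_divide)
    finally show "(\<Sum>m<k. (1 * real_of_int (z m) - coord c m / h)\<^sup>2) \<le> real k" .
  qed auto
  then show ?thesis by simp
qed

text \<open>A union bound over the \<open>n\<close> balls works for every sample, so the lower
  estimate holds pointwise before integration.\<close>

lemma expected_wasserstein_grid_ge:
  assumes "1 < \<gamma>" "0 < M" "1 \<le> p" "0 < k" "1 \<le> n"
    and large: "2 * real n * 72 ^ k \<le> \<gamma> powr (real k * (real k + 1) / 2)"
  shows "ennreal (M / \<gamma> ^ k / 2) \<le> expected_wasserstein p n (grid_measure \<gamma> M k)"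
proof -
  let ?\<mu> = "grid_measure \<gamma> M k" and ?\<delta> = "M / \<gamma> ^ k"
  interpret prob_space ?\<mu> by (rule prob_space_grid_measure[OF assms(1)])
  interpret P: prob_space "\<Pi>\<^sub>M i\<in>{..<n}. ?\<mu>"
    by (intro prob_space_PiM prob_space_axioms)
  have cG: "0 < real (card (grid \<gamma> k))"
    using grid_nonempty[OF assms(1), of k] by (simp add: card_gt_0_iff)
  have "ennreal (?\<delta> / 2) \<le> wasserstein p (empirical_measure n x) ?\<mu>" for x
  proof (rule wasserstein_empirical_ge)
    have ball: "measure ?\<mu> (cball (x i) ?\<delta>) \<le> 72 ^ k / real (card (grid \<gamma> k))" for i
      using card_grid_ball_le[OF assms(1,2,4)] cG
      by (subst measure_grid_measure[OF assms(1)]) (auto intro!: divide_right_mono)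
    have "measure ?\<mu> (\<Union>i<n. cball (x i) ?\<delta>) \<le> (\<Sum>i<n. measure ?\<mu> (cball (x i) ?\<delta>))"
      using sets_grid_measure[OF assms(1)] by (intro finite_measure_subadditive_finite) auto
    also have "\<dots> \<le> (\<Sum>i<n. 72 ^ k / real (card (grid \<gamma> k)))" by (intro sum_mono ball)
    also have "\<dots> = real n * 72 ^ k / real (card (grid \<gamma> k))" by simp
    also have "\<dots> \<le> 1 / 2"
      using large card_grid_ge[OF assms(1), of k] cG by (simp add: field_simps)
    finally show "measure ?\<mu> (\<Union>i<n. cball (x i) ?\<delta>) \<le> 1 / 2" .
  qed (use assms prob_space_axioms sets_grid_measure[OF assms(1)] in auto)
  then have "(\<integral>\<^sup>+x. ennreal (?\<delta> / 2) \<partial>(\<Pi>\<^sub>M i\<in>{..<n}. ?\<mu>)) \<le> expected_wasserstein p n ?\<mu>"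
    unfolding expected_wasserstein_def by (intro nn_integral_mono) auto
  then show ?thesis by (simp add: P.emeasure_space_1)
qed

lemma lower_bound:
  fixes p q \<gamma> :: real
  assumes "1 \<le> p" "p < q" "1 < \<gamma>"
  shows "\<exists>c>0. \<forall>M n. 0 < M \<longrightarrow> 1 \<le> n \<longrightarrow>
    (\<exists>\<mu>\<in>P_exp q \<gamma> M. ennreal (c * M * decay_rate \<gamma> n) \<le> expected_wasserstein p n \<mu>)"
proof -
  \<comment> \<open>Here 144 is 2 * 72: \<open>\<gamma> ^ (b * k)\<close> then dominates the factor
    \<open>2 * 72 ^ k\<close>.\<close>
  obtain b :: nat where "144 < \<gamma> ^ b" using real_arch_pow[OF assms(3)] by blast
  then have b: "144 \<le> \<gamma> ^ b" "0 < b" by (auto intro!: gr0I)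
  define c where "c = \<gamma> powr (- (1 + 2 * real b)) / 2"
  have c: "0 < c" using assms by (simp add: c_def)
  have "\<exists>\<mu>\<in>P_exp q \<gamma> M. ennreal (c * M * decay_rate \<gamma> n) \<le> expected_wasserstein p n \<mu>"
    if M: "0 < M" and n: "1 \<le> n" for M n
  proof
    define L where "L = critical_level \<gamma> n"
    define l where "l = nat \<lceil>L\<rceil>"
    \<comment> \<open>The shift by \<open>2 * b\<close> leaves a surplus: \<open>k * (k + 1) / 2 - b
      * k = (l\<^sup>2 + l + 2 * b * l + 2 * b) / 2\<close>, which is at least
      \<open>L\<^sup>2 / 2\<close>. Also \<open>k \<le> L + 1 + 2 * b\<close>, the source of
      \<open>c\<close>.\<close>
    define k where "k = l + 2 * b"
    have L: "0 \<le> L" using critical_level_nonneg assms n by (auto simp: L_def)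
    have l: "L \<le> real l" "real l \<le> L + 1" using L unfolding l_def by linarith+
    have k: "0 < k" using b by (simp add: k_def)
    have "L\<^sup>2 / 2 + real (b * k) \<le> real k * (real k + 1) / 2"
    proof -
      have "L\<^sup>2 \<le> (real l)\<^sup>2" using L l by (intro power_mono) auto
      moreover have "real k * (real k + 1) / 2 - real (b * k) = (real l)\<^sup>2 / 2 + real (2 * b * l + l + 2 * b) / 2"
        by (simp add: k_def power2_eq_square field_simps)
      moreover have "0 \<le> real (2 * b * l + l + 2 * b)" by (rule of_nat_0_le_iff)
      ultimately show ?thesis by linarith
    qed
    then have "\<gamma> powr (L\<^sup>2 / 2 + real (b * k)) \<le> \<gamma> powr (real k * (real k + 1) / 2)"
      using assms by (intro powr_mono) auto
    moreover have "\<gamma> powr (L\<^sup>2 / 2 + real (b * k)) = real n * (\<gamma> ^ b) ^ k"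
      using powr_critical_level[OF assms(3) n] assms(3)
      by (simp only: powr_add L_def[symmetric] powr_realpow power_mult)
    moreover have "2 * real n * 72 ^ k \<le> real n * (\<gamma> ^ b) ^ k"
    proof -
      have "(2::real) ^ 1 \<le> 2 ^ k" using k by (intro power_increasing) auto
      then have "2 * 72 ^ k \<le> 2 ^ k * (72::real) ^ k" by (intro mult_right_mono) auto
      also have "\<dots> = 144 ^ k" by (simp flip: power_mult_distrib)
      also have "\<dots> \<le> (\<gamma> ^ b) ^ k" using b by (intro power_mono) auto
      finally have "real n * (2 * 72 ^ k) \<le> real n * (\<gamma> ^ b) ^ k" by (intro mult_left_mono) auto
      then show ?thesis by (simp only: mult_ac)
    qed
    ultimately have large: "2 * real n * 72 ^ k \<le> \<gamma> powr (real k * (real k + 1) / 2)" by linarith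
    have "\<gamma> powr (- (1 + 2 * real b)) * decay_rate \<gamma> n = \<gamma> powr (- (1 + 2 * real b) - L)"
      using decay_rate_eq[OF assms(3) n] by (simp add: L_def powr_diff powr_minus divide_inverse)
    also have "\<dots> \<le> \<gamma> powr (- real k)"
      using assms l by (intro powr_mono) (auto simp: k_def)
    also have "\<dots> = 1 / \<gamma> ^ k" using assms by (simp add: powr_minus powr_realpow divide_inverse)
    finally have "M * (\<gamma> powr (- (1 + 2 * real b)) * decay_rate \<gamma> n) \<le> M * (1 / \<gamma> ^ k)"
      using M by (intro mult_left_mono) auto
    then have "ennreal (c * M * decay_rate \<gamma> n) \<le> ennreal (M / \<gamma> ^ k / 2)"
      by (intro ennreal_leI) (simp add: c_def mult_ac)
    also have "\<dots> \<le> expected_wasserstein p n (grid_measure \<gamma> M k)"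
      by (rule expected_wasserstein_grid_ge[OF assms(3) M assms(1) k n large])
    finally show "ennreal (c * M * decay_rate \<gamma> n) \<le> expected_wasserstein p n (grid_measure \<gamma> M k)" .
    show "grid_measure \<gamma> M k \<in> P_exp q \<gamma> M"
      using assms M by (intro grid_measure_in_P_exp) auto
  qed
  with c show ?thesis by blast
qed

theorem theorem4p2:
  fixes p q \<gamma> :: real
  assumes "1 \<le> p" and "p < q" and "1 < \<gamma>"
  shows "\<exists>c_lower c_upper :: real. 0 < c_lower \<and> 0 < c_upper \<and>
    (\<forall>(M :: real) (n :: nat). 0 < M \<longrightarrow> 1 \<le> n \<longrightarrow>
      ennreal (c_lower * M * exp (- sqrt (2 * ln \<gamma> * ln (real n))))
        \<le> (SUP \<mu>\<in>P_exp q \<gamma> M. expected_wasserstein p n \<mu>) \<and>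
      (SUP \<mu>\<in>P_exp q \<gamma> M. expected_wasserstein p n \<mu>)
        \<le> ennreal (c_upper * M * exp (- sqrt (2 * ln \<gamma> * ln (real n)))))"
proof -
  obtain c where c: "0 < c" "\<And>M n. 0 < M \<Longrightarrow> 1 \<le> n \<Longrightarrow>
      \<exists>\<mu>\<in>P_exp q \<gamma> M. ennreal (c * M * decay_rate \<gamma> n) \<le> expected_wasserstein p n \<mu>"
    using lower_bound[OF assms] by blast
  obtain C where C: "0 < C" "\<And>M n \<mu>. 0 < M \<Longrightarrow> 1 \<le> n \<Longrightarrow> \<mu> \<in> P_exp q \<gamma> M \<Longrightarrow>
      expected_wasserstein p n \<mu> \<le> ennreal (C * M * decay_rate \<gamma> n)"
    using upper_bound[OF assms] by blast
  have "ennreal (c * M * decay_rate \<gamma> n) \<le> (SUP \<mu>\<in>P_exp q \<gamma> M. expected_wasserstein p n \<mu>)"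
    if "0 < M" "1 \<le> n" for M n
    using c(2)[OF that] by (auto intro: SUP_upper2)
  moreover have "(SUP \<mu>\<in>P_exp q \<gamma> M. expected_wasserstein p n \<mu>) \<le> ennreal (C * M * decay_rate \<gamma> n)"
    if "0 < M" "1 \<le> n" for M n
    using C(2)[OF that] by (rule SUP_least)
  ultimately show ?thesis
    using c(1) C(1) unfolding decay_rate_def by blast
qed

end
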